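(* Let $q\in\mathbb{C}^*$ be not a root of unity, let $m\ge 1$ be an integer, let $n=3m$, and let $R=\mathcal{O}_q(M_{m,n})$. Let $\sigma$ be a $\mathbb{C}$-algebra automorphism of $R$. Then, for all $i\in\{1,\dots,4m-1\}$ with $i\neq 2m$, there exists $\lambda_i\in\mathbb{C}^*$ such that $\sigma(b_i)=\lambda_ib_i$.
   Context: $R=\mathcal{O}_q(M_{m,n})$ is the $\mathbb{C}$-algebra generated by $Y_{i,\alpha}$, $1\le i\le m$, $1\le\alpha\le n$, subject to: $Y_{i,\beta}Y_{i,\alpha}=q^{-1}Y_{i,\alpha}Y_{i,\beta}$ for $\alpha<\beta$; $Y_{j,\alpha}Y_{i,\alpha}=q^{-1}Y_{i,\alpha}Y_{j,\alpha}$ for $i<j$; $Y_{j,\beta}Y_{i,\alpha}=Y_{i,\alpha}Y_{j,\beta}$ for $i<j$, $\alpha>\beta$; $Y_{j,\beta}Y_{i,\alpha}=Y_{i,\alpha}Y_{j,\beta}-(q-q^{-1})Y_{i,\beta}Y_{j,\alpha}$ for $i<j$, $\alpha<\beta$. Quantum minors: for $I=\{i_1<\dots<i_t\}\subseteq\{1,\dots,m\}$ and $\Gamma=\{\gamma_1<\dots<\gamma_t\}\subseteq\{1,\dots,n\}$, $[I\mid\Gamma]=\sum_{\sigma\in S_t}(-q)^{\ell(\sigma)}Y_{i_1,\gamma_{\sigma(1)}}\cdots Y_{i_t,\gamma_{\sigma(t)}}$, with $\ell$ the usual length function. For $1\le i\le m+n-1$: $b_i=[1,\dots,i\mid n-i+1,\dots,n]$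 if $1\le i\le m$; $b_i=[1,\dots,m\mid n-i+1,\dots,n+m-i]$ if $m<i\le n$; $b_i=[i-n+1,\dots,m\mid 1,\dots,m+n-i]$ if $n<i\le m+n-1$. *)

theory Defs
  imports Complex_Main "HOL-Library.Poly_Mapping" "HOL-Combinatorics.Permutations"
    "HOL-Algebra.QuotRing" "HOL-Algebra.Module"
begin

text \<open>The free monoid on \<open>'a\<close>, written additively, so that \<open>'a word \<Rightarrow>\<^sub>0 complex\<close> with the convolution
  product of \<^theory>\<open>HOL-Library.Poly_Mapping\<close> is the free associative \<open>complex\<close>-algebra on \<open>'a\<close>.
  The wrapper around lists avoids an instance on the type of lists itself.\<close>

datatype 'a word = Word (letters: "'a list")

instantiation word :: (type) monoid_add
begin

definition zero_word :: "'a word" where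
  "0 = Word []"

definition plus_word :: "'a word \<Rightarrow> 'a word \<Rightarrow> 'a word" where
  "u + v = Word (letters u @ letters v)"

instance
  by standard (simp_all add: zero_word_def plus_word_def)

end

type_synonym qm_free = "(nat \<times> nat) word \<Rightarrow>\<^sub>0 complex"

definition scal :: "complex \<Rightarrow> qm_free" where
  "scal c = Poly_Mapping.single 0 c"

definition gen :: "nat \<Rightarrow> nat \<Rightarrow> qm_free" where
  "gen i \<alpha> = Poly_Mapping.single (Word [(i, \<alpha>)]) 1"

definition free_alg :: "nat \<Rightarrow> nat \<Rightarrow> qm_free ring" where
  "free_alg m n =
    \<lparr>carrier = {p. \<forall>w \<in> Poly_Mapping.keys p. set (letters w) \<subseteq> {1..m} \<times> {1..n}},
     mult = (*), one = 1, zero = 0, add = (+)\<rparr>"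

definition qm_relations :: "complex \<Rightarrow> nat \<Rightarrow> nat \<Rightarrow> qm_free set" where
  "qm_relations q m n =
     {gen i \<beta> * gen i \<alpha> - scal (inverse q) * gen i \<alpha> * gen i \<beta> | i \<alpha> \<beta>.
        i \<in> {1..m} \<and> \<alpha> \<in> {1..n} \<and> \<beta> \<in> {1..n} \<and> \<alpha> < \<beta>} \<union>
     {gen j \<alpha> * gen i \<alpha> - scal (inverse q) * gen i \<alpha> * gen j \<alpha> | i j \<alpha>.
        i \<in> {1..m} \<and> j \<in> {1..m} \<and> \<alpha> \<in> {1..n} \<and> i < j} \<union>
     {gen j \<beta> * gen i \<alpha> - gen i \<alpha> * gen j \<beta> | i j \<alpha> \<beta>.
        i \<in> {1..m} \<and> j \<in> {1..m} \<and> \<alpha> \<in> {1..n} \<and> \<beta> \<in> {1..n} \<and> i < j \<and> \<alpha> > \<beta>} \<union>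
     {gen j \<beta> * gen i \<alpha> - (gen i \<alpha> * gen j \<beta> - scal (q - inverse q) * gen i \<beta> * gen j \<alpha>) | i j \<alpha> \<beta>.
        i \<in> {1..m} \<and> j \<in> {1..m} \<and> \<alpha> \<in> {1..n} \<and> \<beta> \<in> {1..n} \<and> i < j \<and> \<alpha> < \<beta>}"

text \<open>In \<open>HOL-Algebra\<close>, \<open>Idl\<close> is the two-sided ideal generated by a set.\<close>

definition qm_ideal :: "complex \<Rightarrow> nat \<Rightarrow> nat \<Rightarrow> qm_free set" where
  "qm_ideal q m n = Idl\<^bsub>free_alg m n\<^esub> (qm_relations q m n)"

definition qm_class :: "complex \<Rightarrow> nat \<Rightarrow> nat \<Rightarrow> qm_free \<Rightarrow> qm_free set" where
  "qm_class q m n p = qm_ideal q m n +>\<^bsub>free_alg m n\<^esub> p"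

text \<open>The algebra of quantum \<open>m \<times> n\<close> matrices. The \<open>module\<close> record only serves to carry the scalar
  multiplication along with the ring structure; \<open>smult\<close> is defined on cosets in the style of
  \<open>rcoset_mult\<close>, see \<open>qm_smult_class\<close> below.\<close>

definition Oq :: "complex \<Rightarrow> nat \<Rightarrow> nat \<Rightarrow> (complex, qm_free set) module" where
  "Oq q m n = (let Q = free_alg m n Quot qm_ideal q m n in
    \<lparr>carrier = carrier Q, mult = mult Q, one = one Q, zero = zero Q, add = add Q,
     smult = (\<lambda>c X. \<Union>x\<in>X. qm_class q m n (scal c * x))\<rparr>)"

definition algebra_auto :: "(complex, 'a, 'b) module_scheme \<Rightarrow> ('a \<Rightarrow> 'a) set" where
  "algebra_auto A =
    {\<sigma> \<in> ring_iso A A. \<forall>c. \<forall>x \<in> carrier A. \<sigma> (c \<odot>\<^bsub>A\<^esub> x) = c \<odot>\<^bsub>A\<^esub> \<sigma> x}"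

definition perm_length :: "nat \<Rightarrow> (nat \<Rightarrow> nat) \<Rightarrow> nat" where
  "perm_length t \<pi> = card {(a, b). a < b \<and> b < t \<and> \<pi> b < \<pi> a}"

text \<open>Positions \<open>1, \<dots>, t\<close> are shifted to \<open>0, \<dots>, t - 1\<close>, as for list indices; the product is taken in
  increasing order of rows. Only meaningful when \<open>I\<close> and \<open>\<Gamma>\<close> are finite of equal cardinality.\<close>

definition free_minor :: "complex \<Rightarrow> nat set \<Rightarrow> nat set \<Rightarrow> qm_free" where
  "free_minor q I \<Gamma> =
    (\<Sum>\<pi> | \<pi> permutes {..<card I}. scal ((- q) ^ perm_length (card I) \<pi>) *
       prod_list (map (\<lambda>k. gen (sorted_list_of_set I ! k) (sorted_list_of_set \<Gamma> ! \<pi> k)) [0..<card I]))"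

definition quantum_minor :: "complex \<Rightarrow> nat \<Rightarrow> nat \<Rightarrow> nat set \<Rightarrow> nat set \<Rightarrow> qm_free set" where
  "quantum_minor q m n I \<Gamma> = qm_class q m n (free_minor q I \<Gamma>)"

text \<open>For \<open>m \<le> n\<close> and \<open>1 \<le> i \<le> m + n - 1\<close>; in that range no truncated subtraction occurs.\<close>

definition b_minor :: "complex \<Rightarrow> nat \<Rightarrow> nat \<Rightarrow> nat \<Rightarrow> qm_free set" where
  "b_minor q m n i =
    (if i \<le> m then quantum_minor q m n {1..i} {n - i + 1..n}
     else if i \<le> n then quantum_minor q m n {1..m} {n - i + 1..n + m - i}
     else quantum_minor q m n {i - n + 1..m} {1..m + n - i})"

lemma scal_closed: "scal c \<in> carrier (free_alg m n)"
  by (auto simp: scal_def free_alg_def zero_word_def)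

lemma gen_closed: "i \<in> {1..m} \<Longrightarrow> \<alpha> \<in> {1..n} \<Longrightarrow> gen i \<alpha> \<in> carrier (free_alg m n)"
  by (auto simp: gen_def free_alg_def)

lemma free_alg_plus:
  "x \<in> carrier (free_alg m n) \<Longrightarrow> y \<in> carrier (free_alg m n) \<Longrightarrow> x + y \<in> carrier (free_alg m n)"
  using keys_add[of x y] unfolding free_alg_def by (simp, blast)

lemma free_alg_minus:
  "x \<in> carrier (free_alg m n) \<Longrightarrow> y \<in> carrier (free_alg m n) \<Longrightarrow> x - y \<in> carrier (free_alg m n)"
  using keys_diff[of x y] unfolding free_alg_def by (simp, blast)

lemma free_alg_times:
  "x \<in> carrier (free_alg m n) \<Longrightarrow> y \<in> carrier (free_alg m n) \<Longrightarrow> x * y \<in> carrier (free_alg m n)"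
proof -
  assume xy: "x \<in> carrier (free_alg m n)" "y \<in> carrier (free_alg m n)"
  have "set (letters w) \<subseteq> {1..m} \<times> {1..n}" if w: "w \<in> Poly_Mapping.keys (x * y)" for w
  proof -
    obtain u v where "w = u + v" "u \<in> Poly_Mapping.keys x" "v \<in> Poly_Mapping.keys y"
      using keys_mult[of x y] w by blast
    then show ?thesis
      using xy by (simp add: free_alg_def plus_word_def)
  qed
  then show ?thesis by (simp add: free_alg_def)
qed

lemma free_alg_simps:
  "x \<otimes>\<^bsub>free_alg m n\<^esub> y = x * y" "\<one>\<^bsub>free_alg m n\<^esub> = 1"
  "\<zero>\<^bsub>free_alg m n\<^esub> = 0" "x \<oplus>\<^bsub>free_alg m n\<^esub> y = x + y"
  by (simp_all add: free_alg_def)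

lemma free_alg_zero: "0 \<in> carrier (free_alg m n)"
  by (simp add: free_alg_def)

lemma free_alg_one: "1 \<in> carrier (free_alg m n)"
  using scal_closed[of 1 m n] by (simp add: scal_def)

lemma ring_free_alg: "ring (free_alg m n)"
proof (rule ringI)
  show "abelian_group (free_alg m n)"
  proof (rule abelian_groupI)
    fix x assume x: "x \<in> carrier (free_alg m n)"
    show "\<exists>y\<in>carrier (free_alg m n). y \<oplus>\<^bsub>free_alg m n\<^esub> x = \<zero>\<^bsub>free_alg m n\<^esub>"
      using free_alg_minus[OF free_alg_zero x]
      by (intro bexI[of _ "0 - x"]) (simp_all only: free_alg_simps diff_add_cancel)
  qed (simp_all add: free_alg_simps free_alg_plus free_alg_zero ac_simps)
  show "Group.monoid (free_alg m n)"
    by (rule Group.monoidI) (simp_all add: free_alg_simps free_alg_times free_alg_one mult.assoc)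
qed (simp_all add: free_alg_simps distrib_left distrib_right)

lemma qm_relations_closed: "qm_relations q m n \<subseteq> carrier (free_alg m n)"
  unfolding qm_relations_def
  by (auto intro!: free_alg_minus free_alg_times gen_closed scal_closed)

lemma ideal_qm_ideal: "ideal (qm_ideal q m n) (free_alg m n)"
  unfolding qm_ideal_def by (rule ring.genideal_ideal[OF ring_free_alg qm_relations_closed])

lemma Oq_simps:
  "carrier (Oq q m n) = carrier (free_alg m n Quot qm_ideal q m n)"
  "mult (Oq q m n) = mult (free_alg m n Quot qm_ideal q m n)"
  "one (Oq q m n) = one (free_alg m n Quot qm_ideal q m n)"
  "zero (Oq q m n) = zero (free_alg m n Quot qm_ideal q m n)"
  "add (Oq q m n) = add (free_alg m n Quot qm_ideal q m n)"
  by (simp_all add: Oq_def Let_def)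

lemma ring_Oq: "ring (Oq q m n)"
proof -
  interpret Q: ring "free_alg m n Quot qm_ideal q m n"
    by (rule ideal.quotient_is_ring[OF ideal_qm_ideal])
  show ?thesis
  proof (rule ringI)
    show "abelian_group (Oq q m n)"
    proof (rule abelian_groupI)
      fix x assume x: "x \<in> carrier (Oq q m n)"
      then show "\<exists>y\<in>carrier (Oq q m n). y \<oplus>\<^bsub>Oq q m n\<^esub> x = \<zero>\<^bsub>Oq q m n\<^esub>"
        unfolding Oq_simps using Q.l_neg Q.a_inv_closed by blast
    qed (simp_all add: Oq_simps Q.add.m_ac)
    show "Group.monoid (Oq q m n)"
      by (rule Group.monoidI) (simp_all add: Oq_simps Q.m_assoc)
  qed (simp_all add: Oq_simps Q.l_distr Q.r_distr)
qed

lemma qm_class_eq_iff: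
  assumes x: "x \<in> carrier (free_alg m n)" and y: "y \<in> carrier (free_alg m n)"
  shows "qm_class q m n x = qm_class q m n y \<longleftrightarrow> x - y \<in> qm_ideal q m n"
proof -
  interpret ideal "qm_ideal q m n" "free_alg m n" by (rule ideal_qm_ideal)
  have "\<ominus>\<^bsub>free_alg m n\<^esub> y = 0 - y"
    by (rule minus_equality)
      (use y free_alg_minus[OF free_alg_zero y] in \<open>simp_all add: free_alg_simps\<close>)
  then have "x \<ominus>\<^bsub>free_alg m n\<^esub> y = x - y"
    by (simp add: a_minus_def free_alg_simps)
  then show ?thesis
    using quotient_eq_iff_same_a_r_cos[OF ideal_qm_ideal x y] by (auto simp: qm_class_def)
qed

lemma qm_smult_class:
  assumes x: "x \<in> carrier (free_alg m n)"
  shows "c \<odot>\<^bsub>Oq q m n\<^esub> qm_class q m n x = qm_class q m n (scal c * x)"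
proof -
  interpret ideal "qm_ideal q m n" "free_alg m n" by (rule ideal_qm_ideal)
  have "qm_class q m n (scal c * y) = qm_class q m n (scal c * x)" if y: "y \<in> qm_class q m n x" for y
  proof -
    obtain h where h: "h \<in> qm_ideal q m n" "y = h + x"
      using y unfolding qm_class_def a_r_coset_def' free_alg_simps by blast
    have hc: "h \<in> carrier (free_alg m n)" using h(1) by (rule a_Hcarr)
    have "scal c * y - scal c * x = scal c * h"
      by (simp add: h(2) distrib_left)
    also have "scal c * h \<in> qm_ideal q m n"
      using I_l_closed[OF h(1) scal_closed[of c m n]] by (simp only: free_alg_simps)
    finally have "scal c * y - scal c * x \<in> qm_ideal q m n" .
    moreover have "y \<in> carrier (free_alg m n)"
      unfolding h(2) by (rule free_alg_plus[OF hc x])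
    ultimately show ?thesis
      using qm_class_eq_iff[OF free_alg_times[OF scal_closed] free_alg_times[OF scal_closed x]] by simp
  qed
  moreover have "x \<in> qm_class q m n x"
    unfolding qm_class_def by (rule a_rcos_self[OF x])
  ultimately have "(\<Union>y\<in>qm_class q m n x. qm_class q m n (scal c * y)) = qm_class q m n (scal c * x)"
    by blast
  then show ?thesis
    unfolding Oq_def Let_def by simp
qed

end

theory Submission
  imports Defs "HOL-Combinatorics.Multiset_Permutations" "HOL-Library.Product_Lexorder"
begin

text \<open>
  Quantum matrices embed into a quantum torus, so that every nonzero element has a leading exponent and
  leading exponents add up under multiplication. Conjugation by a normal element \<open>z\<close> rescales each generator,
  and the relations force the rescaling factors to have the form \<open>f i * g \<alpha>\<close>; since a mixed second difference
  of their logarithms computes differences of entries of the leading exponent, this exponent is constant along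
  diagonals. The minors \<open>b\<^sub>k\<close> are normal, and their leading exponents are the indicators of the diagonals.
  An automorphism \<open>\<sigma>\<close> has no constant terms on generators, and its linear part conjugates the rescaling by
  \<open>b\<^sub>k\<close> into the rescaling by the normal element \<open>\<sigma>(b\<^sub>k)\<close>. Thus both have the same eigenvalues with the same
  multiplicities, which for \<open>n = 3 m\<close> and \<open>k \<noteq> 2 m\<close> only leaves the \<open>k\<close>-th diagonal as leading exponent of
  \<open>\<sigma>(b\<^sub>k)\<close>. The same applies to \<open>\<sigma>(b\<^sub>k) - \<lambda> b\<^sub>k\<close>, whose leading exponent is smaller for the right \<open>\<lambda>\<close>, unless
  it vanishes.
\<close>

section \<open>Quantum minors\<close>

text \<open>The algebra is given only as a quotient of a free algebra, so it is not clear beforehand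
  that sorted words are independent in it. The embedding settles this: Cauchon's deleting
  derivations algorithm is run backwards from the torus, where only monomials are inverted, and each
  step adds terms of lexicographically smaller exponent. Straightening shows that sorted words span;
  their distinct leading exponents show that they are independent. The automorphism is not assumed
  to be graded, so nothing is known directly about leading exponents of its values. What survives
  are the multiplicities of the eigenvalues of conjugation, and as \<open>q\<close> is not a root of
  unity, an eigenvalue \<open>q powi e\<close> determines \<open>e\<close>. The exponents at two
  opposite corners leave, besides zero, a single diagonal or the sum of the diagonals
  \<open>m\<close> and \<open>n\<close>. For \<open>n = 3 * m\<close> this sum, the leading exponent
  of the product of \<open>b m\<close> and \<open>b n\<close>, has the same multiplicities as the
  diagonal \<open>2 * m\<close>; this is where the excluded index comes from.\<close>

class complex_alg = ring_1 +
  fixes cscale :: "complex \<Rightarrow> 'a \<Rightarrow> 'a" (infixr "*\<^sub>c" 75)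
  assumes cscale_add_right: "c *\<^sub>c (x + y) = c *\<^sub>c x + c *\<^sub>c y"
    and cscale_add_left: "(c + d) *\<^sub>c x = c *\<^sub>c x + d *\<^sub>c x"
    and cscale_cscale [simp]: "c *\<^sub>c d *\<^sub>c x = (c * d) *\<^sub>c x"
    and cscale_one [simp]: "1 *\<^sub>c x = x"
    and mult_cscale_left [simp]: "(c *\<^sub>c x) * y = c *\<^sub>c (x * y)"
    and mult_cscale_right [simp]: "x * (c *\<^sub>c y) = c *\<^sub>c (x * y)"
begin

lemma cscale_zero_right [simp]: "c *\<^sub>c 0 = 0"
  using cscale_add_right[of c 0 0] by simp

lemma cscale_zero_left [simp]: "0 *\<^sub>c x = 0"
  using cscale_add_left[of 0 0 x] by simp

lemma cscale_minus_right [simp]: "c *\<^sub>c (- x) = - (c *\<^sub>c x)"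
  using cscale_add_right[of c x "- x"] by (simp add: eq_neg_iff_add_eq_0 add.commute)

lemma cscale_minus_left [simp]: "(- c) *\<^sub>c x = - (c *\<^sub>c x)"
  using cscale_add_left[of c "- c" x] by (simp add: eq_neg_iff_add_eq_0 add.commute)

lemma cscale_diff_right: "c *\<^sub>c (x - y) = c *\<^sub>c x - c *\<^sub>c y"
  using cscale_add_right[of c x "- y"] by simp

lemma cscale_diff_left: "(c - d) *\<^sub>c x = c *\<^sub>c x - d *\<^sub>c x"
  using cscale_add_left[of c "- d" x] by simp

lemma cscale_sum_right: "c *\<^sub>c (\<Sum>a\<in>A. f a) = (\<Sum>a\<in>A. c *\<^sub>c f a)"
  by (induction A rule: infinite_finite_induct) (simp_all add: cscale_add_right)

lemma cscale_sum_left: "(\<Sum>a\<in>A. f a) *\<^sub>c x = (\<Sum>a\<in>A. f a *\<^sub>c x)"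
  by (induction A rule: infinite_finite_induct) (simp_all add: cscale_add_left)

lemma cscale_eq_0_iff [simp]: "c *\<^sub>c x = 0 \<longleftrightarrow> c = 0 \<or> x = 0"
proof
  assume "c *\<^sub>c x = 0"
  then have "c \<noteq> 0 \<Longrightarrow> x = 0"
    using cscale_cscale[of "inverse c" c x] by simp
  then show "c = 0 \<or> x = 0" by blast
qed auto

lemma cscale_left_cancel: "c \<noteq> 0 \<Longrightarrow> c *\<^sub>c x = c *\<^sub>c y \<longleftrightarrow> x = y"
  using cscale_eq_0_iff[of c "x - y"] by (simp add: cscale_diff_right)

end

text \<open>In a permutation sum built row by row, \<open>below \<gamma> \<Gamma>\<close> counts the
  inversions caused by using column \<open>\<gamma>\<close> first among \<open>\<Gamma>\<close>, and
  \<open>above\<close> those caused by using it last.\<close>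

definition below :: "nat \<Rightarrow> nat set \<Rightarrow> nat" where
  "below x A = card {y \<in> A. y < x}"

definition above :: "nat \<Rightarrow> nat set \<Rightarrow> nat" where
  "above x A = card {y \<in> A. x < y}"

lemma below_remove:
  assumes "finite A" "y \<in> A"
  shows "below x A = below x (A - {y}) + (if y < x then 1 else 0)"
proof (cases "y < x")
  case True
  then have "{z \<in> A. z < x} = insert y {z \<in> A - {y}. z < x}" using assms by auto
  then show ?thesis using assms True by (simp add: below_def)
next
  case False
  then have "{z \<in> A. z < x} = {z \<in> A - {y}. z < x}" by auto
  then show ?thesis using False by (simp add: below_def)
qed

lemma above_remove:
  assumes "finite A" "y \<in> A"
  shows "above x A = above x (A - {y}) + (if x < y then 1 else 0)"
proof (cases "x < y")
  case True
  then have "{z \<in> A. x < z} = insert y {z \<in> A - {y}. x < z}" using assms by auto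
  then show ?thesis using assms True by (simp add: above_def)
next
  case False
  then have "{z \<in> A. x < z} = {z \<in> A - {y}. x < z}" by auto
  then show ?thesis using False by (simp add: above_def)
qed

lemma below_plus_above:
  assumes "finite A" "x \<in> A"
  shows "below x A + above x A = card A - 1"
proof -
  have "A - {x} = {y \<in> A. y < x} \<union> {y \<in> A. x < y}" by auto
  moreover have "card ({y \<in> A. y < x} \<union> {y \<in> A. x < y}) = below x A + above x A"
    unfolding below_def above_def by (rule card_Un_disjoint) (use assms in auto)
  ultimately show ?thesis using assms by (metis card_Diff_singleton)
qed

lemma below_remove_Min: "finite A \<Longrightarrow> x \<in> A \<Longrightarrow> (\<And>y. y \<in> A \<Longrightarrow> x \<le> y) \<Longrightarrow> below x A = 0"
  by (auto simp: below_def dest!: leD)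

lemma sum_pairs_swap:
  assumes "finite A"
  shows "(\<Sum>x\<in>A. \<Sum>y\<in>A - {x}. f x y) = (\<Sum>y\<in>A. \<Sum>x\<in>A - {y}. f x y)"
proof -
  have 1: "(\<Sum>x\<in>A. \<Sum>y\<in>A - {x}. f x y) = (\<Sum>x\<in>A. \<Sum>y | y \<in> A \<and> x \<noteq> y. f x y)"
    by (intro sum.cong) auto
  have 2: "(\<Sum>y\<in>A. \<Sum>x\<in>A - {y}. f x y) = (\<Sum>y\<in>A. \<Sum>x | x \<in> A \<and> x \<noteq> y. f x y)"
    by (intro sum.cong) auto
  show ?thesis
    unfolding 1 2 by (rule sum.swap_restrict[OF assms assms])
qed

lemma sum_pairs_ordered:
  fixes f :: "'a::linorder \<Rightarrow> 'a \<Rightarrow> 'b::comm_monoid_add"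
  assumes "finite A"
  shows "(\<Sum>x\<in>A. \<Sum>y\<in>A - {x}. f x y) = (\<Sum>a\<in>A. \<Sum>b | b \<in> A \<and> a < b. f a b + f b a)"
proof -
  have "(\<Sum>x\<in>A. \<Sum>y\<in>A - {x}. f x y) = (\<Sum>x\<in>A. (\<Sum>y | y \<in> A \<and> x < y. f x y) + (\<Sum>y | y \<in> A \<and> y < x. f x y))"
  proof (rule sum.cong)
    fix x assume "x \<in> A"
    have *: "A - {x} = {y. y \<in> A \<and> x < y} \<union> {y. y \<in> A \<and> y < x}" by auto
    show "(\<Sum>y\<in>A - {x}. f x y) = (\<Sum>y | y \<in> A \<and> x < y. f x y) + (\<Sum>y | y \<in> A \<and> y < x. f x y)"
      unfolding * by (rule sum.union_disjoint) (use assms in auto)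
  qed simp
  also have "\<dots> = (\<Sum>a\<in>A. \<Sum>b | b \<in> A \<and> a < b. f a b) + (\<Sum>x\<in>A. \<Sum>y | y \<in> A \<and> y < x. f x y)"
    by (simp add: sum.distrib)
  also have "(\<Sum>x\<in>A. \<Sum>y | y \<in> A \<and> y < x. f x y) = (\<Sum>a\<in>A. \<Sum>b | b \<in> A \<and> a < b. f b a)"
    by (rule sum.swap_restrict[OF assms assms])
  finally show ?thesis by (simp add: sum.distrib)
qed

lemma sorted_split_at:
  assumes "sorted is" "distinct is" "k \<in> set is"
  obtains xs ys where "is = xs @ k # ys" "remove1 k is = xs @ ys" "\<forall>x\<in>set xs. x < k" "\<forall>y\<in>set ys. k < y"
    "length xs = below k (set is)" "length ys = above k (set is)"
proof -
  obtain xs ys where eq: "is = xs @ k # ys" using assms by (meson split_list)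
  have lt: "\<forall>x\<in>set xs. x < k" "\<forall>y\<in>set ys. k < y"
    using assms by (auto simp: eq sorted_append le_less)
  have "{y \<in> set is. y < k} = set xs" "{y \<in> set is. k < y} = set ys" using lt by (auto simp: eq)
  then have "length xs = below k (set is)" "length ys = above k (set is)"
    using assms by (simp_all add: below_def above_def distinct_card eq)
  moreover have "remove1 k is = xs @ ys" using lt by (auto simp: eq remove1_append)
  ultimately show ?thesis using that eq lt by blast
qed

text \<open>The quantum minor by Laplace expansion along its first row. Rows form a list, which may
  be unsorted or have repetitions, so that row operations can be stated; columns form a set.
  Agreement with the sum over permutations is shown in \<open>qdet_expand\<close>.\<close>

fun qdet :: "complex \<Rightarrow> (nat \<Rightarrow> nat \<Rightarrow> 'a::complex_alg) \<Rightarrow> nat list \<Rightarrow> nat set \<Rightarrow> 'a" where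
  "qdet q Y [] \<Gamma> = (if \<Gamma> = {} then 1 else 0)"
| "qdet q Y (i # is) \<Gamma> = (\<Sum>\<gamma>\<in>\<Gamma>. (- q) ^ below \<gamma> \<Gamma> *\<^sub>c (Y i \<gamma> * qdet q Y is (\<Gamma> - {\<gamma>})))"

text \<open>Expanding along the first and the last row at once gives a double sum over two distinct
  columns. Which of the two is removed first does not matter, and this turns expansion along the
  first row into expansion along the last.\<close>

lemma qdet_snoc:
  assumes "finite \<Gamma>"
  shows "qdet q Y (is @ [i]) \<Gamma> = (\<Sum>\<gamma>\<in>\<Gamma>. (- q) ^ above \<gamma> \<Gamma> *\<^sub>c (qdet q Y is (\<Gamma> - {\<gamma>}) * Y i \<gamma>))"
  using assms
proof (induction "is" arbitrary: \<Gamma>)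
  case Nil
  have "(- q) ^ below \<gamma> \<Gamma> *\<^sub>c (Y i \<gamma> * (if \<Gamma> - {\<gamma>} = {} then 1 else 0)) =
    (- q) ^ above \<gamma> \<Gamma> *\<^sub>c ((if \<Gamma> - {\<gamma>} = {} then 1 else 0) * Y i \<gamma>)" if "\<gamma> \<in> \<Gamma>" for \<gamma>
  proof (cases "\<Gamma> - {\<gamma>} = {}")
    case True
    then have "\<Gamma> = {\<gamma>}" using that by auto
    then have "below \<gamma> \<Gamma> = 0" "above \<gamma> \<Gamma> = 0" by (auto simp: below_def above_def)
    then show ?thesis by simp
  qed auto
  then show ?case by (auto intro!: sum.cong)
next
  case (Cons j js)
  let ?t = "\<lambda>\<gamma> \<delta>. (- q) ^ (below \<gamma> \<Gamma> + above \<delta> (\<Gamma> - {\<gamma>})) *\<^sub>c (Y j \<gamma> * qdet q Y js (\<Gamma> - {\<gamma>} - {\<delta>}) * Y i \<delta>)"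
  let ?u = "\<lambda>\<gamma> \<delta>. (- q) ^ (above \<delta> \<Gamma> + below \<gamma> (\<Gamma> - {\<delta>})) *\<^sub>c (Y j \<gamma> * qdet q Y js (\<Gamma> - {\<delta>} - {\<gamma>}) * Y i \<delta>)"
  \<comment> \<open>If \<open>\<delta> < \<gamma>\<close>, removing the other column lowers
    \<open>below \<gamma>\<close> and \<open>above \<delta>\<close> by one each; otherwise neither
    changes. So the total exponent is the same for both orders of removal.\<close>
  have eq: "?t \<gamma> \<delta> = ?u \<gamma> \<delta>" if "\<gamma> \<in> \<Gamma>" "\<delta> \<in> \<Gamma> - {\<gamma>}" for \<gamma> \<delta>
  proof -
    have "\<Gamma> - {\<gamma>} - {\<delta>} = \<Gamma> - {\<delta>} - {\<gamma>}" by auto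
    moreover have "below \<gamma> \<Gamma> + above \<delta> (\<Gamma> - {\<gamma>}) = above \<delta> \<Gamma> + below \<gamma> (\<Gamma> - {\<delta>})"
      using below_remove[of \<Gamma> \<delta> \<gamma>] above_remove[of \<Gamma> \<gamma> \<delta>] that Cons.prems by auto
    ultimately show ?thesis by simp
  qed
  have "qdet q Y ((j # js) @ [i]) \<Gamma> = (\<Sum>\<gamma>\<in>\<Gamma>. \<Sum>\<delta>\<in>\<Gamma> - {\<gamma>}. ?t \<gamma> \<delta>)"
    using Cons by (simp add: sum_distrib_left cscale_sum_right power_add mult.assoc)
  also have "\<dots> = (\<Sum>\<gamma>\<in>\<Gamma>. \<Sum>\<delta>\<in>\<Gamma> - {\<gamma>}. ?u \<gamma> \<delta>)"
    by (intro sum.cong refl eq)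
  also have "\<dots> = (\<Sum>\<delta>\<in>\<Gamma>. \<Sum>\<gamma>\<in>\<Gamma> - {\<delta>}. ?u \<gamma> \<delta>)"
    by (rule sum_pairs_swap[OF Cons.prems])
  also have "\<dots> = (\<Sum>\<gamma>\<in>\<Gamma>. (- q) ^ above \<gamma> \<Gamma> *\<^sub>c (qdet q Y (j # js) (\<Gamma> - {\<gamma>}) * Y i \<gamma>))"
    by (simp add: sum_distrib_right cscale_sum_right power_add mult.assoc)
  finally show ?case .
qed

text \<open>Grouping the column pairs \<open>(a, b)\<close> and \<open>(b, a)\<close> makes the
  dependence on the first two rows a 2 by 2 minor, so that relations between two rows reduce to that
  size.\<close>

lemma qdet_Cons_Cons:
  assumes "finite \<Gamma>"
  shows "qdet q Y (i # j # is) \<Gamma> = (\<Sum>a\<in>\<Gamma>. \<Sum>b | b \<in> \<Gamma> \<and> a < b.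
    (- q) ^ (below a \<Gamma> + below b (\<Gamma> - {a})) *\<^sub>c ((Y i a * Y j b - q *\<^sub>c (Y i b * Y j a)) * qdet q Y is (\<Gamma> - {a, b})))"
proof -
  let ?t = "\<lambda>\<gamma> \<delta>. (- q) ^ (below \<gamma> \<Gamma> + below \<delta> (\<Gamma> - {\<gamma>})) *\<^sub>c (Y i \<gamma> * Y j \<delta> * qdet q Y is (\<Gamma> - {\<gamma>, \<delta>}))"
  have del: "\<Gamma> - {a} - {b} = \<Gamma> - {a, b}" for a b by auto
  have "qdet q Y (i # j # is) \<Gamma> = (\<Sum>\<gamma>\<in>\<Gamma>. \<Sum>\<delta>\<in>\<Gamma> - {\<gamma>}. ?t \<gamma> \<delta>)"
    by (simp add: sum_distrib_left cscale_sum_right power_add mult.assoc del)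
  also have "\<dots> = (\<Sum>a\<in>\<Gamma>. \<Sum>b | b \<in> \<Gamma> \<and> a < b. ?t a b + ?t b a)"
    by (rule sum_pairs_ordered[OF assms])
  also have "\<dots> = (\<Sum>a\<in>\<Gamma>. \<Sum>b | b \<in> \<Gamma> \<and> a < b.
    (- q) ^ (below a \<Gamma> + below b (\<Gamma> - {a})) *\<^sub>c ((Y i a * Y j b - q *\<^sub>c (Y i b * Y j a)) * qdet q Y is (\<Gamma> - {a, b})))"
  proof (intro sum.cong refl)
    fix a b assume ab: "a \<in> \<Gamma>" "b \<in> {b. b \<in> \<Gamma> \<and> a < b}"
    have N: "below b \<Gamma> + below a (\<Gamma> - {b}) = Suc (below a \<Gamma> + below b (\<Gamma> - {a}))"
      using below_remove[of \<Gamma> b a] below_remove[of \<Gamma> a b] ab assms by auto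
    have "\<Gamma> - {b, a} = \<Gamma> - {a, b}" by auto
    with N show "?t a b + ?t b a = (- q) ^ (below a \<Gamma> + below b (\<Gamma> - {a})) *\<^sub>c
      ((Y i a * Y j b - q *\<^sub>c (Y i b * Y j a)) * qdet q Y is (\<Gamma> - {a, b}))"
      by (simp add: left_diff_distrib cscale_diff_right mult.commute)
  qed
  finally show ?thesis .
qed

lemma qdet_commute:
  assumes "\<And>i \<gamma>. i \<in> set is \<Longrightarrow> \<gamma> \<in> \<Gamma> \<Longrightarrow> Y i \<gamma> * y = y * Y i \<gamma>"
  shows "qdet q Y is \<Gamma> * y = y * qdet q Y is \<Gamma>"
  using assms
proof (induction "is" arbitrary: \<Gamma>)
  case (Cons i "is")
  have "Y i \<gamma> * qdet q Y is (\<Gamma> - {\<gamma>}) * y = y * (Y i \<gamma> * qdet q Y is (\<Gamma> - {\<gamma>}))" if "\<gamma> \<in> \<Gamma>" for \<gamma>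
  proof -
    have "qdet q Y is (\<Gamma> - {\<gamma>}) * y = y * qdet q Y is (\<Gamma> - {\<gamma>})"
      by (rule Cons.IH) (use Cons.prems in auto)
    then have "Y i \<gamma> * qdet q Y is (\<Gamma> - {\<gamma>}) * y = Y i \<gamma> * y * qdet q Y is (\<Gamma> - {\<gamma>})"
      by (simp add: mult.assoc)
    also have "Y i \<gamma> * y = y * Y i \<gamma>" using Cons.prems that by simp
    finally show ?thesis by (simp add: mult.assoc)
  qed
  then show ?case by (simp add: sum_distrib_left sum_distrib_right)
qed simp

section \<open>Row operations, transposition and commutation rules for quantum minors\<close>

locale quantum_matrix =
  fixes q :: complex and Y :: "nat \<Rightarrow> nat \<Rightarrow> 'a::complex_alg" and R C :: "nat set"
  assumes q0: "q \<noteq> 0"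
    and row: "\<lbrakk>i \<in> R; \<alpha> \<in> C; \<beta> \<in> C; \<alpha> < \<beta>\<rbrakk> \<Longrightarrow> Y i \<beta> * Y i \<alpha> = inverse q *\<^sub>c (Y i \<alpha> * Y i \<beta>)"
    and col: "\<lbrakk>i \<in> R; j \<in> R; \<alpha> \<in> C; i < j\<rbrakk> \<Longrightarrow> Y j \<alpha> * Y i \<alpha> = inverse q *\<^sub>c (Y i \<alpha> * Y j \<alpha>)"
    and anti: "\<lbrakk>i \<in> R; j \<in> R; \<alpha> \<in> C; \<beta> \<in> C; i < j; \<beta> < \<alpha>\<rbrakk> \<Longrightarrow> Y j \<beta> * Y i \<alpha> = Y i \<alpha> * Y j \<beta>"
    and diag: "\<lbrakk>i \<in> R; j \<in> R; \<alpha> \<in> C; \<beta> \<in> C; i < j; \<alpha> < \<beta>\<rbrakk> \<Longrightarrow>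
      Y j \<beta> * Y i \<alpha> = Y i \<alpha> * Y j \<beta> - (q - inverse q) *\<^sub>c (Y i \<beta> * Y j \<alpha>)"
begin

text \<open>\<open>row\<close> and \<open>col\<close> change places, \<open>anti\<close> is read
  backwards, and in \<open>diag\<close> the two factors of the correction term are swapped, which is
  allowed because they commute by \<open>anti\<close>. Every statement about rows thus has a version
  for columns.\<close>

lemma transpose: "quantum_matrix q (\<lambda>i j. Y j i) C R"
proof
  fix i j \<alpha> \<beta>
  assume *: "i \<in> C" "j \<in> C" "\<alpha> \<in> R" "\<beta> \<in> R" "i < j"
  show "Y \<beta> j * Y \<alpha> i = Y \<alpha> i * Y \<beta> j" if "\<beta> < \<alpha>"
    using anti[of \<beta> \<alpha> j i] * that by simp
  show "Y \<beta> j * Y \<alpha> i = Y \<alpha> i * Y \<beta> j - (q - inverse q) *\<^sub>c (Y \<beta> i * Y \<alpha> j)" if "\<alpha> < \<beta>"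
    using diag[of \<alpha> \<beta> i j] anti[of \<alpha> \<beta> j i] * that by simp
qed (use q0 row col in auto)

lemma qdet_equal_rows:
  assumes "finite \<Gamma>" "\<Gamma> \<subseteq> C" "i \<in> R"
  shows "qdet q Y (i # i # is) \<Gamma> = 0"
proof -
  have "Y i a * Y i b - q *\<^sub>c (Y i b * Y i a) = 0" if "a \<in> \<Gamma>" "b \<in> \<Gamma>" "a < b" for a b
    using that assms q0 row[of i a b] by (auto simp: subset_iff)
  then show ?thesis
    using assms by (simp only: qdet_Cons_Cons) (simp cong: sum.cong_simp)
qed

lemma qdet_swap_rows:
  assumes "finite \<Gamma>" "\<Gamma> \<subseteq> C" "i \<in> R" "j \<in> R" "i < j"
  shows "qdet q Y (j # i # is) \<Gamma> = (- q) *\<^sub>c qdet q Y (i # j # is) \<Gamma>"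
proof -
  have "Y j a * Y i b - q *\<^sub>c (Y j b * Y i a) = (- q) *\<^sub>c (Y i a * Y j b - q *\<^sub>c (Y i b * Y j a))"
    if "a \<in> \<Gamma>" "b \<in> \<Gamma>" "a < b" for a b
  proof -
    have "a \<in> C" "b \<in> C" using that assms by auto
    then have a: "Y j a * Y i b = Y i b * Y j a"
      and d: "Y j b * Y i a = Y i a * Y j b - (q - inverse q) *\<^sub>c (Y i b * Y j a)"
      using that assms by (auto intro: anti diag)
    show ?thesis
      unfolding a d using q0 by (simp add: cscale_diff_right cscale_diff_left right_diff_distrib)
  qed
  then have "qdet q Y (j # i # is) \<Gamma> = (\<Sum>a\<in>\<Gamma>. \<Sum>b | b \<in> \<Gamma> \<and> a < b. (- q) ^ (below a \<Gamma> + below b (\<Gamma> - {a})) *\<^sub>c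
     (((- q) *\<^sub>c (Y i a * Y j b - q *\<^sub>c (Y i b * Y j a))) * qdet q Y is (\<Gamma> - {a, b})))"
    unfolding qdet_Cons_Cons[OF assms(1)] by (intro sum.cong refl) simp
  also have "\<dots> = (- q) *\<^sub>c qdet q Y (i # j # is) \<Gamma>"
    unfolding qdet_Cons_Cons[OF assms(1)] cscale_sum_right
    by (intro sum.cong refl) (simp only: mult_cscale_left cscale_cscale mult.commute)
  finally show ?thesis .
qed

text \<open>For vanishing arguments only the existence of a scalar matters, uniformly in the
  remaining rows and columns; so both orders of the two rows can be treated at once.\<close>

lemma qdet_swap_rows_ex:
  assumes "i \<in> R" "j \<in> R" "i \<noteq> j"
  shows "\<exists>c. \<forall>is \<Gamma>. finite \<Gamma> \<longrightarrow> \<Gamma> \<subseteq> C \<longrightarrow> qdet q Y (j # i # is) \<Gamma> = c *\<^sub>c qdet q Y (i # j # is) \<Gamma>"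
proof (cases "i < j")
  case True
  then show ?thesis using qdet_swap_rows assms by (intro exI[of _ "- q"]) simp
next
  case False
  then have "j < i" using assms by simp
  have "qdet q Y (j # i # is) \<Gamma> = inverse (- q) *\<^sub>c qdet q Y (i # j # is) \<Gamma>"
    if "finite \<Gamma>" "\<Gamma> \<subseteq> C" for "is" \<Gamma>
    unfolding qdet_swap_rows[OF that assms(2,1) \<open>j < i\<close>] cscale_cscale using q0 by simp
  then show ?thesis by blast
qed

text \<open>Row \<open>j\<close> travels to the right by swaps, each costing a scalar, until it
  meets its copy and \<open>qdet_equal_rows\<close> applies.\<close>

lemma qdet_repeated_first:
  assumes "finite \<Gamma>" "\<Gamma> \<subseteq> C" "set is \<subseteq> R" "j \<in> set is"
  shows "qdet q Y (j # is) \<Gamma> = 0"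
  using assms
proof (induction "is" arbitrary: \<Gamma>)
  case (Cons i "is")
  show ?case
  proof (cases "i = j")
    case True
    then show ?thesis using Cons.prems qdet_equal_rows by auto
  next
    case False
    have "i \<in> R" "j \<in> R" using Cons.prems by auto
    obtain c where "\<forall>is \<Gamma>. finite \<Gamma> \<longrightarrow> \<Gamma> \<subseteq> C \<longrightarrow> qdet q Y (j # i # is) \<Gamma> = c *\<^sub>c qdet q Y (i # j # is) \<Gamma>"
      using qdet_swap_rows_ex[OF \<open>i \<in> R\<close> \<open>j \<in> R\<close> False] ..
    then have c: "qdet q Y (j # i # is) \<Gamma> = c *\<^sub>c qdet q Y (i # j # is) \<Gamma>"
      using Cons.prems by simp
    have "qdet q Y (j # is) (\<Gamma> - {\<gamma>}) = 0" for \<gamma>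
      by (rule Cons.IH) (use Cons.prems False in auto)
    then have "qdet q Y (i # j # is) \<Gamma> = 0"
      by (simp only: qdet.simps(2)[of q Y i "j # is"]) simp
    with c show ?thesis by simp
  qed
qed simp

text \<open>Expanding along the first row keeps the repetition unless that row is the only other
  copy of \<open>j\<close>. In this case it is first swapped with its successor, and then the
  expansion applies.\<close>

lemma qdet_repeated_last:
  assumes "finite \<Gamma>" "\<Gamma> \<subseteq> C" "set is \<subseteq> R" "j \<in> set is"
  shows "qdet q Y (is @ [j]) \<Gamma> = 0"
  using assms
proof (induction "length is" arbitrary: "is" \<Gamma> rule: less_induct)
  case less
  then obtain i js where ijs: "is = i # js" by (cases "is") auto
  show ?case
  proof (cases "j \<in> set js")
    case True
    then have "qdet q Y (js @ [j]) (\<Gamma> - {\<gamma>}) = 0" for \<gamma>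
      using less.prems ijs by (intro less.hyps) auto
    then show ?thesis by (simp add: ijs)
  next
    case False
    then have ij: "i = j" using less.prems ijs by simp
    show ?thesis
    proof (cases js)
      case Nil
      then show ?thesis using qdet_equal_rows[of \<Gamma> j "[]"] less.prems ijs ij by simp
    next
      case (Cons k ks)
      have "k \<in> R" "i \<in> R" "k \<noteq> i" using less.prems ijs Cons False ij by auto
      obtain c where "\<forall>is \<Gamma>. finite \<Gamma> \<longrightarrow> \<Gamma> \<subseteq> C \<longrightarrow> qdet q Y (i # k # is) \<Gamma> = c *\<^sub>c qdet q Y (k # i # is) \<Gamma>"
        using qdet_swap_rows_ex[OF \<open>k \<in> R\<close> \<open>i \<in> R\<close> \<open>k \<noteq> i\<close>] ..
      then have c: "qdet q Y (i # k # ks @ [j]) \<Gamma> = c *\<^sub>c qdet q Y (k # i # ks @ [j]) \<Gamma>"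
        using less.prems by simp
      have "qdet q Y ((i # ks) @ [j]) (\<Gamma> - {\<gamma>}) = 0" for \<gamma>
        using less.prems ijs ij Cons by (intro less.hyps) auto
      then have "qdet q Y (k # (i # ks) @ [j]) \<Gamma> = 0"
        by (simp only: qdet.simps(2)[of q Y k]) simp
      then show ?thesis using c by (simp add: ijs Cons)
    qed
  qed
qed

lemma qdet_move_first:
  assumes "finite \<Gamma>" "\<Gamma> \<subseteq> C" "set xs \<subseteq> R" "j \<in> R" "\<forall>x\<in>set xs. x < j"
  shows "qdet q Y (j # xs @ ys) \<Gamma> = (- q) ^ length xs *\<^sub>c qdet q Y (xs @ j # ys) \<Gamma>"
  using assms
proof (induction xs arbitrary: \<Gamma>)
  case (Cons x xs)
  have "qdet q Y (j # x # xs @ ys) \<Gamma> = (- q) *\<^sub>c qdet q Y (x # j # xs @ ys) \<Gamma>"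
    using Cons.prems by (intro qdet_swap_rows) auto
  also have "qdet q Y (x # j # xs @ ys) \<Gamma> = (- q) ^ length xs *\<^sub>c qdet q Y (x # xs @ j # ys) \<Gamma>"
  proof -
    have "qdet q Y (j # xs @ ys) (\<Gamma> - {\<gamma>}) = (- q) ^ length xs *\<^sub>c qdet q Y (xs @ j # ys) (\<Gamma> - {\<gamma>})" for \<gamma>
      using Cons.prems by (intro Cons.IH) auto
    then show ?thesis
      by (simp only: qdet.simps(2)[of q Y x]) (simp add: cscale_sum_right mult.commute del: qdet.simps)
  qed
  finally show ?case by simp
qed simp

lemma qdet_move_last:
  assumes "finite \<Gamma>" "\<Gamma> \<subseteq> C" "set ys \<subseteq> R" "j \<in> R" "\<forall>y\<in>set ys. j < y"
  shows "qdet q Y (xs @ ys @ [j]) \<Gamma> = (- q) ^ length ys *\<^sub>c qdet q Y (xs @ j # ys) \<Gamma>"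
  using assms
proof (induction xs arbitrary: \<Gamma>)
  case Nil
  then show ?case
  proof (induction ys arbitrary: \<Gamma>)
    case (Cons y ys)
    have "qdet q Y (y # ys @ [j]) \<Gamma> = (- q) ^ length ys *\<^sub>c qdet q Y (y # j # ys) \<Gamma>"
    proof -
      have "qdet q Y ([] @ ys @ [j]) (\<Gamma> - {\<gamma>}) = (- q) ^ length ys *\<^sub>c qdet q Y ([] @ j # ys) (\<Gamma> - {\<gamma>})" for \<gamma>
        using Cons.prems by (intro Cons.IH) auto
      then show ?thesis
        by (simp only: qdet.simps(2)[of q Y y]) (simp add: cscale_sum_right mult.commute del: qdet.simps)
    qed
    also have "qdet q Y (y # j # ys) \<Gamma> = (- q) *\<^sub>c qdet q Y (j # y # ys) \<Gamma>"
      using Cons.prems by (intro qdet_swap_rows) auto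
    finally show ?case by (simp add: mult.commute)
  qed simp
next
  case (Cons x xs)
  have "qdet q Y (xs @ ys @ [j]) (\<Gamma> - {\<gamma>}) = (- q) ^ length ys *\<^sub>c qdet q Y (xs @ j # ys) (\<Gamma> - {\<gamma>})" for \<gamma>
    using Cons.prems by (intro Cons.IH) auto
  then show ?case by (simp add: cscale_sum_right mult.commute)
qed

text \<open>Expand along the first row and then the first column, and in the other order. Apart from
  the corner term, both give a double sum over the remaining entries of the first row and column
  times complementary minors. The two outer entries commute by \<open>anti\<close>, and the smaller
  minors agree by induction.\<close>

lemma qdet_transpose:
  assumes "sorted is" "distinct is" "set is \<subseteq> R" "sorted js" "distinct js" "set js \<subseteq> C"
    and "length is = length js"
  shows "qdet q Y is (set js) = qdet q (\<lambda>i j. Y j i) js (set is)"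
  using assms
proof (induction "length is" arbitrary: "is" js rule: less_induct)
  case less
  show ?case
  proof (cases "is")
    case Nil
    then show ?thesis using less.prems by simp
  next
    case (Cons i0 is')
    then obtain j0 js' where js: "js = j0 # js'" using less.prems by (cases js) auto
    let ?Z = "\<lambda>i j. Y j i"
    let ?I = "set is'" and ?J = "set js'"
    have i0: "i0 \<notin> ?I" "\<And>x. x \<in> ?I \<Longrightarrow> i0 < x" and j0: "j0 \<notin> ?J" "\<And>x. x \<in> ?J \<Longrightarrow> j0 < x"
      using less.prems Cons js by (auto simp: le_less)
    have b0: "below i0 (set is) = 0" "below j0 (set js) = 0"
      using i0 j0 by (force simp: below_def Cons js)+
    have bi: "below x (set is) = Suc (below x ?I)" if "x \<in> ?I" for x
      using below_remove[of "set is" i0 x] i0 that by (simp add: Cons)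
    have bj: "below x (set js) = Suc (below x ?J)" if "x \<in> ?J" for x
      using below_remove[of "set js" j0 x] j0 that by (simp add: js)
    have sub: "sorted (remove1 x xs)" "distinct (remove1 x xs)" "set (remove1 x xs) = set xs - {x}"
      if "sorted xs" "distinct xs" for xs and x :: nat
      using that by (simp_all add: sorted_remove1)
    have rem: "qdet q Y (remove1 i is') (?J - {\<gamma>}) = qdet q ?Z (remove1 \<gamma> js') (?I - {i})"
      if "i \<in> ?I" "\<gamma> \<in> ?J" for i \<gamma>
    proof -
      have "qdet q Y (remove1 i is') (set (remove1 \<gamma> js')) = qdet q ?Z (remove1 \<gamma> js') (set (remove1 i is'))"
        using less.prems that Cons js
        by (intro less.hyps sub) (auto simp: length_remove1 dest: notin_set_remove1)
      then show ?thesis using less.prems Cons js by simp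
    qed
    have 0: "qdet q Y is' ?J = qdet q ?Z js' ?I"
      using less.prems Cons js by (intro less.hyps) auto
    have 1: "qdet q Y is' (set js - {\<gamma>}) = (\<Sum>i\<in>?I. (- q) ^ below i ?I *\<^sub>c (Y i j0 * qdet q Y (remove1 i is') (?J - {\<gamma>})))"
      if "\<gamma> \<in> ?J" for \<gamma>
    proof -
      have "qdet q Y is' (set (remove1 \<gamma> js)) = qdet q ?Z (remove1 \<gamma> js) ?I"
        using less.prems that Cons js j0
        by (intro less.hyps sub) (auto simp: length_remove1 dest: notin_set_remove1 length_pos_if_in_set)
      also have "remove1 \<gamma> js = j0 # remove1 \<gamma> js'" using that j0 by (auto simp: js)
      finally show ?thesis using less.prems that js j0 rem by (auto simp: insert_Diff_if)
    qed
    have 2: "qdet q ?Z js' (set is - {i}) = (\<Sum>\<gamma>\<in>?J. (- q) ^ below \<gamma> ?J *\<^sub>c (Y i0 \<gamma> * qdet q Y (remove1 i is') (?J - {\<gamma>})))"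
      if "i \<in> ?I" for i
    proof -
      have "0 < length js'"
        using less.prems that length_pos_if_in_set[OF that] by (simp add: Cons js)
      then have "qdet q Y (remove1 i is) ?J = qdet q ?Z js' (set (remove1 i is))"
        using less.prems that Cons js i0
        by (intro less.hyps sub) (auto simp: length_remove1 dest: notin_set_remove1 length_pos_if_in_set)
      moreover have "remove1 i is = i0 # remove1 i is'" using that i0 by (auto simp: Cons)
      moreover have "set (remove1 i is) = set is - {i}" using less.prems by simp
      ultimately show ?thesis by simp
    qed
    have "qdet q Y is (set js) = Y i0 j0 * qdet q Y is' ?J +
      (\<Sum>\<gamma>\<in>?J. (- q) ^ Suc (below \<gamma> ?J) *\<^sub>c (Y i0 \<gamma> * qdet q Y is' (set js - {\<gamma>})))"
      using j0 b0 bj by (simp add: Cons js)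
    also have "\<dots> = Y i0 j0 * qdet q Y is' ?J + (\<Sum>\<gamma>\<in>?J. \<Sum>i\<in>?I. (- q) ^ Suc (below \<gamma> ?J + below i ?I) *\<^sub>c
        (Y i0 \<gamma> * Y i j0 * qdet q Y (remove1 i is') (?J - {\<gamma>})))"
      by (simp add: 1 sum_distrib_left cscale_sum_right power_add mult.assoc)
    also have "\<dots> = Y i0 j0 * qdet q ?Z js' ?I + (\<Sum>i\<in>?I. \<Sum>\<gamma>\<in>?J. (- q) ^ Suc (below \<gamma> ?J + below i ?I) *\<^sub>c
        (Y i j0 * Y i0 \<gamma> * qdet q Y (remove1 i is') (?J - {\<gamma>})))"
    proof -
      have "Y i j0 * Y i0 \<gamma> = Y i0 \<gamma> * Y i j0" if "i \<in> ?I" "\<gamma> \<in> ?J" for i \<gamma>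
        using anti[of i0 i \<gamma> j0] less.prems Cons js that i0 j0 by (auto simp: subset_iff)
      then show ?thesis unfolding 0 by (subst sum.swap) simp
    qed
    also have "\<dots> = Y i0 j0 * qdet q ?Z js' ?I + (\<Sum>i\<in>?I. (- q) ^ Suc (below i ?I) *\<^sub>c (Y i j0 * qdet q ?Z js' (set is - {i})))"
      by (simp add: 2 sum_distrib_left cscale_sum_right power_add mult.assoc mult.commute mult.left_commute)
    also have "\<dots> = qdet q ?Z js (set is)"
      using i0 b0 bi by (simp add: Cons js)
    finally show ?thesis .
  qed
qed

text \<open>If \<open>j\<close> is not the first row, the entry commutes with that row by
  \<open>anti\<close> and induction applies. If it is, expand along the last row \<open>k\<close>:
  moving \<open>Y j \<alpha>\<close> past \<open>Y k \<gamma>\<close> leaves correction terms whose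
  sum contains a minor with row \<open>j\<close> repeated, hence vanishes.\<close>

lemma qdet_left_of:
  assumes "finite \<Gamma>" "\<Gamma> \<subseteq> C" "sorted is" "distinct is" "set is \<subseteq> R" "j \<in> set is"
    and "\<alpha> \<in> C" "\<And>\<gamma>. \<gamma> \<in> \<Gamma> \<Longrightarrow> \<alpha> < \<gamma>"
  shows "qdet q Y is \<Gamma> * Y j \<alpha> = inverse q *\<^sub>c (Y j \<alpha> * qdet q Y is \<Gamma>)"
  using assms
proof (induction "length is" arbitrary: "is" \<Gamma> rule: less_induct)
  case less
  obtain i is' where "is": "is = i # is'" using less.prems by (cases "is") auto
  have jR: "j \<in> R" using less.prems by auto
  show ?case
  proof (cases "j = i")
    case False
    then have j: "j \<in> set is'" "i < j" using less.prems "is" by (auto simp: le_less)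
    have "Y i \<gamma> * qdet q Y is' (\<Gamma> - {\<gamma>}) * Y j \<alpha> = inverse q *\<^sub>c (Y j \<alpha> * (Y i \<gamma> * qdet q Y is' (\<Gamma> - {\<gamma>})))"
      if "\<gamma> \<in> \<Gamma>" for \<gamma>
    proof -
      have "qdet q Y is' (\<Gamma> - {\<gamma>}) * Y j \<alpha> = inverse q *\<^sub>c (Y j \<alpha> * qdet q Y is' (\<Gamma> - {\<gamma>}))"
        using less.prems "is" j by (intro less.hyps) auto
      moreover have "Y j \<alpha> * Y i \<gamma> = Y i \<gamma> * Y j \<alpha>"
        using less.prems "is" j that by (intro anti) auto
      ultimately show ?thesis by (metis mult.assoc mult_cscale_right)
    qed
    then show ?thesis
      by (simp add: "is" sum_distrib_left sum_distrib_right cscale_sum_right mult.commute)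
  next
    case True
    show ?thesis
    proof (cases is' rule: rev_cases)
      case Nil
      have "Y j \<gamma> * qdet q Y [] (\<Gamma> - {\<gamma>}) * Y j \<alpha> = inverse q *\<^sub>c (Y j \<alpha> * (Y j \<gamma> * qdet q Y [] (\<Gamma> - {\<gamma>})))"
        if "\<gamma> \<in> \<Gamma>" for \<gamma>
        using row[of j \<alpha> \<gamma>] jR less.prems that by auto
      then show ?thesis
        by (simp add: "is" Nil True sum_distrib_left sum_distrib_right cscale_sum_right mult.commute del: qdet.simps(1))
    next
      case (snoc ks k)
      have isk: "is = (i # ks) @ [k]" using "is" snoc by simp
      have jk: "j < k" "k \<in> R" using less.prems isk True by (auto simp: le_less sorted_append)
      let ?D = "\<lambda>\<gamma>. qdet q Y (i # ks) (\<Gamma> - {\<gamma>})"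
      have t: "?D \<gamma> * Y k \<gamma> * Y j \<alpha> = inverse q *\<^sub>c (Y j \<alpha> * (?D \<gamma> * Y k \<gamma>)) - (q - inverse q) *\<^sub>c (?D \<gamma> * Y j \<gamma> * Y k \<alpha>)"
        if "\<gamma> \<in> \<Gamma>" for \<gamma>
      proof -
        have D: "?D \<gamma> * Y j \<alpha> = inverse q *\<^sub>c (Y j \<alpha> * ?D \<gamma>)"
          using less.prems isk True by (intro less.hyps) (auto simp: sorted_append)
        have c: "Y k \<gamma> * Y j \<alpha> = Y j \<alpha> * Y k \<gamma> - (q - inverse q) *\<^sub>c (Y j \<gamma> * Y k \<alpha>)"
          using less.prems that jk jR by (intro diag) auto
        have "?D \<gamma> * Y k \<gamma> * Y j \<alpha> = ?D \<gamma> * Y j \<alpha> * Y k \<gamma> - (q - inverse q) *\<^sub>c (?D \<gamma> * Y j \<gamma> * Y k \<alpha>)"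
          by (simp only: mult.assoc c right_diff_distrib mult_cscale_right)
        then show ?thesis by (simp only: D mult_cscale_left mult.assoc)
      qed
      have "(\<Sum>\<gamma>\<in>\<Gamma>. (- q) ^ above \<gamma> \<Gamma> *\<^sub>c (?D \<gamma> * Y j \<gamma>)) = 0"
        using qdet_repeated_last[of \<Gamma> "i # ks" j] less.prems isk True
        by (simp add: qdet_snoc del: append_Cons)
      then have z: "(\<Sum>\<gamma>\<in>\<Gamma>. (- q) ^ above \<gamma> \<Gamma> *\<^sub>c (?D \<gamma> * Y j \<gamma> * Y k \<alpha>)) = 0"
        by (metis (no_types, lifting) mult_cscale_left mult_zero_left sum.cong sum_distrib_right)
      have "qdet q Y is \<Gamma> * Y j \<alpha> = (\<Sum>\<gamma>\<in>\<Gamma>. (- q) ^ above \<gamma> \<Gamma> *\<^sub>c (?D \<gamma> * Y k \<gamma> * Y j \<alpha>))"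
        unfolding isk qdet_snoc[OF less.prems(1)] by (simp add: sum_distrib_right mult.assoc)
      also have "\<dots> = (\<Sum>\<gamma>\<in>\<Gamma>. (- q) ^ above \<gamma> \<Gamma> *\<^sub>c (inverse q *\<^sub>c (Y j \<alpha> * (?D \<gamma> * Y k \<gamma>)) -
          (q - inverse q) *\<^sub>c (?D \<gamma> * Y j \<gamma> * Y k \<alpha>)))"
        by (intro sum.cong refl) (simp only: t)
      also have "\<dots> = inverse q *\<^sub>c (Y j \<alpha> * (\<Sum>\<gamma>\<in>\<Gamma>. (- q) ^ above \<gamma> \<Gamma> *\<^sub>c (?D \<gamma> * Y k \<gamma>))) -
          (q - inverse q) *\<^sub>c (\<Sum>\<gamma>\<in>\<Gamma>. (- q) ^ above \<gamma> \<Gamma> *\<^sub>c (?D \<gamma> * Y j \<gamma> * Y k \<alpha>))"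
        by (simp only: cscale_diff_right sum_subtractf sum_distrib_left cscale_sum_right mult_cscale_right cscale_cscale mult.commute[of "(- q) ^ _"])
      finally show ?thesis unfolding z isk qdet_snoc[OF less.prems(1)] by simp
    qed
  qed
qed

text \<open>The mirror image of \<open>qdet_left_of\<close>: \<open>anti\<close> now takes care of
  every row except the last, and for the last row the expansion along the first row produces a
  vanishing minor whose new first row is repeated.\<close>

lemma qdet_right_of:
  assumes "finite \<Gamma>" "\<Gamma> \<subseteq> C" "sorted is" "distinct is" "set is \<subseteq> R" "j \<in> set is"
    and "\<alpha> \<in> C" "\<And>\<gamma>. \<gamma> \<in> \<Gamma> \<Longrightarrow> \<gamma> < \<alpha>"
  shows "qdet q Y is \<Gamma> * Y j \<alpha> = q *\<^sub>c (Y j \<alpha> * qdet q Y is \<Gamma>)"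
  using assms
proof (induction "length is" arbitrary: "is" \<Gamma> rule: less_induct)
  case less
  obtain i is' where "is": "is = i # is'" using less.prems by (cases "is") auto
  have jR: "j \<in> R" "i \<in> R" using less.prems "is" by auto
  show ?case
  proof (cases "is' = []")
    case True
    have "Y j \<gamma> * qdet q Y [] (\<Gamma> - {\<gamma>}) * Y j \<alpha> = q *\<^sub>c (Y j \<alpha> * (Y j \<gamma> * qdet q Y [] (\<Gamma> - {\<gamma>})))"
      if "\<gamma> \<in> \<Gamma>" for \<gamma>
      using row[of j \<gamma> \<alpha>] jR less.prems that q0 by auto
    then show ?thesis
      using True "is" less.prems
      by (simp add: sum_distrib_left sum_distrib_right cscale_sum_right mult.commute del: qdet.simps(1))
  next
    case False
    then obtain ks k where snoc: "is' = ks @ [k]" by (cases is' rule: rev_cases) auto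
    have isk: "is = (i # ks) @ [k]" using "is" snoc by simp
    have kR: "k \<in> R" using less.prems isk by auto
    show ?thesis
    proof (cases "j = k")
      case False
      then have j: "j \<in> set (i # ks)" "j < k" using less.prems isk by (auto simp: le_less sorted_append)
      let ?D = "\<lambda>\<gamma>. qdet q Y (i # ks) (\<Gamma> - {\<gamma>})"
      have t: "?D \<gamma> * Y k \<gamma> * Y j \<alpha> = q *\<^sub>c (Y j \<alpha> * (?D \<gamma> * Y k \<gamma>))" if "\<gamma> \<in> \<Gamma>" for \<gamma>
      proof -
        have D: "?D \<gamma> * Y j \<alpha> = q *\<^sub>c (Y j \<alpha> * ?D \<gamma>)"
          using less.prems isk j by (intro less.hyps) (auto simp: sorted_append)
        have c: "Y k \<gamma> * Y j \<alpha> = Y j \<alpha> * Y k \<gamma>"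
          using less.prems that j kR jR by (intro anti) auto
        have "?D \<gamma> * Y k \<gamma> * Y j \<alpha> = ?D \<gamma> * Y j \<alpha> * Y k \<gamma>"
          by (simp only: mult.assoc c)
        then show ?thesis by (simp only: D mult_cscale_left mult.assoc)
      qed
      have "qdet q Y is \<Gamma> * Y j \<alpha> = (\<Sum>\<gamma>\<in>\<Gamma>. (- q) ^ above \<gamma> \<Gamma> *\<^sub>c (?D \<gamma> * Y k \<gamma> * Y j \<alpha>))"
        unfolding isk qdet_snoc[OF less.prems(1)] by (simp add: sum_distrib_right mult.assoc)
      also have "\<dots> = (\<Sum>\<gamma>\<in>\<Gamma>. (- q) ^ above \<gamma> \<Gamma> *\<^sub>c q *\<^sub>c (Y j \<alpha> * (?D \<gamma> * Y k \<gamma>)))"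
        by (intro sum.cong refl) (simp only: t)
      also have "\<dots> = q *\<^sub>c (Y j \<alpha> * (\<Sum>\<gamma>\<in>\<Gamma>. (- q) ^ above \<gamma> \<Gamma> *\<^sub>c (?D \<gamma> * Y k \<gamma>)))"
        by (simp only: sum_distrib_left cscale_sum_right mult_cscale_right cscale_cscale mult.commute[of q])
      finally show ?thesis unfolding isk qdet_snoc[OF less.prems(1)] .
    next
      case True
      then have j: "j \<in> set is'" "i < j" using less.prems isk snoc by (auto simp: le_less sorted_append)
      let ?D = "\<lambda>\<gamma>. qdet q Y is' (\<Gamma> - {\<gamma>})"
      have t: "Y j \<alpha> * (Y i \<gamma> * ?D \<gamma>) = inverse q *\<^sub>c (Y i \<gamma> * ?D \<gamma> * Y j \<alpha>) - (q - inverse q) *\<^sub>c (Y i \<alpha> * (Y j \<gamma> * ?D \<gamma>))"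
        if "\<gamma> \<in> \<Gamma>" for \<gamma>
      proof -
        have D: "?D \<gamma> * Y j \<alpha> = q *\<^sub>c (Y j \<alpha> * ?D \<gamma>)"
          using less.prems "is" j by (intro less.hyps) auto
        then have D': "Y j \<alpha> * ?D \<gamma> = inverse q *\<^sub>c (?D \<gamma> * Y j \<alpha>)" using q0 by simp
        have "\<gamma> \<in> C" "\<gamma> < \<alpha>" using less.prems that by auto
        then have c: "Y j \<alpha> * Y i \<gamma> = Y i \<gamma> * Y j \<alpha> - (q - inverse q) *\<^sub>c (Y i \<alpha> * Y j \<gamma>)"
          using diag[of i j \<gamma> \<alpha>] j jR less.prems by simp
        have "Y j \<alpha> * (Y i \<gamma> * ?D \<gamma>) = Y i \<gamma> * (Y j \<alpha> * ?D \<gamma>) - (q - inverse q) *\<^sub>c (Y i \<alpha> * (Y j \<gamma> * ?D \<gamma>))"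
          by (simp only: mult.assoc[symmetric] c left_diff_distrib mult_cscale_left)
        then show ?thesis by (simp only: D' mult_cscale_right mult.assoc)
      qed
      have z: "(\<Sum>\<gamma>\<in>\<Gamma>. (- q) ^ below \<gamma> \<Gamma> *\<^sub>c (Y j \<gamma> * ?D \<gamma>)) = 0"
        using qdet_repeated_first[of \<Gamma> is' j] less.prems "is" j by simp
      have "Y j \<alpha> * qdet q Y is \<Gamma> = (\<Sum>\<gamma>\<in>\<Gamma>. (- q) ^ below \<gamma> \<Gamma> *\<^sub>c (Y j \<alpha> * (Y i \<gamma> * ?D \<gamma>)))"
        by (simp add: "is" sum_distrib_left)
      also have "\<dots> = (\<Sum>\<gamma>\<in>\<Gamma>. (- q) ^ below \<gamma> \<Gamma> *\<^sub>c (inverse q *\<^sub>c (Y i \<gamma> * ?D \<gamma> * Y j \<alpha>) -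
          (q - inverse q) *\<^sub>c (Y i \<alpha> * (Y j \<gamma> * ?D \<gamma>))))"
        by (intro sum.cong refl) (simp only: t)
      also have "\<dots> = inverse q *\<^sub>c ((\<Sum>\<gamma>\<in>\<Gamma>. (- q) ^ below \<gamma> \<Gamma> *\<^sub>c (Y i \<gamma> * ?D \<gamma>)) * Y j \<alpha>) -
          (q - inverse q) *\<^sub>c (Y i \<alpha> * (\<Sum>\<gamma>\<in>\<Gamma>. (- q) ^ below \<gamma> \<Gamma> *\<^sub>c (Y j \<gamma> * ?D \<gamma>)))"
        by (simp only: cscale_diff_right sum_subtractf sum_distrib_left sum_distrib_right cscale_sum_right
            mult_cscale_right mult_cscale_left cscale_cscale mult.commute[of "(- q) ^ _"])
      finally have "Y j \<alpha> * qdet q Y is \<Gamma> = inverse q *\<^sub>c (qdet q Y is \<Gamma> * Y j \<alpha>)"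
        unfolding z by (simp add: "is")
      then show ?thesis using q0 by simp
    qed
  qed
qed

text \<open>The cofactor identity in disguise: row \<open>k\<close> expanded against the cofactors
  of row \<open>i\<close> is the determinant once \<open>k\<close> has been moved back to its place,
  or a minor with a repeated row.\<close>

lemma qdet_remove_first:
  assumes "sorted is" "distinct is" "set is \<subseteq> R" "finite \<Gamma>" "\<Gamma> \<subseteq> C" "i \<in> set is" "k \<in> set is"
  shows "qdet q Y (k # remove1 i is) \<Gamma> = (if k = i then (- q) ^ below k (set is) *\<^sub>c qdet q Y is \<Gamma> else 0)"
proof (cases "k = i")
  case True
  obtain xs ys where s: "is = xs @ k # ys" "remove1 k is = xs @ ys" "\<forall>x\<in>set xs. x < k"
    "length xs = below k (set is)"
    using assms by (elim sorted_split_at[of "is" k]) auto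
  have "qdet q Y (k # xs @ ys) \<Gamma> = (- q) ^ length xs *\<^sub>c qdet q Y (xs @ k # ys) \<Gamma>"
    using assms s by (intro qdet_move_first) auto
  then show ?thesis using True s by simp
next
  case False
  have "set (remove1 i is) \<subseteq> R" "k \<in> set (remove1 i is)"
    using assms False by (auto dest: notin_set_remove1)
  then show ?thesis using False qdet_repeated_first assms by simp
qed

lemma qdet_remove_last:
  assumes "sorted is" "distinct is" "set is \<subseteq> R" "finite \<Gamma>" "\<Gamma> \<subseteq> C" "i \<in> set is" "k \<in> set is"
  shows "qdet q Y (remove1 i is @ [k]) \<Gamma> = (if k = i then (- q) ^ above k (set is) *\<^sub>c qdet q Y is \<Gamma> else 0)"
proof (cases "k = i")
  case True
  obtain xs ys where s: "is = xs @ k # ys" "remove1 k is = xs @ ys" "\<forall>y\<in>set ys. k < y"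
    "length ys = above k (set is)"
    using assms by (elim sorted_split_at[of "is" k]) auto
  have "qdet q Y (xs @ ys @ [k]) \<Gamma> = (- q) ^ length ys *\<^sub>c qdet q Y (xs @ k # ys) \<Gamma>"
    using assms s by (intro qdet_move_last) auto
  then show ?thesis using True s by simp
next
  case False
  have "set (remove1 i is) \<subseteq> R" "k \<in> set (remove1 i is)"
    using assms False by (auto dest: notin_set_remove1)
  then show ?thesis using False qdet_repeated_last assms by simp
qed

text \<open>With \<open>M\<close> the matrix of complementary minors, suitably signed, both \<open>Y M\<close> and \<open>M Y\<close> are the scalar
  matrix of the determinant \<open>D\<close>, and \<open>Y (M Y) = (Y M) Y\<close>.\<close>

lemma qdet_central:
  assumes I: "sorted is" "distinct is" "set is \<subseteq> R" and J: "sorted js" "distinct js" "set js \<subseteq> C"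
    and len: "length is = length js" and k: "k \<in> set is" and d: "\<delta> \<in> set js"
  shows "qdet q Y is (set js) * Y k \<delta> = Y k \<delta> * qdet q Y is (set js)"
proof -
  let ?I = "set is" and ?J = "set js" and ?D = "qdet q Y is (set js)" and ?Z = "\<lambda>i j. Y j i"
  let ?M = "\<lambda>i \<gamma>. qdet q Y (remove1 i is) (?J - {\<gamma>})"
  interpret T: quantum_matrix q ?Z C R by (rule transpose)
  \<comment> \<open>Transposing the complementary minors makes the expansion along a last column
    available, as needed for \<open>M Y\<close>.\<close>
  have M: "?M i \<gamma> = qdet q ?Z (remove1 \<gamma> js) (?I - {i})" if "i \<in> ?I" "\<gamma> \<in> ?J" for i \<gamma>
  proof -
    have "qdet q Y (remove1 i is) (set (remove1 \<gamma> js)) = qdet q ?Z (remove1 \<gamma> js) (set (remove1 i is))"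
      using I J len that
      by (intro qdet_transpose) (auto simp: sorted_remove1 length_remove1 dest: notin_set_remove1)
    then show ?thesis using I J by simp
  qed
  have 1: "(\<Sum>\<gamma>\<in>?J. (- q) ^ below \<gamma> ?J *\<^sub>c (Y k \<gamma> * ?M i \<gamma>)) = (if k = i then (- q) ^ below k ?I *\<^sub>c ?D else 0)"
    if "i \<in> ?I" for i
    using qdet_remove_first[OF I, of ?J i k] J k that by simp
  have 2: "(\<Sum>i\<in>?I. (- q) ^ above i ?I *\<^sub>c (?M i \<gamma> * Y i \<delta>)) = (if \<gamma> = \<delta> then (- q) ^ above \<delta> ?J *\<^sub>c ?D else 0)"
    if "\<gamma> \<in> ?J" for \<gamma>
    using T.qdet_remove_last[OF J, of ?I \<gamma> \<delta>] I d that qdet_transpose[OF I J len]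
    by (auto simp: qdet_snoc M)
  \<comment> \<open>These are the terms of entry \<open>(k, \<delta>)\<close> of
    \<open>Y M Y\<close>. In either order of summation the inner sum collapses to the determinant,
    and the remaining exponent is \<open>below\<close> plus \<open>above\<close> of one element,
    that is, the cardinality minus one.\<close>
  let ?S = "\<lambda>\<gamma> i. (- q) ^ (below \<gamma> ?J + above i ?I) *\<^sub>c (Y k \<gamma> * ?M i \<gamma> * Y i \<delta>)"
  have "(\<Sum>i\<in>?I. \<Sum>\<gamma>\<in>?J. ?S \<gamma> i) = (\<Sum>i\<in>?I. (- q) ^ above i ?I *\<^sub>c ((\<Sum>\<gamma>\<in>?J. (- q) ^ below \<gamma> ?J *\<^sub>c (Y k \<gamma> * ?M i \<gamma>)) * Y i \<delta>))"
    by (simp add: sum_distrib_right cscale_sum_right power_add mult.commute)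
  also have "\<dots> = (\<Sum>i\<in>?I. if k = i then (- q) ^ (below k ?I + above k ?I) *\<^sub>c (?D * Y k \<delta>) else 0)"
    by (intro sum.cong refl) (simp add: 1 power_add mult.commute)
  also have "\<dots> = (- q) ^ (below k ?I + above k ?I) *\<^sub>c (?D * Y k \<delta>)"
    using k by (simp add: sum.delta)
  finally have a: "(\<Sum>i\<in>?I. \<Sum>\<gamma>\<in>?J. ?S \<gamma> i) = (- q) ^ (card ?I - 1) *\<^sub>c (?D * Y k \<delta>)"
    using k by (simp add: below_plus_above)
  have "(\<Sum>\<gamma>\<in>?J. \<Sum>i\<in>?I. ?S \<gamma> i) = (\<Sum>\<gamma>\<in>?J. (- q) ^ below \<gamma> ?J *\<^sub>c (Y k \<gamma> * (\<Sum>i\<in>?I. (- q) ^ above i ?I *\<^sub>c (?M i \<gamma> * Y i \<delta>))))"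
    by (simp add: sum_distrib_left cscale_sum_right power_add mult.assoc)
  also have "\<dots> = (\<Sum>\<gamma>\<in>?J. if \<gamma> = \<delta> then (- q) ^ (below \<delta> ?J + above \<delta> ?J) *\<^sub>c (Y k \<delta> * ?D) else 0)"
    by (intro sum.cong refl) (simp add: 2 power_add)
  also have "\<dots> = (- q) ^ (below \<delta> ?J + above \<delta> ?J) *\<^sub>c (Y k \<delta> * ?D)"
    using d by (simp add: sum.delta)
  finally have b: "(\<Sum>\<gamma>\<in>?J. \<Sum>i\<in>?I. ?S \<gamma> i) = (- q) ^ (card ?J - 1) *\<^sub>c (Y k \<delta> * ?D)"
    using d by (simp add: below_plus_above)
  have "card ?I = card ?J" using I J len by (simp add: distinct_card)
  moreover have "(\<Sum>i\<in>?I. \<Sum>\<gamma>\<in>?J. ?S \<gamma> i) = (\<Sum>\<gamma>\<in>?J. \<Sum>i\<in>?I. ?S \<gamma> i)"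
    by (rule sum.swap)
  ultimately show ?thesis
    using a b q0 by (simp add: cscale_left_cancel)
qed

end

section \<open>Reversing a step of Cauchon's algorithm\<close>

text \<open>An intermediate stage of Cauchon's deleting derivations algorithm: a diagonal pair is subject to the
  quantum relation if its lower right corner precedes \<open>(r, s)\<close> lexicographically, and commutes otherwise.\<close>

locale cauchon_stage =
  fixes q :: complex and Y :: "nat \<Rightarrow> nat \<Rightarrow> 'a::complex_alg" and R C :: "nat set" and r s :: nat
  assumes q0: "q \<noteq> 0"
    and row: "\<lbrakk>i \<in> R; \<alpha> \<in> C; \<beta> \<in> C; \<alpha> < \<beta>\<rbrakk> \<Longrightarrow> Y i \<beta> * Y i \<alpha> = inverse q *\<^sub>c (Y i \<alpha> * Y i \<beta>)"
    and col: "\<lbrakk>i \<in> R; j \<in> R; \<alpha> \<in> C; i < j\<rbrakk> \<Longrightarrow> Y j \<alpha> * Y i \<alpha> = inverse q *\<^sub>c (Y i \<alpha> * Y j \<alpha>)"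
    and anti: "\<lbrakk>i \<in> R; j \<in> R; \<alpha> \<in> C; \<beta> \<in> C; i < j; \<beta> < \<alpha>\<rbrakk> \<Longrightarrow> Y j \<beta> * Y i \<alpha> = Y i \<alpha> * Y j \<beta>"
    and active: "\<lbrakk>i \<in> R; j \<in> R; \<alpha> \<in> C; \<beta> \<in> C; i < j; \<alpha> < \<beta>; j < r \<or> j = r \<and> \<beta> < s\<rbrakk> \<Longrightarrow>
      Y j \<beta> * Y i \<alpha> = Y i \<alpha> * Y j \<beta> - (q - inverse q) *\<^sub>c (Y i \<beta> * Y j \<alpha>)"
    and inactive: "\<lbrakk>i \<in> R; j \<in> R; \<alpha> \<in> C; \<beta> \<in> C; i < j; \<alpha> < \<beta>; r < j \<or> j = r \<and> s \<le> \<beta>\<rbrakk> \<Longrightarrow>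
      Y j \<beta> * Y i \<alpha> = Y i \<alpha> * Y j \<beta>"

text \<open>Only the pivot \<open>Y r s\<close> is inverted, with inverse \<open>t'\<close>;
  whenever the step is applied, the pivot is still a torus monomial.\<close>

locale cauchon_step = cauchon_stage q Y R C r s
  for q :: complex and Y :: "nat \<Rightarrow> nat \<Rightarrow> 'a::complex_alg" and R C :: "nat set" and r s :: nat +
  fixes t' :: 'a
  assumes rs: "r \<in> R" "s \<in> C"
    and inv: "Y r s * t' = 1" "t' * Y r s = 1"
begin

lemma inv_commute:
  assumes "Y r s * x = c *\<^sub>c (x * Y r s)" "c \<noteq> 0"
  shows "t' * x = inverse c *\<^sub>c (x * t')"
proof -
  have "t' * (Y r s * x) * t' = c *\<^sub>c (t' * x * (Y r s * t'))"
    using assms(1) by (simp add: mult.assoc)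
  then have "x * t' = c *\<^sub>c (t' * x)"
    by (simp add: inv mult.assoc[symmetric])
  then show ?thesis using assms(2) by simp
qed

lemma inv_commute':
  assumes "x * Y r s = c *\<^sub>c (Y r s * x)" "c \<noteq> 0"
  shows "x * t' = inverse c *\<^sub>c (t' * x)"
proof -
  have "t' * (x * Y r s) * t' = c *\<^sub>c (t' * Y r s * x * t')"
    using assms(1) by (simp add: mult.assoc)
  then have "t' * x = c *\<^sub>c (x * t')"
    by (simp add: inv mult.assoc)
  then show ?thesis using assms(2) by simp
qed

text \<open>The directions place \<open>t'\<close> at the position of \<open>Y r s\<close> in
  row-major order: earlier entries move to its left, later ones to its right. Together with the
  relations this rewrites products to a row-major normal form.\<close>

lemma inv_rules:
  "\<lbrakk>i \<in> R; \<alpha> \<in> C; i < r; \<alpha> \<noteq> s\<rbrakk> \<Longrightarrow> t' * Y i \<alpha> = Y i \<alpha> * t'"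
  "\<lbrakk>i \<in> R; i < r\<rbrakk> \<Longrightarrow> t' * Y i s = q *\<^sub>c (Y i s * t')"
  "\<lbrakk>\<alpha> \<in> C; \<alpha> < s\<rbrakk> \<Longrightarrow> t' * Y r \<alpha> = q *\<^sub>c (Y r \<alpha> * t')"
  "\<lbrakk>\<alpha> \<in> C; s < \<alpha>\<rbrakk> \<Longrightarrow> Y r \<alpha> * t' = q *\<^sub>c (t' * Y r \<alpha>)"
  "\<lbrakk>i \<in> R; \<alpha> \<in> C; r < i; \<alpha> \<noteq> s\<rbrakk> \<Longrightarrow> Y i \<alpha> * t' = t' * Y i \<alpha>"
  "\<lbrakk>i \<in> R; r < i\<rbrakk> \<Longrightarrow> Y i s * t' = q *\<^sub>c (t' * Y i s)"
proof -
  show "t' * Y i \<alpha> = Y i \<alpha> * t'" if "i \<in> R" "\<alpha> \<in> C" "i < r" "\<alpha> \<noteq> s"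
  proof -
    have "Y r s * Y i \<alpha> = Y i \<alpha> * Y r s"
    proof (cases "\<alpha> < s")
      case True
      show ?thesis by (rule inactive) (use that rs True in simp_all)
    next
      case False
      show ?thesis by (rule anti) (use that rs False in simp_all)
    qed
    then show ?thesis using inv_commute[of "Y i \<alpha>" 1] by simp
  qed
  show "t' * Y i s = q *\<^sub>c (Y i s * t')" if "i \<in> R" "i < r"
    using inv_commute[of "Y i s" "inverse q"] that rs col[of i r s] q0 by auto
  show "t' * Y r \<alpha> = q *\<^sub>c (Y r \<alpha> * t')" if "\<alpha> \<in> C" "\<alpha> < s"
    using inv_commute[of "Y r \<alpha>" "inverse q"] that rs row[of r \<alpha> s] q0 by auto
  show "Y r \<alpha> * t' = q *\<^sub>c (t' * Y r \<alpha>)" if "\<alpha> \<in> C" "s < \<alpha>"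
    using inv_commute'[of "Y r \<alpha>" "inverse q"] that rs row[of r s \<alpha>] q0 by auto
  show "Y i \<alpha> * t' = t' * Y i \<alpha>" if "i \<in> R" "\<alpha> \<in> C" "r < i" "\<alpha> \<noteq> s"
  proof -
    have "Y i \<alpha> * Y r s = Y r s * Y i \<alpha>"
    proof (cases "\<alpha> < s")
      case True
      show ?thesis by (rule anti) (use that rs True in simp_all)
    next
      case False
      show ?thesis by (rule inactive) (use that rs False in simp_all)
    qed
    then show ?thesis using inv_commute'[of "Y i \<alpha>" 1] by simp
  qed
  show "Y i s * t' = q *\<^sub>c (t' * Y i s)" if "i \<in> R" "r < i"
    using inv_commute'[of "Y i s" "inverse q"] that rs col[of r i s] q0 by auto
qed

lemma assoc_rule: "a * b = c \<Longrightarrow> a * (b * x) = c * (x :: 'a)"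
  by (simp add: mult.assoc[symmetric])

lemmas straighten = row col anti active inactive inv inv_rules
lemmas straighten_all = straighten straighten[THEN assoc_rule]

text \<open>Cauchon's deletion step subtracts \<open>Y i s * t' * Y r \<alpha>\<close> from the
  entries above and to the left of the pivot. Adding it undoes the step, since row \<open>r\<close>
  and column \<open>s\<close> stay fixed.\<close>

definition Y' :: "nat \<Rightarrow> nat \<Rightarrow> 'a" where
  "Y' i \<alpha> = (if i < r \<and> \<alpha> < s then Y i \<alpha> + Y i s * t' * Y r \<alpha> else Y i \<alpha>)"

lemma q_inverse_cancel: "inverse q * (q * x) = x" "q * (inverse q * x) = (x::complex)"
  using q0 by simp_all

lemmas normalize = distrib_left distrib_right left_diff_distrib right_diff_distrib cscale_add_right cscale_diff_right
  cscale_diff_left cscale_add_left mult.assoc q0 q_inverse_cancel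

text \<open>Here and in the next lemmas both sides are brought to row-major normal form; the cases
  fix the position relative to the pivot.\<close>

lemma row': "\<lbrakk>i \<in> R; \<alpha> \<in> C; \<beta> \<in> C; \<alpha> < \<beta>\<rbrakk> \<Longrightarrow> Y' i \<beta> * Y' i \<alpha> = inverse q *\<^sub>c (Y' i \<alpha> * Y' i \<beta>)"
  using rs by (cases \<beta> s rule: linorder_cases) (auto simp: Y'_def straighten_all normalize)

lemma col': "\<lbrakk>i \<in> R; j \<in> R; \<alpha> \<in> C; i < j\<rbrakk> \<Longrightarrow> Y' j \<alpha> * Y' i \<alpha> = inverse q *\<^sub>c (Y' i \<alpha> * Y' j \<alpha>)"
  using rs by (cases j r rule: linorder_cases) (auto simp: Y'_def straighten_all normalize)

lemma anti': "\<lbrakk>i \<in> R; j \<in> R; \<alpha> \<in> C; \<beta> \<in> C; i < j; \<beta> < \<alpha>\<rbrakk> \<Longrightarrow> Y' j \<beta> * Y' i \<alpha> = Y' i \<alpha> * Y' j \<beta>"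
  using rs by (cases j r rule: linorder_cases; cases \<alpha> s rule: linorder_cases)
    (auto simp: Y'_def straighten_all normalize)

lemma active':
  assumes "i \<in> R" "j \<in> R" "\<alpha> \<in> C" "\<beta> \<in> C" "i < j" "\<alpha> < \<beta>" "j < r \<or> j = r \<and> \<beta> < Suc s"
  shows "Y' j \<beta> * Y' i \<alpha> = Y' i \<alpha> * Y' j \<beta> - (q - inverse q) *\<^sub>c (Y' i \<beta> * Y' j \<alpha>)"
proof (cases "\<alpha> < s")
  case False
  then have "j < r" using assms by auto
  then show ?thesis using assms False active[of i j \<alpha> \<beta>] by (simp add: Y'_def)
next
  case True
  \<comment> \<open>The last case is the new relation at the pivot. Its correction stems from
    \<open>Y i s * t' * Y r \<alpha>\<close>: multiplied by the pivot from the left, this gives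
    \<open>inverse q\<close> times \<open>Y i s * Y r \<alpha>\<close>, and from the right
    \<open>q\<close> times it.\<close>
  consider "j < r" "\<beta> < s" | "j < r" "\<beta> = s" | "j < r" "s < \<beta>" | "j = r" "\<beta> < s" | "j = r" "\<beta> = s"
    using assms(7) by linarith
  then show ?thesis
    by cases (use assms(1-6) True rs in \<open>simp_all add: Y'_def straighten_all normalize\<close>)
qed

lemma inactive':
  assumes "i \<in> R" "j \<in> R" "\<alpha> \<in> C" "\<beta> \<in> C" "i < j" "\<alpha> < \<beta>" "r < j \<or> j = r \<and> Suc s \<le> \<beta>"
  shows "Y' j \<beta> * Y' i \<alpha> = Y' i \<alpha> * Y' j \<beta>"
proof (cases "i < r \<and> \<alpha> < s")
  case False
  then show ?thesis using assms inactive[of i j \<alpha> \<beta>] by (auto simp: Y'_def)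
next
  case True
  consider "r < j" "\<beta> < s" | "r < j" "\<beta> = s" | "r < j" "s < \<beta>" | "j = r" "s < \<beta>"
    using assms(7) by linarith
  then show ?thesis
  proof cases
    case 1
    then show ?thesis
      using assms(1-6) True rs by (simp add: Y'_def) (simp add: straighten_all normalize)
  next
    case 2
    then show ?thesis
      using assms(1-6) True rs by (simp add: Y'_def) (simp add: straighten_all normalize)
  next
    case 3
    then show ?thesis
      using assms(1-6) True rs by (simp add: Y'_def) (simp add: straighten_all normalize)
  next
    case 4
    then show ?thesis
      using assms(1-6) True rs by (simp add: Y'_def) (simp add: straighten_all normalize)
  qed
qed

lemma step: "cauchon_stage q Y' R C r (Suc s)"
  by unfold_locales (fact q0 row' col' anti' active' inactive')+

end

section \<open>The quantum torus\<close>

type_synonym expo = "(nat \<times> nat) \<Rightarrow>\<^sub>0 int"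

text \<open>The quantum torus is realized by operators on functions of exponents: its product depends on the
  parameter \<open>q\<close> and therefore cannot itself be an instance of a type class.\<close>

typedef endo = "{f :: (expo \<Rightarrow> complex) \<Rightarrow> expo \<Rightarrow> complex.
  (\<forall>x y. f (\<lambda>v. x v + y v) = (\<lambda>v. f x v + f y v)) \<and> (\<forall>c x. f (\<lambda>v. c * x v) = (\<lambda>v. c * f x v))}"
  by (rule exI[of _ "\<lambda>x. x"]) auto

setup_lifting type_definition_endo

instantiation endo :: complex_alg
begin

lift_definition zero_endo :: endo is "\<lambda>x v. 0" by auto
lift_definition one_endo :: endo is "\<lambda>x. x" by auto
lift_definition plus_endo :: "endo \<Rightarrow> endo \<Rightarrow> endo" is "\<lambda>f g x v. f x v + g x v"
  by (auto simp: algebra_simps)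
lift_definition uminus_endo :: "endo \<Rightarrow> endo" is "\<lambda>f x v. - f x v" by auto
lift_definition minus_endo :: "endo \<Rightarrow> endo \<Rightarrow> endo" is "\<lambda>f g x v. f x v - g x v"
  by (auto simp: algebra_simps)
lift_definition times_endo :: "endo \<Rightarrow> endo \<Rightarrow> endo" is "\<lambda>f g x. f (g x)" by auto
lift_definition cscale_endo :: "complex \<Rightarrow> endo \<Rightarrow> endo" is "\<lambda>c f x v. c * f x v"
  by (auto simp: algebra_simps)

instance
proof
  show "(0 :: endo) \<noteq> 1"
    by transfer (auto simp: fun_eq_iff intro!: exI[of _ "\<lambda>v. 1"])
qed (transfer; auto simp: algebra_simps fun_eq_iff)+

end

lemmas endo_rep_eqs = zero_endo.rep_eq one_endo.rep_eq plus_endo.rep_eq uminus_endo.rep_eq minus_endo.rep_eq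
  times_endo.rep_eq cscale_endo.rep_eq

text \<open>\<open>T a\<close> sends the indicator function of exponent \<open>0\<close> to that of
  \<open>a\<close>, so the image of this one function shows all coefficients of a combination of
  monomials.\<close>

definition coef :: "endo \<Rightarrow> expo \<Rightarrow> complex" where
  "coef f = Rep_endo f (\<lambda>v. if v = 0 then 1 else 0)"

lemma coef_simps [simp]:
  "coef 0 a = 0" "coef (f + g) a = coef f a + coef g a" "coef (f - g) a = coef f a - coef g a"
  "coef (- f) a = - coef f a" "coef (c *\<^sub>c f) a = c * coef f a"
  by (simp_all add: coef_def endo_rep_eqs)

lemma coef_sum: "coef (\<Sum>i\<in>I. f i) a = (\<Sum>i\<in>I. coef (f i) a)"
  by (induction I rule: infinite_finite_induct) auto

definition supp :: "endo \<Rightarrow> expo set" where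
  "supp f = {a. coef f a \<noteq> 0}"

abbreviation unit_vec :: "nat \<Rightarrow> nat \<Rightarrow> expo" where
  "unit_vec i \<alpha> \<equiv> Poly_Mapping.single (i, \<alpha>) 1"

text \<open>The cocycle is one-sided: a factor \<open>inverse q\<close> arises only when the later
  of two generators in a common row or column stands on the left. Products in row-major order thus
  have coefficient \<open>1\<close>, and exchanging two such generators costs exactly
  \<open>inverse q\<close>.\<close>

definition pairing :: "nat \<times> nat \<Rightarrow> nat \<times> nat \<Rightarrow> int" where
  "pairing k l = (if fst k = fst l \<and> snd l < snd k \<or> snd k = snd l \<and> fst l < fst k then - 1 else 0)"

lemma pairing_self [simp]: "pairing k k = 0"
  by (simp add: pairing_def)

locale quantum_torus =
  fixes q :: complex and m n :: nat
  assumes q_nz: "q \<noteq> 0"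
begin

definition box :: "(nat \<times> nat) set" where
  "box = {1..m} \<times> {1..n}"

lemma finite_box [simp]: "finite box"
  by (simp add: box_def)

definition form :: "expo \<Rightarrow> expo \<Rightarrow> int" where
  "form a b = (\<Sum>k\<in>box. \<Sum>l\<in>box. Poly_Mapping.lookup a k * Poly_Mapping.lookup b l * pairing k l)"

lemma form_simps:
  "form (a + b) c = form a c + form b c" "form a (b + c) = form a b + form a c"
  "form (a - b) c = form a c - form b c" "form a (b - c) = form a b - form a c"
  "form 0 c = 0" "form a 0 = 0" "form (- a) c = - form a c" "form a (- c) = - form a c"
  unfolding form_def
  by (simp_all add: lookup_add lookup_minus algebra_simps sum.distrib sum_subtractf sum_negf)

lemma form_single_right:
  assumes "l \<in> box"
  shows "form a (Poly_Mapping.single l c) = (\<Sum>k\<in>box. Poly_Mapping.lookup a k * pairing k l) * c"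
proof -
  have "form a (Poly_Mapping.single l c) = (\<Sum>k\<in>box. \<Sum>l'\<in>box. if l' = l then Poly_Mapping.lookup a k * c * pairing k l else 0)"
    unfolding form_def by (intro sum.cong refl) (auto simp: lookup_single when_def)
  then show ?thesis
    using assms by (simp add: sum_distrib_left sum_distrib_right mult_ac)
qed

lemma form_single_left:
  assumes "k \<in> box"
  shows "form (Poly_Mapping.single k c) b = c * (\<Sum>l\<in>box. Poly_Mapping.lookup b l * pairing k l)"
proof -
  have "form (Poly_Mapping.single k c) b = (\<Sum>k'\<in>box. if k' = k then \<Sum>l\<in>box. c * Poly_Mapping.lookup b l * pairing k l else 0)"
    unfolding form_def by (intro sum.cong refl) (auto simp: lookup_single when_def)
  then show ?thesis
    using assms by (simp add: sum_distrib_left sum_distrib_right mult_ac)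
qed

lemma form_single_single:
  assumes "k \<in> box" "l \<in> box"
  shows "form (Poly_Mapping.single k c) (Poly_Mapping.single l d) = c * d * pairing k l"
proof -
  have "(\<Sum>k'\<in>box. Poly_Mapping.lookup (Poly_Mapping.single k c) k' * pairing k' l) =
    (\<Sum>k'\<in>box. if k' = k then c * pairing k l else 0)"
    by (intro sum.cong refl) (auto simp: lookup_single when_def)
  then show ?thesis
    using assms by (simp add: form_single_right)
qed

text \<open>Left multiplication by the monomial with exponent \<open>a\<close>, in the group algebra
  of exponents twisted by the cocycle \<open>q powi form\<close>; bilinearity of \<open>form\<close>
  gives the cocycle identity.\<close>

definition T :: "expo \<Rightarrow> endo" where
  "T a = Abs_endo (\<lambda>x v. q powi form a (v - a) * x (v - a))"

lemma Rep_T: "Rep_endo (T a) = (\<lambda>x v. q powi form a (v - a) * x (v - a))"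
  unfolding T_def by (subst Abs_endo_inverse) (auto simp: algebra_simps)

lemma T_0 [simp]: "T 0 = 1"
  by (simp add: Rep_endo_inject[symmetric] endo_rep_eqs Rep_T form_simps)

lemma T_mult: "T a * T b = (q powi form a b) *\<^sub>c T (a + b)"
  unfolding Rep_endo_inject[symmetric] endo_rep_eqs Rep_T
proof (intro ext)
  fix x v
  have "form a (v - a) + form b (v - a - b) = form a b + form (a + b) (v - (a + b))"
    by (simp add: form_simps)
  then have "q powi form a (v - a) * q powi form b (v - a - b) = q powi form a b * q powi form (a + b) (v - (a + b))"
    using q_nz by (metis power_int_add)
  then show "q powi form a (v - a) * (q powi form b (v - a - b) * x (v - a - b)) =
    q powi form a b * (q powi form (a + b) (v - (a + b)) * x (v - (a + b)))"
    by (simp only: mult.assoc[symmetric] diff_diff_eq)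
qed

lemma coef_T [simp]: "coef (T a) b = (if a = b then 1 else 0)"
  by (auto simp: coef_def Rep_T form_simps)

text \<open>A general operator is not determined by \<open>coef\<close>. The second condition
  selects the span of the monomials \<open>T a\<close>, which is the quantum torus proper.\<close>

definition A :: "endo set" where
  "A = {f. finite (supp f) \<and> f = (\<Sum>a\<in>supp f. coef f a *\<^sub>c T a)}"

lemma sum_in_A:
  assumes "finite F"
  shows "(\<Sum>a\<in>F. c a *\<^sub>c T a) \<in> A"
proof -
  let ?f = "\<Sum>a\<in>F. c a *\<^sub>c T a"
  have cf: "coef ?f b = (if b \<in> F then c b else 0)" for b
    using assms by (simp add: coef_sum if_distrib cong: if_cong)
  then have s: "supp ?f \<subseteq> F" by (auto simp: supp_def)
  then have "?f = (\<Sum>a\<in>supp ?f. c a *\<^sub>c T a)"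
    using assms cf by (intro sum.mono_neutral_right) (auto simp: supp_def)
  also have "\<dots> = (\<Sum>a\<in>supp ?f. coef ?f a *\<^sub>c T a)"
    using s cf by (intro sum.cong refl) auto
  finally show ?thesis
    unfolding A_def using s assms finite_subset by blast
qed

lemma A_expand:
  assumes "f \<in> A" "finite F" "supp f \<subseteq> F"
  shows "f = (\<Sum>a\<in>F. coef f a *\<^sub>c T a)"
proof -
  have "f = (\<Sum>a\<in>supp f. coef f a *\<^sub>c T a)" using assms by (simp add: A_def)
  also have "\<dots> = (\<Sum>a\<in>F. coef f a *\<^sub>c T a)"
    using assms by (intro sum.mono_neutral_left) (auto simp: supp_def)
  finally show ?thesis .
qed

lemma A_finite: "f \<in> A \<Longrightarrow> finite (supp f)"
  by (simp add: A_def)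

lemma T_in_A: "T a \<in> A"
  using sum_in_A[of "{a}" "\<lambda>_. 1"] by simp

lemma zero_in_A: "0 \<in> A"
  using sum_in_A[of "{}"] by simp

lemma one_in_A: "1 \<in> A"
  using T_in_A[of 0] by simp

lemma add_in_A:
  assumes "f \<in> A" "g \<in> A"
  shows "f + g \<in> A"
proof -
  have "f + g = (\<Sum>a\<in>supp f \<union> supp g. (coef f a + coef g a) *\<^sub>c T a)"
    using assms A_expand[of f "supp f \<union> supp g"] A_expand[of g "supp f \<union> supp g"] A_finite
    by (simp add: cscale_add_left sum.distrib)
  then show ?thesis using sum_in_A A_finite assms by (metis finite_UnI)
qed

lemma cscale_in_A:
  assumes "f \<in> A"
  shows "c *\<^sub>c f \<in> A"
proof -
  have "c *\<^sub>c f = (\<Sum>a\<in>supp f. (c * coef f a) *\<^sub>c T a)"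
    using assms A_expand[of f "supp f"] A_finite by (metis (no_types, lifting) cscale_cscale cscale_sum_right subset_refl sum.cong)
  then show ?thesis using sum_in_A A_finite assms by metis
qed

lemma minus_in_A: "f \<in> A \<Longrightarrow> g \<in> A \<Longrightarrow> f - g \<in> A"
  using add_in_A[of f "(- 1) *\<^sub>c g"] cscale_in_A[of g "- 1"] by simp

lemma sum_in_A': "(\<And>i. i \<in> I \<Longrightarrow> f i \<in> A) \<Longrightarrow> (\<Sum>i\<in>I. f i) \<in> A"
  by (induction I rule: infinite_finite_induct) (auto intro: add_in_A zero_in_A)

lemma mult_expand:
  assumes "f \<in> A" "g \<in> A"
  shows "f * g = (\<Sum>a\<in>supp f. \<Sum>b\<in>supp g. (coef f a * coef g b * q powi form a b) *\<^sub>c T (a + b))"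
proof -
  have "f * g = (\<Sum>a\<in>supp f. coef f a *\<^sub>c T a) * (\<Sum>b\<in>supp g. coef g b *\<^sub>c T b)"
    using assms by (simp add: A_def)
  then show ?thesis
    by (simp add: sum_product T_mult mult.assoc mult.commute[of "coef g _"] mult.left_commute[of "coef g _"])
qed

lemma mult_in_A:
  assumes "f \<in> A" "g \<in> A"
  shows "f * g \<in> A"
  unfolding mult_expand[OF assms] by (intro sum_in_A' cscale_in_A T_in_A)

lemma coef_mult:
  assumes "f \<in> A" "g \<in> A"
  shows "coef (f * g) c = (\<Sum>a\<in>supp f. \<Sum>b\<in>supp g. if a + b = c then coef f a * coef g b * q powi form a b else 0)"
  unfolding mult_expand[OF assms] by (auto simp: coef_sum intro!: sum.cong)

lemma supp_mult:
  assumes "f \<in> A" "g \<in> A" "c \<in> supp (f * g)"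
  obtains a b where "a \<in> supp f" "b \<in> supp g" "c = a + b"
proof -
  have "\<exists>a\<in>supp f. \<exists>b\<in>supp g. c = a + b"
  proof (rule ccontr)
    assume "\<not> (\<exists>a\<in>supp f. \<exists>b\<in>supp g. c = a + b)"
    then have "coef (f * g) c = 0"
      unfolding coef_mult[OF assms(1,2)] by (intro sum.neutral ballI) auto
    with assms(3) show False by (simp add: supp_def)
  qed
  with that show ?thesis by blast
qed

text \<open>If \<open>a0 + b0\<close> splits in only one way over the two supports, nothing can
  cancel there. This serves arguments by leading exponent as well as by weight and by
  degree.\<close>

lemma coef_mult_unique:
  assumes "f \<in> A" "g \<in> A"
    and "\<And>a b. a \<in> supp f \<Longrightarrow> b \<in> supp g \<Longrightarrow> a + b = a0 + b0 \<Longrightarrow> a = a0 \<and> b = b0"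
  shows "coef (f * g) (a0 + b0) = coef f a0 * coef g b0 * q powi form a0 b0"
proof -
  have fin: "finite (supp f)" "finite (supp g)" using assms A_finite by auto
  have "coef (f * g) (a0 + b0) = (\<Sum>a\<in>supp f. \<Sum>b\<in>supp g. if a = a0 then if b = b0 then coef f a0 * coef g b0 * q powi form a0 b0 else 0 else 0)"
    unfolding coef_mult[OF assms(1,2)] using assms(3) by (intro sum.cong refl) auto
  also have "\<dots> = (\<Sum>a\<in>supp f. if a = a0 then \<Sum>b\<in>supp g. if b = b0 then coef f a0 * coef g b0 * q powi form a0 b0 else 0 else 0)"
    by (intro sum.cong refl) auto
  also have "\<dots> = coef f a0 * coef g b0 * q powi form a0 b0"
    using fin by (auto simp: supp_def)
  finally show ?thesis .
qed

lemma supp_nonempty: "f \<in> A \<Longrightarrow> f \<noteq> 0 \<Longrightarrow> supp f \<noteq> {}"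
  using A_expand[of f "{}"] by auto

section \<open>Leading exponents and weights under conjugation\<close>

definition lead :: "endo \<Rightarrow> expo" where
  "lead f = Max (supp f)"

lemma lead_in: "f \<in> A \<Longrightarrow> f \<noteq> 0 \<Longrightarrow> lead f \<in> supp f"
  unfolding lead_def using A_finite supp_nonempty by (metis Max_in)

lemma lead_ge: "f \<in> A \<Longrightarrow> a \<in> supp f \<Longrightarrow> a \<le> lead f"
  unfolding lead_def using A_finite by (metis Max_ge)

lemma leadI: "f \<in> A \<Longrightarrow> a \<in> supp f \<Longrightarrow> (\<And>b. b \<in> supp f \<Longrightarrow> b \<le> a) \<Longrightarrow> lead f = a"
  unfolding lead_def using A_finite by (intro Max_eqI) auto

lemma add_eq_bounds:
  fixes a b a0 b0 :: "'a::linordered_ab_group_add"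
  assumes "a + b = a0 + b0" "a \<le> a0" "b \<le> b0"
  shows "a = a0 \<and> b = b0"
  using assms add_less_le_mono[of a a0 b b0] add_le_less_mono[of a a0 b b0] by (auto simp: le_less)

lemma coef_lead_mult:
  assumes "f \<in> A" "g \<in> A"
  shows "coef (f * g) (lead f + lead g) = coef f (lead f) * coef g (lead g) * q powi form (lead f) (lead g)"
  using assms by (intro coef_mult_unique add_eq_bounds lead_ge) auto

lemma lead_mult:
  assumes "f \<in> A" "g \<in> A" "f \<noteq> 0" "g \<noteq> 0"
  shows "lead (f * g) = lead f + lead g" "f * g \<noteq> 0"
proof -
  have "lead f + lead g \<in> supp (f * g)"
    using lead_in[of f] lead_in[of g] assms q_nz by (simp add: supp_def coef_lead_mult)
  moreover have "c \<le> lead f + lead g" if "c \<in> supp (f * g)" for c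
    using supp_mult[OF assms(1,2) that] add_mono lead_ge assms(1,2) by metis
  ultimately show "lead (f * g) = lead f + lead g"
    using assms by (intro leadI mult_in_A) auto
  show "f * g \<noteq> 0"
    using \<open>lead f + lead g \<in> supp (f * g)\<close> by (auto simp: supp_def)
qed

lemma A_no_zero_divisors: "f \<in> A \<Longrightarrow> g \<in> A \<Longrightarrow> f * g = 0 \<Longrightarrow> f = 0 \<or> g = 0"
  using lead_mult(2) by blast

lemma A_right_cancel: "f \<in> A \<Longrightarrow> g \<in> A \<Longrightarrow> h \<in> A \<Longrightarrow> h \<noteq> 0 \<Longrightarrow> f * h = g * h \<Longrightarrow> f = g"
  using A_no_zero_divisors[of "f - g" h] minus_in_A[of f g] by (auto simp: left_diff_distrib)

text \<open>Ties in the weight \<open>\<omega>\<close> are broken by the total order on exponents.\<close>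

lemma weight_bound:
  fixes \<omega> :: "expo \<Rightarrow> int"
  assumes add: "\<And>a b. \<omega> (a + b) = \<omega> a + \<omega> b"
    and A: "z \<in> A" "y \<in> A" "y' \<in> A" and z: "z \<noteq> 0" and eq: "z * y = y' * z"
    and y: "\<And>a. a \<in> supp y \<Longrightarrow> \<omega> a \<le> d" and a: "a \<in> supp y'"
  shows "\<omega> a \<le> d"
proof -
  define top where "top f = Max {b \<in> supp f. \<omega> b = Max (\<omega> ` supp f)}" for f
  have top: "top f \<in> supp f" "\<And>b. b \<in> supp f \<Longrightarrow> \<omega> b \<le> \<omega> (top f)"
    "\<And>b. b \<in> supp f \<Longrightarrow> \<omega> b = \<omega> (top f) \<Longrightarrow> b \<le> top f" if "f \<in> A" "f \<noteq> 0" for f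
  proof -
    have fin: "finite (supp f)" "supp f \<noteq> {}" using that A_finite supp_nonempty by auto
    then have "Max (\<omega> ` supp f) \<in> \<omega> ` supp f" by (intro Max_in) auto
    then have "{b \<in> supp f. \<omega> b = Max (\<omega> ` supp f)} \<noteq> {}" by auto
    then have "top f \<in> {b \<in> supp f. \<omega> b = Max (\<omega> ` supp f)}"
      unfolding top_def using fin by (intro Max_in) auto
    then have *: "top f \<in> supp f" "\<omega> (top f) = Max (\<omega> ` supp f)" by auto
    then show "top f \<in> supp f" "\<And>b. b \<in> supp f \<Longrightarrow> \<omega> b \<le> \<omega> (top f)" using fin by auto
    show "\<And>b. b \<in> supp f \<Longrightarrow> \<omega> b = \<omega> (top f) \<Longrightarrow> b \<le> top f"
      unfolding *(2) unfolding top_def using fin by (intro Max_ge) auto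
  qed
  have y'0: "y' \<noteq> 0" using a by (auto simp: supp_def)
  have u: "b = top y' \<and> c = top z" if "b \<in> supp y'" "c \<in> supp z" "b + c = top y' + top z" for b c
  proof -
    have "\<omega> b + \<omega> c = \<omega> (top y') + \<omega> (top z)" using that(3) add by metis
    then have "\<omega> b = \<omega> (top y')" "\<omega> c = \<omega> (top z)"
      using top(2)[OF A(3) y'0 that(1)] top(2)[OF A(1) z that(2)] by linarith+
    then show ?thesis
      using that add_eq_bounds top(3)[OF A(3) y'0] top(3)[OF A(1) z] by blast
  qed
  have "coef (y' * z) (top y' + top z) = coef y' (top y') * coef z (top z) * q powi form (top y') (top z)"
    by (rule coef_mult_unique[OF A(3,1)]) (rule u)
  then have "coef (y' * z) (top y' + top z) \<noteq> 0"
    using top(1)[OF A(3) y'0] top(1)[OF A(1) z] q_nz by (simp add: supp_def)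
  \<comment> \<open>The top exponent survives in \<open>y' * z\<close>, so it also splits over
    \<open>z\<close> and \<open>y\<close>. The part from \<open>z\<close> weighs at most as much as
    \<open>top z\<close>, hence the bound on \<open>y\<close> passes to
    \<open>top y'\<close>.\<close>
  then have "top y' + top z \<in> supp (z * y)" by (simp add: supp_def eq)
  then obtain b c where bc: "b \<in> supp z" "c \<in> supp y" "top y' + top z = b + c"
    by (rule supp_mult[OF A(1,2)])
  then have "\<omega> (top y') + \<omega> (top z) = \<omega> b + \<omega> c" using add by metis
  then have "\<omega> (top y') \<le> d" using top(2)[OF A(1) z bc(1)] y[OF bc(2)] by linarith
  then show ?thesis using top(2)[OF A(3) y'0 a] by linarith
qed

text \<open>Apply the bound to \<open>\<omega>\<close> and to \<open>- \<omega>\<close>: conjugation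
  by \<open>z\<close> preserves homogeneity although \<open>z\<close> itself may be
  inhomogeneous.\<close>

lemma weight_transfer:
  fixes \<omega> :: "expo \<Rightarrow> int"
  assumes add: "\<And>a b. \<omega> (a + b) = \<omega> a + \<omega> b"
    and A: "z \<in> A" "y \<in> A" "y' \<in> A" and z: "z \<noteq> 0" and eq: "z * y = y' * z"
    and y: "\<And>a. a \<in> supp y \<Longrightarrow> \<omega> a = d" and a: "a \<in> supp y'"
  shows "\<omega> a = d"
proof -
  have "\<omega> a \<le> d"
    by (rule weight_bound[OF add A z eq _ a]) (simp add: y)
  moreover have "- \<omega> a \<le> - d"
    by (rule weight_bound[of "\<lambda>a. - \<omega> a", OF _ A z eq _ a]) (simp_all add: y add)
  ultimately show ?thesis by simp
qed

end

section \<open>The embedding of the generators\<close>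

text \<open>Among the four corners, \<open>(i, \<alpha>)\<close> comes first in row-major order and
  therefore decides the lexicographic comparison; it occurs only on the right.\<close>

lemma less_unit_vec:
  assumes "i < r" "\<alpha> < s"
  shows "unit_vec i s - unit_vec r s + unit_vec r \<alpha> < unit_vec i \<alpha>"
proof -
  have "less_fun (Poly_Mapping.lookup (unit_vec i s - unit_vec r s + unit_vec r \<alpha>)) (Poly_Mapping.lookup (unit_vec i \<alpha>))"
    unfolding less_fun_def
    by (rule exI[of _ "(i, \<alpha>)"]) (use assms in \<open>auto simp: lookup_add lookup_minus lookup_single when_def\<close>)
  then show ?thesis by (simp add: less_poly_mapping.rep_eq)
qed

context quantum_torus
begin

definition row_weight :: "nat \<Rightarrow> expo \<Rightarrow> int" where
  "row_weight k a = (\<Sum>\<beta>\<in>{1..n}. Poly_Mapping.lookup a (k, \<beta>))"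

definition col_weight :: "nat \<Rightarrow> expo \<Rightarrow> int" where
  "col_weight k a = (\<Sum>j\<in>{1..m}. Poly_Mapping.lookup a (j, k))"

lemma weight_simps:
  "row_weight k (a + b) = row_weight k a + row_weight k b"
  "row_weight k (- a) = - row_weight k a" "row_weight k 0 = 0"
  "col_weight k (a + b) = col_weight k a + col_weight k b"
  "col_weight k (- a) = - col_weight k a" "col_weight k 0 = 0"
  by (simp_all add: row_weight_def col_weight_def lookup_add sum.distrib sum_negf)

lemma row_weight_unit_vec: "\<alpha> \<in> {1..n} \<Longrightarrow> row_weight k (unit_vec i \<alpha>) = (if k = i then 1 else 0)"
  by (auto simp: row_weight_def lookup_single when_def)

lemma col_weight_unit_vec: "i \<in> {1..m} \<Longrightarrow> col_weight k (unit_vec i \<alpha>) = (if k = \<alpha> then 1 else 0)"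
  by (auto simp: col_weight_def lookup_single when_def)

text \<open>The invariant of the backward algorithm: entries stay monic with the expected leading
  monomial, and homogeneous for every row and column weight.\<close>

definition entry :: "nat \<Rightarrow> nat \<Rightarrow> endo \<Rightarrow> bool" where
  "entry i \<alpha> f \<longleftrightarrow> f \<in> A \<and> coef f (unit_vec i \<alpha>) = 1 \<and>
    (\<forall>a\<in>supp f. a \<le> unit_vec i \<alpha> \<and> (\<forall>k. row_weight k a = (if k = i then 1 else 0)) \<and>
      (\<forall>k. col_weight k a = (if k = \<alpha> then 1 else 0)))"

lemma entry_T:
  assumes "i \<in> {1..m}" "\<alpha> \<in> {1..n}"
  shows "entry i \<alpha> (T (unit_vec i \<alpha>))"
  using assms by (auto simp: entry_def T_in_A supp_def row_weight_unit_vec col_weight_unit_vec)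

text \<open>The added product has the weights of position \<open>(i, \<alpha>)\<close>, because
  those of the pivot cancel, and its exponents are smaller by \<open>less_unit_vec\<close>.\<close>

lemma entry_update:
  assumes "i < r" "\<alpha> < s" "r \<in> {1..m}" "s \<in> {1..n}"
    and f: "entry i \<alpha> f" and u: "entry i s u" and w: "entry r \<alpha> w"
  shows "entry i \<alpha> (f + u * T (- unit_vec r s) * w)"
proof -
  let ?Z = "u * T (- unit_vec r s) * w"
  have A: "f \<in> A" "u \<in> A" "w \<in> A" "u * T (- unit_vec r s) \<in> A" "?Z \<in> A"
    using f u w by (auto simp: entry_def intro: mult_in_A T_in_A)
  have Z: "a < unit_vec i \<alpha> \<and> (\<forall>k. row_weight k a = (if k = i then 1 else 0)) \<and>
      (\<forall>k. col_weight k a = (if k = \<alpha> then 1 else 0))" if a: "a \<in> supp ?Z" for a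
  proof -
    obtain b c where b: "b \<in> supp (u * T (- unit_vec r s))" and c: "c \<in> supp w" and a_eq: "a = b + c"
      using supp_mult[OF A(4,3) a] .
    obtain d e where d: "d \<in> supp u" and "e \<in> supp (T (- unit_vec r s))" and "b = d + e"
      using supp_mult[OF A(2) T_in_A b] .
    then have a': "a = d + - unit_vec r s + c" using a_eq by (simp add: supp_def split: if_splits)
    have "d \<le> unit_vec i s" "c \<le> unit_vec r \<alpha>" using d c u w by (auto simp: entry_def)
    then have "a \<le> unit_vec i s - unit_vec r s + unit_vec r \<alpha>"
      unfolding a' by (simp add: add_mono)
    also have "\<dots> < unit_vec i \<alpha>" using less_unit_vec assms by blast
    finally show ?thesis
      using d c u w assms unfolding a' weight_simps
      by (auto simp: entry_def row_weight_unit_vec col_weight_unit_vec)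
  qed
  have "unit_vec i \<alpha> \<notin> supp ?Z" using Z by blast
  then have "coef ?Z (unit_vec i \<alpha>) = 0" by (simp add: supp_def)
  moreover have "a \<le> unit_vec i \<alpha> \<and> (\<forall>k. row_weight k a = (if k = i then 1 else 0)) \<and>
      (\<forall>k. col_weight k a = (if k = \<alpha> then 1 else 0))" if "a \<in> supp (f + ?Z)" for a
  proof (cases "a \<in> supp f")
    case True
    then show ?thesis using f by (simp add: entry_def)
  next
    case False
    then have "a \<in> supp ?Z" using that by (auto simp: supp_def)
    from Z[OF this] show ?thesis by (auto intro: less_imp_le)
  qed
  moreover have "f + ?Z \<in> A" using A by (intro add_in_A)
  ultimately show ?thesis
    using f by (simp add: entry_def)
qed

section \<open>Cauchon's algorithm run backwards, pivot by pivot in row-major order\<close>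

definition update :: "(nat \<Rightarrow> nat \<Rightarrow> endo) \<Rightarrow> nat \<Rightarrow> nat \<Rightarrow> nat \<Rightarrow> nat \<Rightarrow> endo" where
  "update Y r s i \<alpha> = (if i < r \<and> \<alpha> < s then Y i \<alpha> + Y i s * T (- unit_vec r s) * Y r \<alpha> else Y i \<alpha>)"

primrec row_pass :: "(nat \<Rightarrow> nat \<Rightarrow> endo) \<Rightarrow> nat \<Rightarrow> nat \<Rightarrow> nat \<Rightarrow> nat \<Rightarrow> endo" where
  "row_pass Y r 0 = Y"
| "row_pass Y r (Suc s) = update (row_pass Y r s) r (Suc s)"

primrec stage :: "nat \<Rightarrow> nat \<Rightarrow> nat \<Rightarrow> endo" where
  "stage 0 = (\<lambda>i \<alpha>. T (unit_vec i \<alpha>))"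
| "stage (Suc r) = row_pass (stage r) (Suc r) n"

text \<open>A pass changes only rows above its pivot row. So in each step the pivot is still a
  single monomial and has an inverse in the torus.\<close>

lemma row_pass_below: "r \<le> i \<Longrightarrow> row_pass Y r s i \<alpha> = Y i \<alpha>"
  by (induction s) (auto simp: update_def)

lemma stage_below: "r < i \<Longrightarrow> stage r i \<alpha> = T (unit_vec i \<alpha>)"
  by (induction r) (auto simp: row_pass_below)

lemma entry_row_pass:
  assumes "r \<in> {1..m}" "\<And>i \<alpha>. i \<in> {1..m} \<Longrightarrow> \<alpha> \<in> {1..n} \<Longrightarrow> entry i \<alpha> (Y i \<alpha>)"
  shows "s \<le> n \<Longrightarrow> i \<in> {1..m} \<Longrightarrow> \<alpha> \<in> {1..n} \<Longrightarrow> entry i \<alpha> (row_pass Y r s i \<alpha>)"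
  by (induction s arbitrary: i \<alpha>) (use assms in \<open>auto simp: update_def intro!: entry_update\<close>)

lemma entry_stage: "r \<le> m \<Longrightarrow> i \<in> {1..m} \<Longrightarrow> \<alpha> \<in> {1..n} \<Longrightarrow> entry i \<alpha> (stage r i \<alpha>)"
  by (induction r arbitrary: i \<alpha>) (auto intro!: entry_T entry_row_pass)

text \<open>No diagonal pair has its lower right corner before \<open>(1, 1)\<close>, so all
  diagonal pairs have to commute; and \<open>pairing\<close> vanishes on them.\<close>

lemma stage_torus: "cauchon_stage q (\<lambda>i \<alpha>. T (unit_vec i \<alpha>)) {1..m} {1..n} (Suc 0) 1"
proof
  have *: "T (unit_vec j \<beta>) * T (unit_vec i \<alpha>) = (q powi pairing (j, \<beta>) (i, \<alpha>)) *\<^sub>c T (unit_vec j \<beta> + unit_vec i \<alpha>)"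
    if "i \<in> {1..m}" "j \<in> {1..m}" "\<alpha> \<in> {1..n}" "\<beta> \<in> {1..n}" for i j \<alpha> \<beta>
    using that by (simp add: T_mult form_single_single box_def)
  fix i j \<alpha> \<beta>
  assume i: "i \<in> {1..m}" and a: "\<alpha> \<in> {1..n}"
  show "T (unit_vec i \<beta>) * T (unit_vec i \<alpha>) = inverse q *\<^sub>c (T (unit_vec i \<alpha>) * T (unit_vec i \<beta>))"
    if "\<beta> \<in> {1..n}" "\<alpha> < \<beta>"
    using i a that by (simp add: * pairing_def add.commute power_int_minus)
  assume j: "j \<in> {1..m}" and ij: "i < j"
  show "T (unit_vec j \<alpha>) * T (unit_vec i \<alpha>) = inverse q *\<^sub>c (T (unit_vec i \<alpha>) * T (unit_vec j \<alpha>))"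
    using i j a ij by (simp add: * pairing_def add.commute power_int_minus)
  assume b: "\<beta> \<in> {1..n}"
  show "T (unit_vec j \<beta>) * T (unit_vec i \<alpha>) = T (unit_vec i \<alpha>) * T (unit_vec j \<beta>)" if "\<beta> < \<alpha>"
    using i j a b ij that by (simp add: * pairing_def add.commute)
  show "T (unit_vec j \<beta>) * T (unit_vec i \<alpha>) = T (unit_vec i \<alpha>) * T (unit_vec j \<beta>)" if "\<alpha> < \<beta>"
    using i j a b ij that by (simp add: * pairing_def add.commute)
  show "T (unit_vec j \<beta>) * T (unit_vec i \<alpha>) = T (unit_vec i \<alpha>) * T (unit_vec j \<beta>) -
      (q - inverse q) *\<^sub>c (T (unit_vec i \<beta>) * T (unit_vec j \<alpha>))" if "j < Suc 0 \<or> j = Suc 0 \<and> \<beta> < 1"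
    using that i ij b by auto
qed (rule q_nz)

lemma stage_row_pass:
  assumes "r \<in> {1..m}" "cauchon_stage q Y {1..m} {1..n} r 1" "\<And>\<alpha>. Y r \<alpha> = T (unit_vec r \<alpha>)"
  shows "s \<le> n \<Longrightarrow> cauchon_stage q (row_pass Y r s) {1..m} {1..n} r (Suc s)"
proof (induction s)
  case 0
  then show ?case using assms by simp
next
  case (Suc s)
  interpret S: cauchon_stage q "row_pass Y r s" "{1..m}" "{1..n}" r "Suc s"
    using Suc by simp
  interpret S: cauchon_step q "row_pass Y r s" "{1..m}" "{1..n}" r "Suc s" "T (- unit_vec r (Suc s))"
  proof
    have "form (unit_vec r (Suc s)) (unit_vec r (Suc s)) = 0"
      using assms(1) Suc.prems by (subst form_single_single) (auto simp: box_def)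
    then show "row_pass Y r s r (Suc s) * T (- unit_vec r (Suc s)) = 1"
      "T (- unit_vec r (Suc s)) * row_pass Y r s r (Suc s) = 1"
      by (simp_all add: row_pass_below assms(3) T_mult form_simps)
  qed (use assms Suc.prems in auto)
  have "update (row_pass Y r s) r (Suc s) = S.Y'"
    by (intro ext) (simp add: update_def S.Y'_def)
  then show ?case using S.step by simp
qed

text \<open>The position behind the last column and the start of the next row are preceded by the
  same positions of the matrix.\<close>

lemma cauchon_stage_next_row:
  assumes "cauchon_stage q Y {1..m} {1..n} r (Suc n)"
  shows "cauchon_stage q Y {1..m} {1..n} (Suc r) 1"
proof -
  interpret cauchon_stage q Y "{1..m}" "{1..n}" r "Suc n" by (rule assms)
  show ?thesis
    by unfold_locales
      (rule q0 | (rule row col anti; assumption) | (rule active; fastforce) | (rule inactive; fastforce))+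
qed

lemma stage_relations: "r \<le> m \<Longrightarrow> cauchon_stage q (stage r) {1..m} {1..n} (Suc r) 1"
proof (induction r)
  case 0
  then show ?case using stage_torus by simp
next
  case (Suc r)
  then show ?case
    using cauchon_stage_next_row stage_row_pass[of "Suc r" "stage r" n] by (simp add: stage_below)
qed

definition y :: "nat \<Rightarrow> nat \<Rightarrow> endo" where
  "y = stage m"

lemma entry_y: "i \<in> {1..m} \<Longrightarrow> \<alpha> \<in> {1..n} \<Longrightarrow> entry i \<alpha> (y i \<alpha>)"
  unfolding y_def by (rule entry_stage) auto

text \<open>At the final position \<open>(m + 1, 1)\<close> every diagonal pair has become active,
  which leaves precisely the relations of quantum matrices.\<close>

sublocale y: quantum_matrix q y "{1..m}" "{1..n}"
proof -
  interpret cauchon_stage q y "{1..m}" "{1..n}" "Suc m" 1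
    unfolding y_def by (rule stage_relations) simp
  show "quantum_matrix q y {1..m} {1..n}"
    by unfold_locales (rule q0 | (rule row col anti; assumption) | (rule active; fastforce))+
qed

lemma y_in_A: "i \<in> {1..m} \<Longrightarrow> \<alpha> \<in> {1..n} \<Longrightarrow> y i \<alpha> \<in> A"
  using entry_y by (simp add: entry_def)

lemma y_nonzero: "i \<in> {1..m} \<Longrightarrow> \<alpha> \<in> {1..n} \<Longrightarrow> y i \<alpha> \<noteq> 0"
  using entry_y[of i \<alpha>] by (auto simp: entry_def)

lemma lead_y: "i \<in> {1..m} \<Longrightarrow> \<alpha> \<in> {1..n} \<Longrightarrow> lead (y i \<alpha>) = unit_vec i \<alpha>"
  using entry_y[of i \<alpha>] by (intro leadI) (auto simp: entry_def supp_def)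

lemma coef_lead_y: "i \<in> {1..m} \<Longrightarrow> \<alpha> \<in> {1..n} \<Longrightarrow> coef (y i \<alpha>) (lead (y i \<alpha>)) = 1"
  using entry_y[of i \<alpha>] by (simp add: lead_y entry_def)

lemma weights_y:
  "i \<in> {1..m} \<Longrightarrow> \<alpha> \<in> {1..n} \<Longrightarrow> a \<in> supp (y i \<alpha>) \<Longrightarrow> row_weight k a = (if k = i then 1 else 0)"
  "i \<in> {1..m} \<Longrightarrow> \<alpha> \<in> {1..n} \<Longrightarrow> a \<in> supp (y i \<alpha>) \<Longrightarrow> col_weight k a = (if k = \<alpha> then 1 else 0)"
  using entry_y[of i \<alpha>] by (auto simp: entry_def)

end

section \<open>Straightening and injectivity\<close>

lemma poly_mapping_expand:
  fixes p :: "'a \<Rightarrow>\<^sub>0 'b::comm_monoid_add"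
  shows "p = (\<Sum>w\<in>Poly_Mapping.keys p. Poly_Mapping.single w (Poly_Mapping.lookup p w))"
  by (rule poly_mapping_eqI) (simp add: lookup_sum lookup_single when_def not_in_keys_iff_lookup_eq_zero)

lemma scal_mult: "scal c * p = Poly_Mapping.map ((*) c) p"
proof -
  have "scal c * p = (\<Sum>w\<in>Poly_Mapping.keys p. Poly_Mapping.single w (c * Poly_Mapping.lookup p w))"
    by (subst (1) poly_mapping_expand[of p]) (simp add: sum_distrib_left scal_def mult_single)
  also have "\<dots> = Poly_Mapping.map ((*) c) p"
    by (rule poly_mapping_eqI) (simp add: lookup_sum lookup_single when_def map.rep_eq not_in_keys_iff_lookup_eq_zero)
  finally show ?thesis .
qed

lemma lookup_scal_mult: "Poly_Mapping.lookup (scal c * p) w = c * Poly_Mapping.lookup p w"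
  by (simp add: scal_mult map.rep_eq when_def)

lemma plus_word_letters [simp]: "letters (u + v) = letters u @ letters v"
  by (simp add: plus_word_def)

section \<open>Evaluation of the free algebra in the torus\<close>

context quantum_torus
begin

definition box_word :: "(nat \<times> nat) word \<Rightarrow> bool" where
  "box_word w \<longleftrightarrow> set (letters w) \<subseteq> box"

lemma carrier_iff: "p \<in> carrier (free_alg m n) \<longleftrightarrow> (\<forall>w\<in>Poly_Mapping.keys p. box_word w)"
  by (simp add: free_alg_def box_word_def box_def)

definition eval_word :: "(nat \<times> nat) word \<Rightarrow> endo" where
  "eval_word w = prod_list (map (\<lambda>(i, \<alpha>). y i \<alpha>) (letters w))"

definition word_expo :: "(nat \<times> nat) word \<Rightarrow> expo" where
  "word_expo w = sum_list (map (\<lambda>(i, \<alpha>). unit_vec i \<alpha>) (letters w))"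

definition phi :: "qm_free \<Rightarrow> endo" where
  "phi p = (\<Sum>w\<in>Poly_Mapping.keys p. Poly_Mapping.lookup p w *\<^sub>c eval_word w)"

lemma eval_word_plus: "eval_word (u + v) = eval_word u * eval_word v"
  by (simp add: eval_word_def)

lemma phi_superset: "finite F \<Longrightarrow> Poly_Mapping.keys p \<subseteq> F \<Longrightarrow> phi p = (\<Sum>w\<in>F. Poly_Mapping.lookup p w *\<^sub>c eval_word w)"
  unfolding phi_def by (rule sum.mono_neutral_left) (auto simp: in_keys_iff)

lemma phi_zero [simp]: "phi 0 = 0"
  by (simp add: phi_def)

lemma phi_add: "phi (p + r) = phi p + phi r"
proof -
  let ?F = "Poly_Mapping.keys p \<union> Poly_Mapping.keys r"
  have "Poly_Mapping.keys (p + r) \<subseteq> ?F" by (rule Poly_Mapping.keys_add)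
  then show ?thesis
    using phi_superset[of ?F p] phi_superset[of ?F r] phi_superset[of ?F "p + r"]
    by (simp add: lookup_add cscale_add_left sum.distrib)
qed

lemma phi_minus: "phi (p - r) = phi p - phi r"
  using phi_add[of "p - r" r] by simp

lemma phi_sum: "phi (\<Sum>i\<in>I. f i) = (\<Sum>i\<in>I. phi (f i))"
  by (induction I rule: infinite_finite_induct) (simp_all add: phi_add)

lemma phi_single: "phi (Poly_Mapping.single w c) = c *\<^sub>c eval_word w"
  by (simp add: phi_def)

lemma phi_mult: "phi (p * r) = phi p * phi r"
proof -
  have "phi (p * r) = (\<Sum>u\<in>Poly_Mapping.keys p. \<Sum>v\<in>Poly_Mapping.keys r.
    (Poly_Mapping.lookup p u * Poly_Mapping.lookup r v) *\<^sub>c (eval_word u * eval_word v))"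
    by (subst (1) poly_mapping_expand[of p], subst (1) poly_mapping_expand[of r])
      (simp add: sum_product mult_single phi_sum phi_single eval_word_plus)
  also have "\<dots> = phi p * phi r"
    by (simp add: phi_def sum_product mult.commute)
  finally show ?thesis .
qed

lemma eval_word_0 [simp]: "eval_word 0 = 1"
  by (simp add: eval_word_def zero_word_def)

lemma phi_one [simp]: "phi 1 = 1"
  using phi_single[of 0 1] by (simp add: single_one)

lemma phi_scal [simp]: "phi (scal c) = c *\<^sub>c 1"
  by (simp add: scal_def phi_single)

lemma phi_gen [simp]: "phi (gen i \<alpha>) = y i \<alpha>"
  by (simp add: gen_def phi_single eval_word_def)

lemma phi_relations: "p \<in> qm_relations q m n \<Longrightarrow> phi p = 0"
  unfolding qm_relations_def
  by (auto simp: phi_minus phi_mult y.row[simplified] y.col[simplified] y.anti[simplified] y.diag[simplified])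

lemma phi_ideal:
  assumes "p \<in> qm_ideal q m n"
  shows "phi p = 0"
proof -
  interpret F: ring "free_alg m n" by (rule ring_free_alg)
  let ?K = "{p \<in> carrier (free_alg m n). phi p = 0}"
  have "ideal ?K (free_alg m n)"
  proof (rule idealI)
    show "subgroup ?K (add_monoid (free_alg m n))"
    proof (rule F.add.subgroupI)
      fix a assume a: "a \<in> ?K"
      have "\<ominus>\<^bsub>free_alg m n\<^esub> a = 0 - a"
        by (rule F.minus_equality) (use a free_alg_minus[OF free_alg_zero, of a m n] in \<open>simp_all add: free_alg_simps\<close>)
      then show "\<ominus>\<^bsub>free_alg m n\<^esub> a \<in> ?K"
        using a free_alg_minus[OF free_alg_zero, of a m n] phi_minus[of 0 a] by simp
    qed (use free_alg_zero in \<open>auto simp: free_alg_simps free_alg_plus phi_add\<close>)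
  qed (auto simp: free_alg_simps free_alg_times phi_mult ring_free_alg)
  moreover have "qm_relations q m n \<subseteq> ?K"
    using phi_relations qm_relations_closed by blast
  ultimately have "Idl\<^bsub>free_alg m n\<^esub> (qm_relations q m n) \<subseteq> ?K"
    by (rule F.genideal_minimal)
  then show ?thesis using assms by (auto simp: qm_ideal_def)
qed

lemma ideal_closed:
  "a \<in> qm_ideal q m n \<Longrightarrow> b \<in> qm_ideal q m n \<Longrightarrow> a + b \<in> qm_ideal q m n"
  "a \<in> qm_ideal q m n \<Longrightarrow> x \<in> carrier (free_alg m n) \<Longrightarrow> x * a \<in> qm_ideal q m n"
  "a \<in> qm_ideal q m n \<Longrightarrow> x \<in> carrier (free_alg m n) \<Longrightarrow> a * x \<in> qm_ideal q m n"
  "0 \<in> qm_ideal q m n" "qm_relations q m n \<subseteq> qm_ideal q m n"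
proof -
  interpret I: ideal "qm_ideal q m n" "free_alg m n" by (rule ideal_qm_ideal)
  show "a \<in> qm_ideal q m n \<Longrightarrow> b \<in> qm_ideal q m n \<Longrightarrow> a + b \<in> qm_ideal q m n"
    using additive_subgroup.a_closed[OF I.additive_subgroup_axioms] by (simp add: free_alg_simps)
  show "a \<in> qm_ideal q m n \<Longrightarrow> x \<in> carrier (free_alg m n) \<Longrightarrow> x * a \<in> qm_ideal q m n"
    using I.I_l_closed by (simp add: free_alg_simps)
  show "a \<in> qm_ideal q m n \<Longrightarrow> x \<in> carrier (free_alg m n) \<Longrightarrow> a * x \<in> qm_ideal q m n"
    using I.I_r_closed by (simp add: free_alg_simps)
  show "0 \<in> qm_ideal q m n"
    using additive_subgroup.zero_closed[OF I.additive_subgroup_axioms] by (simp add: free_alg_simps)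
  show "qm_relations q m n \<subseteq> qm_ideal q m n"
    unfolding qm_ideal_def by (rule ring.genideal_self[OF ring_free_alg qm_relations_closed])
qed

section \<open>Spanning: every word reduces to sorted words modulo the relations\<close>

definition sorted_combination :: "qm_free \<Rightarrow> bool" where
  "sorted_combination r \<longleftrightarrow> r \<in> carrier (free_alg m n) \<and> (\<forall>w\<in>Poly_Mapping.keys r. sorted (letters w))"

definition straightens :: "qm_free \<Rightarrow> bool" where
  "straightens p \<longleftrightarrow> (\<exists>r. sorted_combination r \<and> p - r \<in> qm_ideal q m n)"

lemma sorted_combination_add: "sorted_combination p \<Longrightarrow> sorted_combination r \<Longrightarrow> sorted_combination (p + r)"
  unfolding sorted_combination_def using Poly_Mapping.keys_add[of p r] by (auto intro: free_alg_plus)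

lemma sorted_combination_scal:
  assumes "sorted_combination p"
  shows "sorted_combination (scal c * p)"
proof -
  have "Poly_Mapping.keys (scal c * p) \<subseteq> Poly_Mapping.keys p" by (auto simp: in_keys_iff lookup_scal_mult)
  then show ?thesis
    using assms unfolding sorted_combination_def by (auto intro: free_alg_times scal_closed)
qed

lemma straightens_add:
  assumes "straightens p" "straightens r"
  shows "straightens (p + r)"
proof -
  obtain p' r' where "sorted_combination p'" "p - p' \<in> qm_ideal q m n" "sorted_combination r'" "r - r' \<in> qm_ideal q m n"
    using assms by (auto simp: straightens_def)
  moreover have "p + r - (p' + r') = (p - p') + (r - r')" by simp
  ultimately show ?thesis unfolding straightens_def using sorted_combination_add ideal_closed(1) by metis
qed

lemma straightens_scal:
  assumes "straightens p"
  shows "straightens (scal c * p)"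
proof -
  obtain p' where "sorted_combination p'" "p - p' \<in> qm_ideal q m n"
    using assms by (auto simp: straightens_def)
  moreover have "scal c * p - scal c * p' = scal c * (p - p')" by (simp add: right_diff_distrib)
  ultimately show ?thesis
    unfolding straightens_def using sorted_combination_scal ideal_closed(2) scal_closed by metis
qed

lemma straightens_ideal:
  assumes "p - r \<in> qm_ideal q m n" "straightens r"
  shows "straightens p"
proof -
  obtain r' where "sorted_combination r'" "r - r' \<in> qm_ideal q m n"
    using assms by (auto simp: straightens_def)
  moreover have "p - r' = (p - r) + (r - r')" by simp
  ultimately show ?thesis unfolding straightens_def using ideal_closed(1) assms(1) by metis
qed

lemma straightens_sum: "(\<And>i. i \<in> I \<Longrightarrow> straightens (f i)) \<Longrightarrow> straightens (\<Sum>i\<in>I. f i)"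
proof (induction I rule: infinite_finite_induct)
  case empty
  have "sorted_combination 0" by (simp add: sorted_combination_def free_alg_zero)
  then show ?case unfolding straightens_def using ideal_closed(4) by force
next
  case (infinite I)
  have "sorted_combination 0" by (simp add: sorted_combination_def free_alg_zero)
  then show ?case unfolding straightens_def using ideal_closed(4) infinite by force
qed (auto intro: straightens_add)

abbreviation word_poly :: "(nat \<times> nat) list \<Rightarrow> qm_free" where
  "word_poly ws \<equiv> Poly_Mapping.single (Word ws) 1"

lemma word_poly_append: "word_poly (us @ vs) = word_poly us * word_poly vs"
  by (simp add: mult_single plus_word_def)

lemma word_poly_carrier: "word_poly ws \<in> carrier (free_alg m n) \<longleftrightarrow> set ws \<subseteq> box"
  by (simp add: carrier_iff box_word_def)

text \<open>The correction word of a diagonal pair also starts with a letter from the upper row,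
  hence smaller than \<open>x\<close>. This bound on \<open>z'\<close> is what makes the rewriting
  terminate.\<close>

lemma swap_letters:
  assumes "x \<in> box" "z \<in> box" "z < x"
  shows "\<exists>c d x' z'. word_poly [x, z] - (scal c * word_poly [z, x] + scal d * word_poly [z', x']) \<in> qm_ideal q m n \<and>
    x' \<in> box \<and> z' \<in> box \<and> z' < x"
proof -
  obtain j \<beta> i \<alpha> where xz: "x = (j, \<beta>)" "z = (i, \<alpha>)" by (cases x, cases z) auto
  have box: "i \<in> {1..m}" "j \<in> {1..m}" "\<alpha> \<in> {1..n}" "\<beta> \<in> {1..n}" using assms xz by (auto simp: box_def)
  have g: "gen a b * gen a' b' = word_poly [(a, b), (a', b')]" for a b a' b'
    by (simp add: gen_def mult_single plus_word_def)
  have s0: "scal 0 = 0" by (simp add: scal_def)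
  have rel: "r \<in> qm_relations q m n \<Longrightarrow> r \<in> qm_ideal q m n" for r using ideal_closed(5) by blast
  consider "i = j" "\<alpha> < \<beta>" | "i < j" "\<alpha> = \<beta>" | "i < j" "\<beta> < \<alpha>" | "i < j" "\<alpha> < \<beta>"
    using assms(3) xz by fastforce
  then show ?thesis
  proof cases
    case 1
    have "gen j \<beta> * gen i \<alpha> - scal (inverse q) * gen i \<alpha> * gen j \<beta> \<in> qm_relations q m n"
      unfolding qm_relations_def using 1 box by blast
    \<comment> \<open>There is no correction here: the second word is a placeholder with coefficient
      \<open>0\<close>.\<close>
    then have "word_poly [x, z] - (scal (inverse q) * word_poly [z, x] + scal 0 * word_poly [z, x]) \<in> qm_ideal q m n"
      by (intro rel) (simp add: mult.assoc g xz s0)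
    then show ?thesis using assms by blast
  next
    case 2
    have "gen j \<beta> * gen i \<alpha> - scal (inverse q) * gen i \<alpha> * gen j \<beta> \<in> qm_relations q m n"
      unfolding qm_relations_def using 2 box by blast
    then have "word_poly [x, z] - (scal (inverse q) * word_poly [z, x] + scal 0 * word_poly [z, x]) \<in> qm_ideal q m n"
      by (intro rel) (simp add: mult.assoc g xz s0)
    then show ?thesis using assms by blast
  next
    case 3
    have "gen j \<beta> * gen i \<alpha> - gen i \<alpha> * gen j \<beta> \<in> qm_relations q m n"
      unfolding qm_relations_def using 3 box by blast
    then have "word_poly [x, z] - (scal 1 * word_poly [z, x] + scal 0 * word_poly [z, x]) \<in> qm_ideal q m n"
      by (intro rel) (simp add: mult.assoc g xz s0 scal_def single_one)
    then show ?thesis using assms by blast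
  next
    case 4
    have "gen j \<beta> * gen i \<alpha> - (gen i \<alpha> * gen j \<beta> - scal (q - inverse q) * gen i \<beta> * gen j \<alpha>) \<in> qm_relations q m n"
      unfolding qm_relations_def using 4 box by blast
    moreover have "scal (- c) = - scal c" for c by (simp add: scal_def single_uminus)
    ultimately have "word_poly [x, z] - (scal 1 * word_poly [z, x] + scal (- (q - inverse q)) * word_poly [(i, \<beta>), (j, \<alpha>)]) \<in> qm_ideal q m n"
      by (intro rel) (simp only: mult.assoc g xz, simp add: scal_def single_one)
    moreover have "(i, \<beta>) \<in> box" "(j, \<alpha>) \<in> box" "(i, \<beta>) < x" using box 4 xz by (auto simp: box_def)
    ultimately show ?thesis by blast
  qed
qed

lemma not_sorted_split:
  "\<not> sorted ws \<Longrightarrow> \<exists>us x z vs. ws = us @ [x, z] @ vs \<and> z < x"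
proof (induction ws rule: induct_list012)
  case (3 x z vs)
  show ?case
  proof (cases "z < x")
    case True
    then show ?thesis by (metis append_Cons append_Nil)
  next
    case False
    then have "\<not> sorted (z # vs)" using "3.prems" unfolding sorted2 by simp
    then obtain us x' z' vs' where "z # vs = us @ [x', z'] @ vs'" "z' < x'" using 3 by blast
    then show ?thesis by (metis append_Cons)
  qed
qed auto

lemma straightens_word: "set ws \<subseteq> box \<Longrightarrow> straightens (word_poly ws)"
proof (induction ws rule: wf_induct_rule[OF wf_lenlex[OF wf]])
  case (1 ws)
  show ?case
  proof (cases "sorted ws")
    case True
    then have "sorted_combination (word_poly ws)"
      using 1 by (simp add: sorted_combination_def word_poly_carrier)
    then show ?thesis unfolding straightens_def using ideal_closed(4) by force
  next
    case False
    then obtain us x z vs where ws: "ws = us @ [x, z] @ vs" and zx: "z < x"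
      using not_sorted_split by blast
    then have box: "x \<in> box" "z \<in> box" "set us \<subseteq> box" "set vs \<subseteq> box" using 1 by auto
    obtain c d x' z' where e: "word_poly [x, z] - (scal c * word_poly [z, x] + scal d * word_poly [z', x']) \<in> qm_ideal q m n"
      and box': "x' \<in> box" "z' \<in> box" and z': "z' < x"
      using swap_letters[OF box(1,2) zx] by blast
    \<comment> \<open>Both new words keep the length and lower the letter at the place of
      \<open>x\<close>, so they precede \<open>ws\<close> in the well-founded order
      \<open>lenlex\<close>.\<close>
    have less: "(us @ [a, b] @ vs, ws) \<in> lenlex {(x, y). x < y}" if "a < x" for a b
      unfolding ws using that by (simp add: irrefl_def Cons_lenlex_iff)
    have "straightens (word_poly (us @ [z, x] @ vs))" "straightens (word_poly (us @ [z', x'] @ vs))"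
      using 1 box box' less zx z' by auto
    then have s: "straightens (scal c * word_poly (us @ [z, x] @ vs) + scal d * word_poly (us @ [z', x'] @ vs))"
      by (intro straightens_add straightens_scal)
    have comm: "word_poly us * (scal c * p) = scal c * (word_poly us * p)" for c p
    proof -
      have "word_poly us * scal c = scal c * word_poly us" by (simp add: scal_def mult_single)
      from this show ?thesis by (simp only: mult.assoc[symmetric])
    qed
    have "word_poly ws - (scal c * word_poly (us @ [z, x] @ vs) + scal d * word_poly (us @ [z', x'] @ vs)) =
      word_poly us * (word_poly [x, z] - (scal c * word_poly [z, x] + scal d * word_poly [z', x'])) * word_poly vs"
      unfolding ws word_poly_append[of us] word_poly_append[of _ vs]
      by (simp only: right_diff_distrib left_diff_distrib distrib_left distrib_right comm mult.assoc)
    also have "\<dots> \<in> qm_ideal q m n"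
      using e box by (intro ideal_closed(2,3)) (auto simp: word_poly_carrier)
    finally show ?thesis using s by (rule straightens_ideal)
  qed
qed

lemma straightens_carrier:
  assumes "p \<in> carrier (free_alg m n)"
  shows "straightens p"
proof -
  have "straightens (Poly_Mapping.single w c)" if "w \<in> Poly_Mapping.keys p" for w c
  proof -
    have "straightens (scal c * word_poly (letters w))"
      using assms that by (intro straightens_scal straightens_word) (auto simp: carrier_iff box_word_def)
    then show ?thesis by (simp add: scal_def mult_single)
  qed
  then show ?thesis
    by (subst poly_mapping_expand) (rule straightens_sum)
qed

section \<open>Independence: the leading exponents of sorted words\<close>

lemma coef_one: "coef 1 a = (if a = 0 then 1 else 0)"
  using coef_T[of 0 a] by auto

lemma eval_word_props:
  assumes "box_word w"
  shows "eval_word w \<in> A" "eval_word w \<noteq> 0" "lead (eval_word w) = word_expo w"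
    "a \<in> supp (eval_word w) \<Longrightarrow> row_weight k a = row_weight k (word_expo w)"
    "a \<in> supp (eval_word w) \<Longrightarrow> col_weight k a = col_weight k (word_expo w)"
proof -
  have "eval_word (Word ws) \<in> A \<and> eval_word (Word ws) \<noteq> 0 \<and> lead (eval_word (Word ws)) = word_expo (Word ws) \<and>
    (\<forall>a\<in>supp (eval_word (Word ws)). row_weight k a = row_weight k (word_expo (Word ws)) \<and> col_weight k a = col_weight k (word_expo (Word ws)))"
    if "set ws \<subseteq> box" for ws k
    using that
  proof (induction ws)
    case Nil
    have "lead 1 = (0::expo)"
      by (rule leadI) (auto simp: one_in_A supp_def coef_one split: if_splits)
    then show ?case
      by (auto simp: eval_word_def word_expo_def one_in_A supp_def weight_simps coef_one split: if_splits)
  next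
    case (Cons x ws)
    obtain i \<alpha> where x: "x = (i, \<alpha>)" by (cases x) auto
    have i: "i \<in> {1..m}" "\<alpha> \<in> {1..n}" using Cons.prems by (auto simp: x box_def)
    have e: "eval_word (Word (x # ws)) = y i \<alpha> * eval_word (Word ws)" "word_expo (Word (x # ws)) = unit_vec i \<alpha> + word_expo (Word ws)"
      by (simp_all add: eval_word_def word_expo_def x)
    have IH: "eval_word (Word ws) \<in> A" "eval_word (Word ws) \<noteq> 0" "lead (eval_word (Word ws)) = word_expo (Word ws)"
      "\<And>a. a \<in> supp (eval_word (Word ws)) \<Longrightarrow> row_weight k a = row_weight k (word_expo (Word ws)) \<and> col_weight k a = col_weight k (word_expo (Word ws))"
      using Cons by auto
    have "row_weight k a = row_weight k (word_expo (Word (x # ws))) \<and> col_weight k a = col_weight k (word_expo (Word (x # ws)))"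
      if a: "a \<in> supp (eval_word (Word (x # ws)))" for a
    proof -
      obtain b c where "b \<in> supp (y i \<alpha>)" "c \<in> supp (eval_word (Word ws))" "a = b + c"
        using supp_mult[OF y_in_A[OF i] IH(1) a[unfolded e]] .
      then show ?thesis
        using IH(4) weights_y[OF i] by (simp add: e weight_simps row_weight_unit_vec[OF i(2)] col_weight_unit_vec[OF i(1)])
    qed
    then show ?case
      using lead_mult[OF y_in_A[OF i] IH(1) y_nonzero[OF i] IH(2)] IH
      by (simp add: e lead_y[OF i] mult_in_A y_in_A[OF i])
  qed
  from this[of "letters w"] assms
  show "eval_word w \<in> A" "eval_word w \<noteq> 0" "lead (eval_word w) = word_expo w"
    "a \<in> supp (eval_word w) \<Longrightarrow> row_weight k a = row_weight k (word_expo w)"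
    "a \<in> supp (eval_word w) \<Longrightarrow> col_weight k a = col_weight k (word_expo w)"
    by (auto simp: box_word_def)
qed

lemma lookup_word_expo: "Poly_Mapping.lookup (word_expo w) k = int (count_list (letters w) k)"
proof -
  have "Poly_Mapping.lookup (sum_list (map (\<lambda>(i, \<alpha>). unit_vec i \<alpha>) ws)) k = int (count_list ws k)" for ws
    by (induction ws) (auto simp: lookup_add lookup_single when_def)
  then show ?thesis by (simp add: word_expo_def)
qed

text \<open>An exponent records how often each letter occurs, and there is one sorted word for each
  multiset of letters.\<close>

lemma word_expo_inj:
  assumes "sorted (letters u)" "sorted (letters v)" "word_expo u = word_expo v"
  shows "u = v"
proof -
  have "count_list (letters u) k = count_list (letters v) k" for k
    using assms(3) lookup_word_expo by (metis of_nat_eq_iff)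
  then have "mset (letters u) = mset (letters v)"
    by (intro multiset_eqI) (simp add: count_mset)
  then have "letters u = letters v"
    using assms properties_for_sort by (metis sorted_sort_id)
  then show ?thesis by (cases u, cases v) auto
qed

lemma phi_in_A: "p \<in> carrier (free_alg m n) \<Longrightarrow> phi p \<in> A"
  unfolding phi_def by (intro sum_in_A' cscale_in_A eval_word_props(1)) (auto simp: carrier_iff)

text \<open>Distinct sorted words have distinct leading exponents, so the largest of them cannot be
  cancelled by the other words.\<close>

lemma lead_phi:
  assumes r: "sorted_combination r" "r \<noteq> 0"
  shows "phi r \<noteq> 0 \<and> (\<exists>w\<in>Poly_Mapping.keys r. lead (phi r) = word_expo w)"
proof -
  let ?K = "Poly_Mapping.keys r"
  have K: "finite ?K" "?K \<noteq> {}" using r by auto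
  then obtain w0 where w0: "w0 \<in> ?K" "word_expo w0 = Max (word_expo ` ?K)"
    by (metis (mono_tags, lifting) Max_in finite_imageI image_iff image_is_empty)
  have max: "word_expo w \<le> word_expo w0" if "w \<in> ?K" for w using that K w0 by auto
  have box: "box_word w" if "w \<in> ?K" for w using that r by (auto simp: sorted_combination_def carrier_iff)
  have bound: "a \<le> word_expo w0" if "a \<in> supp (eval_word w)" "w \<in> ?K" for a w
    using lead_ge[of "eval_word w" a] eval_word_props[OF box[OF that(2)]] that max by fastforce
  have zero: "coef (eval_word w) (word_expo w0) = 0" if "w \<in> ?K" "w \<noteq> w0" for w
  proof -
    have "word_expo w \<noteq> word_expo w0"
      using word_expo_inj that w0 r by (auto simp: sorted_combination_def)
    then have "word_expo w < word_expo w0" using max[OF that(1)] by simp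
    then have "word_expo w0 \<notin> supp (eval_word w)"
      using lead_ge[of "eval_word w"] eval_word_props[OF box[OF that(1)]] by fastforce
    then show ?thesis by (simp add: supp_def)
  qed
  have "coef (phi r) (word_expo w0) = (\<Sum>w\<in>?K. Poly_Mapping.lookup r w * coef (eval_word w) (word_expo w0))"
    by (simp add: phi_def coef_sum)
  also have "\<dots> = (\<Sum>w\<in>?K. if w = w0 then Poly_Mapping.lookup r w0 * coef (eval_word w0) (word_expo w0) else 0)"
    by (intro sum.cong refl) (auto simp: zero)
  also have "\<dots> = Poly_Mapping.lookup r w0 * coef (eval_word w0) (word_expo w0)"
    using K w0 by simp
  also have "\<dots> \<noteq> 0"
    using w0 lead_in[of "eval_word w0"] eval_word_props[OF box[OF w0(1)]] by (auto simp: supp_def in_keys_iff)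
  finally have in_supp: "word_expo w0 \<in> supp (phi r)" by (simp add: supp_def)
  have "a \<le> word_expo w0" if "a \<in> supp (phi r)" for a
  proof -
    have "(\<Sum>w\<in>?K. Poly_Mapping.lookup r w * coef (eval_word w) a) \<noteq> 0"
      using that by (simp add: supp_def phi_def coef_sum)
    then have "\<exists>w\<in>?K. coef (eval_word w) a \<noteq> 0" by (metis (no_types, lifting) mult_zero_right sum.neutral)
    then show ?thesis using bound by (auto simp: supp_def)
  qed
  then have "lead (phi r) = word_expo w0"
    using in_supp r phi_in_A by (intro leadI) (auto simp: sorted_combination_def)
  with in_supp w0(1) show ?thesis by (auto simp: supp_def)
qed

text \<open>Modulo the ideal an element is a sorted combination, and \<open>lead_phi\<close> forces
  a sorted combination in the kernel to be zero. With \<open>phi_ideal\<close> this makes the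
  evaluation an embedding of the quotient.\<close>

lemma phi_kernel:
  assumes "p \<in> carrier (free_alg m n)" "phi p = 0"
  shows "p \<in> qm_ideal q m n"
proof -
  obtain r where r: "sorted_combination r" "p - r \<in> qm_ideal q m n"
    using straightens_carrier[OF assms(1)] by (auto simp: straightens_def)
  have "phi r = 0" using phi_ideal[OF r(2)] assms(2) by (simp add: phi_minus)
  then have "r = 0" using lead_phi r by blast
  then show ?thesis using r by simp
qed

text \<open>The copy of the algebra inside the torus, where the argument takes place until the
  transfer back to cosets.\<close>

definition S :: "endo set" where
  "S = phi ` carrier (free_alg m n)"

lemma S_sorted:
  assumes "f \<in> S"
  obtains r where "sorted_combination r" "f = phi r"
proof -
  obtain p where p: "p \<in> carrier (free_alg m n)" "f = phi p" using assms by (auto simp: S_def)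
  obtain r where "sorted_combination r" "p - r \<in> qm_ideal q m n"
    using straightens_carrier[OF p(1)] by (auto simp: straightens_def)
  moreover from this have "phi p = phi r" using phi_ideal[of "p - r"] by (simp add: phi_minus)
  ultimately show ?thesis using that p by blast
qed

end

section \<open>Normal elements\<close>

context quantum_torus
begin

lemma S_closed:
  "f \<in> S \<Longrightarrow> g \<in> S \<Longrightarrow> f + g \<in> S" "f \<in> S \<Longrightarrow> g \<in> S \<Longrightarrow> f - g \<in> S"
  "f \<in> S \<Longrightarrow> g \<in> S \<Longrightarrow> f * g \<in> S" "f \<in> S \<Longrightarrow> c *\<^sub>c f \<in> S" "0 \<in> S" "1 \<in> S"
  "i \<in> {1..m} \<Longrightarrow> \<alpha> \<in> {1..n} \<Longrightarrow> y i \<alpha> \<in> S"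
proof -
  show "f \<in> S \<Longrightarrow> g \<in> S \<Longrightarrow> f + g \<in> S"
    by (auto simp: S_def phi_add[symmetric] free_alg_plus)
  show "f \<in> S \<Longrightarrow> g \<in> S \<Longrightarrow> f - g \<in> S"
    by (auto simp: S_def phi_minus[symmetric] free_alg_minus)
  show mult: "f \<in> S \<Longrightarrow> g \<in> S \<Longrightarrow> f * g \<in> S" for f g
    by (auto simp: S_def phi_mult[symmetric] free_alg_times)
  have "c *\<^sub>c 1 \<in> S"
    unfolding S_def by (rule image_eqI[of _ _ "scal c"]) (simp_all add: scal_closed)
  then show "f \<in> S \<Longrightarrow> c *\<^sub>c f \<in> S"
    using mult[of "c *\<^sub>c 1" f] by simp
  show "0 \<in> S" unfolding S_def by (rule image_eqI[of _ _ 0]) (simp_all add: free_alg_zero)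
  show "1 \<in> S" unfolding S_def by (rule image_eqI[of _ _ 1]) (simp_all add: free_alg_one)
  show "i \<in> {1..m} \<Longrightarrow> \<alpha> \<in> {1..n} \<Longrightarrow> y i \<alpha> \<in> S"
    unfolding S_def by (rule image_eqI[of _ _ "gen i \<alpha>"]) (simp_all add: gen_closed)
qed

lemma S_sum: "(\<And>i. i \<in> I \<Longrightarrow> f i \<in> S) \<Longrightarrow> (\<Sum>i\<in>I. f i) \<in> S"
  by (induction I rule: infinite_finite_induct) (auto intro: S_closed)

lemma S_in_A: "f \<in> S \<Longrightarrow> f \<in> A"
  unfolding S_def using phi_in_A by blast

lemma S_lead:
  assumes "f \<in> S" "f \<noteq> 0"
  obtains w where "box_word w" "sorted (letters w)" "lead f = word_expo w"
proof -
  obtain r where r: "sorted_combination r" "f = phi r" using assms S_sorted by blast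
  then have "r \<noteq> 0" using assms by auto
  then obtain w where "w \<in> Poly_Mapping.keys r" "lead f = word_expo w" using lead_phi r by blast
  then show ?thesis using that r by (auto simp: sorted_combination_def carrier_iff)
qed

lemma supp_phi:
  assumes "a \<in> supp (phi r)"
  obtains w where "w \<in> Poly_Mapping.keys r" "a \<in> supp (eval_word w)"
proof -
  have "(\<Sum>w\<in>Poly_Mapping.keys r. Poly_Mapping.lookup r w * coef (eval_word w) a) \<noteq> 0"
    using assms by (simp add: supp_def phi_def coef_sum)
  then have "\<exists>w\<in>Poly_Mapping.keys r. coef (eval_word w) a \<noteq> 0" by (metis (no_types, lifting) mult_zero_right sum.neutral)
  then show ?thesis using that by (auto simp: supp_def)
qed

lemma word_weights:
  assumes "box_word w"
  shows "row_weight k (word_expo w) = int (length (filter (\<lambda>x. fst x = k) (letters w)))"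
    "col_weight k (word_expo w) = int (length (filter (\<lambda>x. snd x = k) (letters w)))"
proof -
  have "row_weight k (word_expo (Word ws)) = int (length (filter (\<lambda>x. fst x = k) ws)) \<and>
      col_weight k (word_expo (Word ws)) = int (length (filter (\<lambda>x. snd x = k) ws))" if "set ws \<subseteq> box" for ws
    using that
  proof (induction ws)
    case (Cons x ws)
    obtain i \<alpha> where x: "x = (i, \<alpha>)" by (cases x) auto
    have "word_expo (Word (x # ws)) = unit_vec i \<alpha> + word_expo (Word ws)" by (simp add: word_expo_def x)
    then show ?case
      using Cons by (auto simp: weight_simps row_weight_unit_vec col_weight_unit_vec x box_def)
  qed (simp add: word_expo_def weight_simps)
  from this[of "letters w"] assms show "row_weight k (word_expo w) = int (length (filter (\<lambda>x. fst x = k) (letters w)))"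
    "col_weight k (word_expo w) = int (length (filter (\<lambda>x. snd x = k) (letters w)))"
    by (auto simp: box_word_def)
qed

lemma single_letter:
  assumes "box_word w" "\<And>k. row_weight k (word_expo w) = (if k = i then 1 else 0)"
    "\<And>k. col_weight k (word_expo w) = (if k = \<alpha> then 1 else 0)"
  shows "w = Word [(i, \<alpha>)]"
proof -
  have r: "fst x = i" if "x \<in> set (letters w)" for x
  proof (rule ccontr)
    assume "fst x \<noteq> i"
    then have "filter (\<lambda>z. fst z = fst x) (letters w) = []"
      using word_weights(1)[OF assms(1), of "fst x"] assms(2)[of "fst x"] by simp
    then show False using that by (auto simp: filter_empty_conv)
  qed
  have c: "snd x = \<alpha>" if "x \<in> set (letters w)" for x
  proof (rule ccontr)
    assume "snd x \<noteq> \<alpha>"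
    then have "filter (\<lambda>z. snd z = snd x) (letters w) = []"
      using word_weights(2)[OF assms(1), of "snd x"] assms(3)[of "snd x"] by simp
    then show False using that by (auto simp: filter_empty_conv)
  qed
  have "filter (\<lambda>x. fst x = i) (letters w) = letters w" using r by (simp add: filter_id_conv)
  then have "length (letters w) = 1" using word_weights(1)[OF assms(1), of i] assms(2)[of i] by simp
  then obtain x where "letters w = [x]" by (auto simp: length_Suc_conv)
  moreover have "x = (i, \<alpha>)" using r[of x] c[of x] calculation by (simp add: prod_eq_iff)
  ultimately show ?thesis by (cases w) simp
qed

text \<open>A word with these row and column weights consists of the single letter
  \<open>(i, \<alpha>)\<close>. Subtracting the matching multiple of \<open>y i \<alpha>\<close>
  therefore leaves a combination without any possible leading word.\<close>

lemma weight_space: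
  assumes f: "f \<in> S" and i: "i \<in> {1..m}" "\<alpha> \<in> {1..n}"
    and w: "\<And>a k. a \<in> supp f \<Longrightarrow> row_weight k a = (if k = i then 1 else 0)"
      "\<And>a k. a \<in> supp f \<Longrightarrow> col_weight k a = (if k = \<alpha> then 1 else 0)"
  shows "\<exists>c. f = c *\<^sub>c y i \<alpha>"
proof -
  obtain r where r: "sorted_combination r" "f = phi r" using f S_sorted by blast
  define c where "c = Poly_Mapping.lookup r (Word [(i, \<alpha>)])"
  define r' where "r' = r + Poly_Mapping.single (Word [(i, \<alpha>)]) (- c)"
  have "sorted_combination (Poly_Mapping.single (Word [(i, \<alpha>)]) (- c))"
    using i by (auto simp: sorted_combination_def carrier_iff box_word_def box_def)
  then have r': "sorted_combination r'" unfolding r'_def using r sorted_combination_add by blast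
  have phi_r': "phi r' = f - c *\<^sub>c y i \<alpha>"
    by (simp add: r'_def phi_add phi_single r eval_word_def)
  have "r' = 0"
  proof (rule ccontr)
    assume "r' \<noteq> 0"
    then obtain w where w': "phi r' \<noteq> 0" "w \<in> Poly_Mapping.keys r'" "lead (phi r') = word_expo w"
      using lead_phi r' by blast
    then have "word_expo w \<in> supp (phi r')"
      using lead_in[of "phi r'"] r' by (simp add: sorted_combination_def phi_in_A)
    then have "word_expo w \<in> supp f \<or> word_expo w \<in> supp (y i \<alpha>)"
      by (auto simp: phi_r' supp_def)
    then have "row_weight k (word_expo w) = (if k = i then 1 else 0)"
      "col_weight k (word_expo w) = (if k = \<alpha> then 1 else 0)" for k
      using w weights_y[OF i] by auto
    moreover have "box_word w" using w' r' by (auto simp: sorted_combination_def carrier_iff)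
    ultimately have "w = Word [(i, \<alpha>)]" by (intro single_letter)
    then show False using w' by (simp add: r'_def in_keys_iff lookup_add c_def)
  qed
  then show ?thesis using phi_r' by (intro exI[of _ c]) simp
qed

definition quasi_central :: "endo \<Rightarrow> (nat \<Rightarrow> nat \<Rightarrow> complex) \<Rightarrow> bool" where
  "quasi_central z c \<longleftrightarrow> z \<in> S \<and> (\<forall>i\<in>{1..m}. \<forall>\<alpha>\<in>{1..n}. z * y i \<alpha> = c i \<alpha> *\<^sub>c (y i \<alpha> * z))"

text \<open>From \<open>z * y i \<alpha> = f * z\<close> the element \<open>f\<close> inherits all
  weights of \<open>y i \<alpha>\<close> by \<open>weight_transfer\<close>, and
  \<open>weight_space\<close> leaves only multiples of the generator.\<close>

lemma quasi_central_normal: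
  assumes z: "z \<in> S" "z \<noteq> 0" and normal: "\<And>f. f \<in> S \<Longrightarrow> \<exists>f'\<in>S. z * f = f' * z"
  shows "\<exists>c. quasi_central z c"
proof -
  have "\<exists>c. z * y i \<alpha> = c *\<^sub>c (y i \<alpha> * z)" if i: "i \<in> {1..m}" "\<alpha> \<in> {1..n}" for i \<alpha>
  proof -
    obtain f where f: "f \<in> S" "z * y i \<alpha> = f * z" using normal S_closed(7)[OF i] by blast
    have "\<exists>c. f = c *\<^sub>c y i \<alpha>"
    proof (rule weight_space[OF f(1) i])
      fix a k assume a: "a \<in> supp f"
      show "row_weight k a = (if k = i then 1 else 0)"
        by (rule weight_transfer[OF weight_simps(1) S_in_A[OF z(1)] y_in_A[OF i] S_in_A[OF f(1)] z(2) f(2) weights_y(1)[OF i] a])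
      show "col_weight k a = (if k = \<alpha> then 1 else 0)"
        by (rule weight_transfer[OF weight_simps(4) S_in_A[OF z(1)] y_in_A[OF i] S_in_A[OF f(1)] z(2) f(2) weights_y(2)[OF i] a])
    qed
    then show ?thesis using f(2) by auto
  qed
  then have "\<exists>c. \<forall>i\<in>{1..m}. \<forall>\<alpha>\<in>{1..n}. z * y i \<alpha> = c i \<alpha> *\<^sub>c (y i \<alpha> * z)"
    by (intro exI[of _ "\<lambda>i \<alpha>. SOME c. z * y i \<alpha> = c *\<^sub>c (y i \<alpha> * z)"]) (metis (mono_tags, lifting) someI_ex)
  then show ?thesis using z by (auto simp: quasi_central_def)
qed

section \<open>Eigenvalues of conjugation in terms of leading exponents\<close>

definition exponent :: "expo \<Rightarrow> nat \<Rightarrow> nat \<Rightarrow> int" where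
  "exponent a i \<alpha> = form a (unit_vec i \<alpha>) - form (unit_vec i \<alpha>) a"

text \<open>Compare the coefficients of both sides at \<open>lead z + lead (y i \<alpha>)\<close>:
  the leading coefficient of \<open>z\<close> cancels and only the two cocycle values
  remain.\<close>

lemma quasi_central_scalar:
  assumes "quasi_central z c" "z \<noteq> 0" and i: "i \<in> {1..m}" "\<alpha> \<in> {1..n}"
  shows "c i \<alpha> = q powi exponent (lead z) i \<alpha>"
proof -
  have z: "z \<in> A" "z * y i \<alpha> = c i \<alpha> *\<^sub>c (y i \<alpha> * z)"
    using assms S_in_A by (auto simp: quasi_central_def)
  have f1: "coef (z * y i \<alpha>) (lead z + lead (y i \<alpha>)) = coef z (lead z) * q powi form (lead z) (unit_vec i \<alpha>)"
    using coef_lead_mult[OF z(1) y_in_A[OF i]] by (simp add: coef_lead_y[OF i, unfolded lead_y[OF i]] lead_y[OF i])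
  have f2: "coef (y i \<alpha> * z) (lead z + lead (y i \<alpha>)) = coef z (lead z) * q powi form (unit_vec i \<alpha>) (lead z)"
    using coef_lead_mult[OF y_in_A[OF i] z(1)] by (simp add: coef_lead_y[OF i, unfolded lead_y[OF i]] lead_y[OF i] add.commute)
  have "coef z (lead z) * q powi form (lead z) (unit_vec i \<alpha>) =
      c i \<alpha> * (coef z (lead z) * q powi form (unit_vec i \<alpha>) (lead z))"
    by (metis f1 f2 z(2) coef_simps(5))
  then have "coef z (lead z) * q powi form (lead z) (unit_vec i \<alpha>) =
      coef z (lead z) * (c i \<alpha> * q powi form (unit_vec i \<alpha>) (lead z))"
    by (simp only: mult.left_commute)
  moreover have "coef z (lead z) \<noteq> 0" using lead_in[OF z(1) assms(2)] by (simp add: supp_def)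
  ultimately have "q powi form (lead z) (unit_vec i \<alpha>) = c i \<alpha> * q powi form (unit_vec i \<alpha>) (lead z)"
    by (simp only: mult_cancel_left) simp
  then show ?thesis
    using q_nz by (simp add: exponent_def power_int_diff)
qed

lemma exponent_sum: "i \<in> {1..m} \<Longrightarrow> \<alpha> \<in> {1..n} \<Longrightarrow>
  exponent a i \<alpha> = (\<Sum>k\<in>box. Poly_Mapping.lookup a k * (pairing k (i, \<alpha>) - pairing (i, \<alpha>) k))"
  by (simp add: exponent_def form_single_left form_single_right box_def right_diff_distrib sum_subtractf)

lemma exponent_rows_cols:
  assumes "i \<in> {1..m}" "\<alpha> \<in> {1..n}"
  shows "exponent a i \<alpha> = (\<Sum>\<beta>\<in>{1..n}. Poly_Mapping.lookup a (i, \<beta>) * sgn (int \<alpha> - int \<beta>)) +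
    (\<Sum>j\<in>{1..m}. Poly_Mapping.lookup a (j, \<alpha>) * sgn (int i - int j))"
proof -
  have p: "pairing (j, \<beta>) (i, \<alpha>) - pairing (i, \<alpha>) (j, \<beta>) = (if j = i then sgn (int \<alpha> - int \<beta>) else 0) +
      (if \<beta> = \<alpha> then sgn (int i - int j) else 0)" for j \<beta>
    by (auto simp: pairing_def)
  have "exponent a i \<alpha> = (\<Sum>j\<in>{1..m}. \<Sum>\<beta>\<in>{1..n}. Poly_Mapping.lookup a (j, \<beta>) * (pairing (j, \<beta>) (i, \<alpha>) - pairing (i, \<alpha>) (j, \<beta>)))"
    unfolding exponent_sum[OF assms] box_def sum.cartesian_product by (intro sum.cong) auto
  also have "\<dots> = (\<Sum>j\<in>{1..m}. \<Sum>\<beta>\<in>{1..n}. (if j = i then Poly_Mapping.lookup a (i, \<beta>) * sgn (int \<alpha> - int \<beta>) else 0) +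
      (if \<beta> = \<alpha> then Poly_Mapping.lookup a (j, \<alpha>) * sgn (int i - int j) else 0))"
    by (intro sum.cong refl) (auto simp: p distrib_left)
  also have "\<dots> = (\<Sum>j\<in>{1..m}. \<Sum>\<beta>\<in>{1..n}. if j = i then Poly_Mapping.lookup a (i, \<beta>) * sgn (int \<alpha> - int \<beta>) else 0) +
      (\<Sum>j\<in>{1..m}. \<Sum>\<beta>\<in>{1..n}. if \<beta> = \<alpha> then Poly_Mapping.lookup a (j, \<alpha>) * sgn (int i - int j) else 0)"
    by (simp only: sum.distrib)
  also have "(\<Sum>j\<in>{1..m}. \<Sum>\<beta>\<in>{1..n}. if j = i then Poly_Mapping.lookup a (i, \<beta>) * sgn (int \<alpha> - int \<beta>) else 0) =
    (\<Sum>j\<in>{1..m}. if j = i then \<Sum>\<beta>\<in>{1..n}. Poly_Mapping.lookup a (i, \<beta>) * sgn (int \<alpha> - int \<beta>) else 0)"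
    by (intro sum.cong) auto
  finally show ?thesis using assms by simp
qed

text \<open>Moving the reference point from \<open>\<alpha>\<close> to its successor raises the sign
  by one at these two positions and changes it nowhere else.\<close>

lemma sum_sgn_step:
  fixes f :: "nat \<Rightarrow> int"
  assumes "Suc \<alpha> \<le> n'" "1 \<le> \<alpha>"
  shows "(\<Sum>\<beta>\<in>{1..n'}. f \<beta> * sgn (int (Suc \<alpha>) - int \<beta>)) - (\<Sum>\<beta>\<in>{1..n'}. f \<beta> * sgn (int \<alpha> - int \<beta>)) = f \<alpha> + f (Suc \<alpha>)"
proof -
  have "(\<Sum>\<beta>\<in>{1..n'}. f \<beta> * sgn (int (Suc \<alpha>) - int \<beta>)) - (\<Sum>\<beta>\<in>{1..n'}. f \<beta> * sgn (int \<alpha> - int \<beta>)) =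
    (\<Sum>\<beta>\<in>{1..n'}. (if \<beta> = \<alpha> then f \<alpha> else 0) + (if \<beta> = Suc \<alpha> then f (Suc \<alpha>) else 0))"
    unfolding sum_subtractf[symmetric] by (intro sum.cong refl) (auto simp: sgn_if)
  then show ?thesis using assms by (simp add: sum.distrib)
qed

text \<open>At the corners \<open>(i, Suc \<alpha>)\<close> and \<open>(Suc i, \<alpha>)\<close> the
  row and the column contributions cancel; at the other two corners they agree, hence the factor
  \<open>2\<close>.\<close>

lemma exponent_mixed_difference:
  assumes "i \<in> {1..m}" "Suc i \<le> m" "\<alpha> \<in> {1..n}" "Suc \<alpha> \<le> n"
  shows "exponent a (Suc i) (Suc \<alpha>) - exponent a i (Suc \<alpha>) - exponent a (Suc i) \<alpha> + exponent a i \<alpha> =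
    2 * (Poly_Mapping.lookup a (Suc i, Suc \<alpha>) - Poly_Mapping.lookup a (i, \<alpha>))"
  using assms sum_sgn_step[of \<alpha> n "\<lambda>\<beta>. Poly_Mapping.lookup a (i, \<beta>)"] sum_sgn_step[of \<alpha> n "\<lambda>\<beta>. Poly_Mapping.lookup a (Suc i, \<beta>)"]
    sum_sgn_step[of i m "\<lambda>j. Poly_Mapping.lookup a (j, \<alpha>)"] sum_sgn_step[of i m "\<lambda>j. Poly_Mapping.lookup a (j, Suc \<alpha>)"]
  by (simp add: exponent_rows_cols)

end

locale generic_quantum_torus = quantum_torus +
  assumes generic: "\<And>k::nat. k \<ge> 1 \<Longrightarrow> q ^ k \<noteq> 1"
begin

lemma powi_inj: "q powi a = q powi b \<longleftrightarrow> a = b"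
proof
  assume "q powi a = q powi b"
  moreover have "a' = b'" if "q powi a' = q powi b'" "a' \<le> b'" for a' b'
  proof (rule ccontr)
    assume "a' \<noteq> b'"
    then have "nat (b' - a') \<ge> 1" using that by simp
    moreover have "q ^ nat (b' - a') = q powi (b' - a')" using that by (simp add: power_int_def)
    moreover have "q powi (b' - a') = 1" using that q_nz by (simp add: power_int_diff)
    ultimately show False using generic by metis
  qed
  ultimately show "a = b" by (metis linear)
qed simp

lemma q_minus_inverse: "q - inverse q \<noteq> 0"
proof
  assume "q - inverse q = 0"
  then have "q ^ 2 = 1" using q_nz by (simp add: field_simps power2_eq_square)
  then show False using generic[of 2] by simp
qed

text \<open>Conjugation by a normal element respects the relation that straightens a diagonal pair, so its
  eigenvalues on the generators have the form \<open>f i * g \<alpha>\<close>.\<close>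

lemma quasi_central_exponents:
  assumes z: "quasi_central z c" "z \<noteq> 0" and ij: "i \<in> {1..m}" "j \<in> {1..m}" "\<alpha> \<in> {1..n}" "\<beta> \<in> {1..n}" "i < j" "\<alpha> < \<beta>"
  shows "exponent (lead z) i \<alpha> + exponent (lead z) j \<beta> = exponent (lead z) i \<beta> + exponent (lead z) j \<alpha>"
proof -
  have A: "z \<in> A" using z S_in_A by (auto simp: quasi_central_def)
  have c: "z * y i' \<alpha>' = c i' \<alpha>' *\<^sub>c (y i' \<alpha>' * z)" if "i' \<in> {1..m}" "\<alpha>' \<in> {1..n}" for i' \<alpha>'
    using z that by (auto simp: quasi_central_def)
  have two: "z * (y i' \<alpha>' * y j' \<beta>') = (c i' \<alpha>' * c j' \<beta>') *\<^sub>c (y i' \<alpha>' * y j' \<beta>' * z)"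
    if "i' \<in> {1..m}" "\<alpha>' \<in> {1..n}" "j' \<in> {1..m}" "\<beta>' \<in> {1..n}" for i' \<alpha>' j' \<beta>'
  proof -
    have "z * (y i' \<alpha>' * y j' \<beta>') = (z * y i' \<alpha>') * y j' \<beta>'" by (simp add: mult.assoc)
    also have "\<dots> = c i' \<alpha>' *\<^sub>c (y i' \<alpha>' * (z * y j' \<beta>'))" using c that by (simp add: mult.assoc)
    finally show ?thesis using c that by (simp add: mult.assoc)
  qed
  let ?k = "q - inverse q" and ?u = "y i \<beta> * y j \<alpha>"
  have d: "y j \<beta> * y i \<alpha> = y i \<alpha> * y j \<beta> - ?k *\<^sub>c ?u" using ij by (intro y.diag)
  have "z * (y j \<beta> * y i \<alpha>) = z * (y i \<alpha> * y j \<beta>) - ?k *\<^sub>c (z * ?u)"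
    by (simp only: d right_diff_distrib mult_cscale_right)
  \<comment> \<open>In \<open>1\<close> the correction term is rescaled by its own scalar, in
    \<open>2\<close> by that of the diagonal product; all other terms coincide, so the two scalars
    are equal.\<close>
  then have 1: "(c i \<alpha> * c j \<beta>) *\<^sub>c (y j \<beta> * y i \<alpha> * z) =
      (c i \<alpha> * c j \<beta>) *\<^sub>c (y i \<alpha> * y j \<beta> * z) - ?k *\<^sub>c ((c i \<beta> * c j \<alpha>) *\<^sub>c (?u * z))"
    using ij by (simp only: two mult.commute[of "c j \<beta>"])
  have 2: "(c i \<alpha> * c j \<beta>) *\<^sub>c (y j \<beta> * y i \<alpha> * z) =
      (c i \<alpha> * c j \<beta>) *\<^sub>c (y i \<alpha> * y j \<beta> * z) - ?k *\<^sub>c ((c i \<alpha> * c j \<beta>) *\<^sub>c (?u * z))"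
  proof -
    have "y j \<beta> * y i \<alpha> * z = y i \<alpha> * y j \<beta> * z - ?k *\<^sub>c (?u * z)"
      by (simp only: d left_diff_distrib mult_cscale_left)
    then show ?thesis by (simp only: cscale_diff_right cscale_cscale mult.commute[of ?k])
  qed
  have "?k *\<^sub>c ((c i \<beta> * c j \<alpha>) *\<^sub>c (?u * z)) = ?k *\<^sub>c ((c i \<alpha> * c j \<beta>) *\<^sub>c (?u * z))"
    using trans[OF 1[symmetric] 2] by (simp only: diff_conv_add_uminus add_left_cancel neg_equal_iff_equal)
  then have "(c i \<beta> * c j \<alpha>) *\<^sub>c (?u * z) = (c i \<alpha> * c j \<beta>) *\<^sub>c (?u * z)"
    by (simp only: cscale_left_cancel[OF q_minus_inverse])
  then have "(c i \<beta> * c j \<alpha> - c i \<alpha> * c j \<beta>) *\<^sub>c (?u * z) = 0"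
    by (simp only: cscale_diff_left diff_self)
  moreover have "?u * z \<noteq> 0"
    using A z ij by (intro lead_mult(2) mult_in_A y_in_A y_nonzero) auto
  ultimately have "c i \<beta> * c j \<alpha> = c i \<alpha> * c j \<beta>" by simp
  then have "q powi (exponent (lead z) i \<beta> + exponent (lead z) j \<alpha>) = q powi (exponent (lead z) i \<alpha> + exponent (lead z) j \<beta>)"
    using quasi_central_scalar[OF z] ij q_nz by (simp add: power_int_add)
  then show ?thesis using powi_inj by simp
qed

lemma lead_diagonal:
  assumes "quasi_central z c" "z \<noteq> 0" and "i \<in> {1..m}" "Suc i \<le> m" "\<alpha> \<in> {1..n}" "Suc \<alpha> \<le> n"
  shows "Poly_Mapping.lookup (lead z) (Suc i, Suc \<alpha>) = Poly_Mapping.lookup (lead z) (i, \<alpha>)"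
  using quasi_central_exponents[OF assms(1,2), of i "Suc i" \<alpha> "Suc \<alpha>"] exponent_mixed_difference[of i \<alpha> "lead z"] assms
  by simp

end

section \<open>The normal minors\<close>

context quantum_matrix
begin

text \<open>The listed positions are inside the minor, beside it in one of its rows or columns, or
  in the lower left and upper right regions, where \<open>anti\<close> applies. The upper left and
  lower right regions are left out: there diagonal pairs produce corrections.\<close>

lemma qdet_normal:
  assumes I: "sorted is" "distinct is" "set is \<subseteq> R" and J: "sorted js" "distinct js" "set js \<subseteq> C"
    and len: "length is = length js" and j: "j \<in> R" and a: "\<alpha> \<in> C"
    and pos: "j \<in> set is \<and> (\<alpha> \<in> set js \<or> (\<forall>\<gamma>\<in>set js. \<alpha> < \<gamma>) \<or> (\<forall>\<gamma>\<in>set js. \<gamma> < \<alpha>)) \<or>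
      \<alpha> \<in> set js \<and> ((\<forall>i\<in>set is. j < i) \<or> (\<forall>i\<in>set is. i < j)) \<or>
      (\<forall>i\<in>set is. i < j) \<and> (\<forall>\<gamma>\<in>set js. \<alpha> < \<gamma>) \<or> (\<forall>i\<in>set is. j < i) \<and> (\<forall>\<gamma>\<in>set js. \<gamma> < \<alpha>)"
  shows "\<exists>c. qdet q Y is (set js) * Y j \<alpha> = c *\<^sub>c (Y j \<alpha> * qdet q Y is (set js))"
proof -
  interpret T: quantum_matrix q "\<lambda>i j. Y j i" C R by (rule transpose)
  let ?D = "qdet q Y is (set js)"
  have D: "?D = qdet q (\<lambda>i j. Y j i) js (set is)"
    by (rule qdet_transpose[OF I J len])
  consider "j \<in> set is" "\<alpha> \<in> set js" | "j \<in> set is" "\<forall>\<gamma>\<in>set js. \<alpha> < \<gamma>" | "j \<in> set is" "\<forall>\<gamma>\<in>set js. \<gamma> < \<alpha>"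
    | "\<alpha> \<in> set js" "\<forall>i\<in>set is. j < i" | "\<alpha> \<in> set js" "\<forall>i\<in>set is. i < j"
    | "\<forall>i\<in>set is. i < j" "\<forall>\<gamma>\<in>set js. \<alpha> < \<gamma>" | "\<forall>i\<in>set is. j < i" "\<forall>\<gamma>\<in>set js. \<gamma> < \<alpha>"
    using pos by blast
  then show ?thesis
  proof cases
    case 1
    then show ?thesis using qdet_central[OF I J len] by (intro exI[of _ 1]) simp
  next
    case 2
    then show ?thesis using qdet_left_of[of "set js" "is" j \<alpha>] I J a by blast
  next
    case 3
    then show ?thesis using qdet_right_of[of "set js" "is" j \<alpha>] I J a by blast
  next
    case 4
    then show ?thesis unfolding D using T.qdet_left_of[of "set is" js \<alpha> j] I J j by blast
  next
    case 5
    then show ?thesis unfolding D using T.qdet_right_of[of "set is" js \<alpha> j] I J j by blast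
  next
    case 6
    have "?D * Y j \<alpha> = Y j \<alpha> * ?D"
    proof (rule qdet_commute)
      fix i \<gamma> assume "i \<in> set is" "\<gamma> \<in> set js"
      then show "Y i \<gamma> * Y j \<alpha> = Y j \<alpha> * Y i \<gamma>"
        using anti[of i j \<gamma> \<alpha>] 6 I J j a by (auto simp: subset_iff)
    qed
    then show ?thesis by (intro exI[of _ 1]) simp
  next
    case 7
    have "?D * Y j \<alpha> = Y j \<alpha> * ?D"
    proof (rule qdet_commute)
      fix i \<gamma> assume "i \<in> set is" "\<gamma> \<in> set js"
      then show "Y i \<gamma> * Y j \<alpha> = Y j \<alpha> * Y i \<gamma>"
        using anti[of j i \<alpha> \<gamma>] 7 I J j a by (auto simp: subset_iff)
    qed
    then show ?thesis by (intro exI[of _ 1]) simp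
  qed
qed

end

definition b_rows :: "nat \<Rightarrow> nat \<Rightarrow> nat \<Rightarrow> nat set" where
  "b_rows m n k = (if k \<le> m then {1..k} else if k \<le> n then {1..m} else {k - n + 1..m})"

definition b_cols :: "nat \<Rightarrow> nat \<Rightarrow> nat \<Rightarrow> nat set" where
  "b_cols m n k = (if k \<le> m then {n - k + 1..n} else if k \<le> n then {n - k + 1..n + m - k} else {1..m + n - k})"

lemma b_minor_rows_cols: "b_minor q m n k = quantum_minor q m n (b_rows m n k) (b_cols m n k)"
  by (simp add: b_minor_def b_rows_def b_cols_def)

context quantum_torus
begin

lemma lead_add_less:
  assumes "f \<in> A" "g \<in> A" "f \<noteq> 0" "\<And>a. a \<in> supp g \<Longrightarrow> a < lead f"
  shows "lead (f + g) = lead f" "f + g \<noteq> 0"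
proof -
  have "lead f \<notin> supp g" using assms(4) by blast
  then have l: "lead f \<in> supp (f + g)" using lead_in[OF assms(1,3)] by (simp add: supp_def)
  have "a \<le> lead f" if "a \<in> supp (f + g)" for a
  proof (cases "a \<in> supp f")
    case True
    then show ?thesis using lead_ge assms(1) by blast
  next
    case False
    then have "a \<in> supp g" using that by (auto simp: supp_def)
    then show ?thesis using assms(4) less_imp_le by blast
  qed
  then show "lead (f + g) = lead f" using l assms add_in_A leadI by blast
  show "f + g \<noteq> 0"
  proof
    assume "f + g = 0"
    with l show False by (simp only: supp_def mem_Collect_eq coef_simps(1)) simp
  qed
qed

text \<open>In the expansion along the first row, the smallest column contributes the earliest
  position \<open>(i, j)\<close>. The remaining minors have no exponents in this row, so that term
  dominates.\<close>

lemma qdet_lead: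
  assumes "sorted is" "distinct is" "set is \<subseteq> {1..m}" "sorted js" "distinct js" "set js \<subseteq> {1..n}"
    and "length is = length js"
  shows "qdet q y is (set js) \<in> A \<and> qdet q y is (set js) \<noteq> 0 \<and>
    lead (qdet q y is (set js)) = word_expo (Word (zip is js))"
  using assms
proof (induction "is" arbitrary: js)
  case Nil
  have "lead 1 = (0::expo)"
    by (rule leadI) (auto simp: one_in_A supp_def coef_one split: if_splits)
  then show ?case using Nil by (simp add: one_in_A word_expo_def)
next
  case (Cons i "is")
  then obtain j js' where js: "js = j # js'" by (cases js) auto
  have i: "i \<in> {1..m}" "j \<in> {1..n}" using Cons.prems js by auto
  have cols: "\<gamma> \<in> {1..n}" if "\<gamma> \<in> set js" for \<gamma> using Cons.prems that by auto
  have j: "j < \<gamma>" if "\<gamma> \<in> set js'" for \<gamma> using Cons.prems js that by (auto simp: le_less)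
  have above: "i < i'" if "i' \<in> set is" for i' using Cons.prems that by (auto simp: le_less)
  let ?D = "\<lambda>\<gamma>. qdet q y is (set js - {\<gamma>})"
  have D: "?D \<gamma> \<in> A \<and> ?D \<gamma> \<noteq> 0 \<and> lead (?D \<gamma>) = word_expo (Word (zip is (remove1 \<gamma> js)))" if "\<gamma> \<in> set js" for \<gamma>
  proof -
    have "set (remove1 \<gamma> js) = set js - {\<gamma>}" using Cons.prems by simp
    moreover have "qdet q y is (set (remove1 \<gamma> js)) \<in> A \<and> qdet q y is (set (remove1 \<gamma> js)) \<noteq> 0 \<and>
      lead (qdet q y is (set (remove1 \<gamma> js))) = word_expo (Word (zip is (remove1 \<gamma> js)))"
      using Cons.prems that
      by (intro Cons.IH) (auto simp: sorted_remove1 length_remove1 dest: notin_set_remove1)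
    ultimately show ?thesis by simp
  qed
  have row_zero: "Poly_Mapping.lookup (lead (?D \<gamma>)) (i', \<beta>) = 0" if "\<gamma> \<in> set js" "i' \<le> i" for \<gamma> i' \<beta>
  proof -
    have "(i', \<beta>) \<notin> set (zip is (remove1 \<gamma> js))" using above[of i'] that set_zip_leftD[of i' \<beta> "is"] by fastforce
    then show ?thesis using D[OF that(1)] by (simp add: lookup_word_expo count_list_0_iff)
  qed
  have less: "unit_vec i \<gamma> + lead (?D \<gamma>) < unit_vec i j + lead (?D j)" if "\<gamma> \<in> set js'" for \<gamma>
  proof -
    have "less_fun (Poly_Mapping.lookup (unit_vec i \<gamma> + lead (?D \<gamma>))) (Poly_Mapping.lookup (unit_vec i j + lead (?D j)))"
      unfolding less_fun_def
    proof (rule exI[of _ "(i, j)"], intro conjI allI impI)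
      show "Poly_Mapping.lookup (unit_vec i \<gamma> + lead (?D \<gamma>)) (i, j) < Poly_Mapping.lookup (unit_vec i j + lead (?D j)) (i, j)"
        using j[OF that] that row_zero[of \<gamma> i j] row_zero[of j i j] by (simp add: lookup_add lookup_single js)
      fix k :: "nat \<times> nat" assume "k < (i, j)"
      then obtain i' \<beta> where k: "k = (i', \<beta>)" "i' < i \<or> i' = i \<and> \<beta> < j" by (cases k) (auto simp: le_less)
      then show "Poly_Mapping.lookup (unit_vec i \<gamma> + lead (?D \<gamma>)) k = Poly_Mapping.lookup (unit_vec i j + lead (?D j)) k"
        using j[OF that] that row_zero[of \<gamma> i' \<beta>] row_zero[of j i' \<beta>] by (auto simp: lookup_add lookup_single js)
    qed
    then show ?thesis by (simp add: less_poly_mapping.rep_eq)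
  qed
  let ?t = "\<lambda>\<gamma>. (- q) ^ below \<gamma> (set js) *\<^sub>c (y i \<gamma> * ?D \<gamma>)"
  have j_notin: "j \<notin> set js'" using Cons.prems js by simp
  have below_j: "below j (set js) = 0"
    using j by (intro below_remove_Min) (auto simp: js le_less)
  have split: "qdet q y (i # is) (set js) = y i j * ?D j + (\<Sum>\<gamma>\<in>set js'. ?t \<gamma>)"
  proof -
    have "(\<Sum>\<gamma>\<in>set js. ?t \<gamma>) = ?t j + (\<Sum>\<gamma>\<in>set js'. ?t \<gamma>)"
      unfolding js using j_notin by (simp only: list.set(2)) (rule sum.insert, auto)
    then show ?thesis using below_j by simp
  qed
  have main: "y i j * ?D j \<in> A" "y i j * ?D j \<noteq> 0" "lead (y i j * ?D j) = unit_vec i j + lead (?D j)"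
    using D[of j] js lead_mult[OF y_in_A[OF i], of "?D j"] y_nonzero[OF i] mult_in_A[OF y_in_A[OF i]] lead_y[OF i] by auto
  have tA: "?t \<gamma> \<in> A" if "\<gamma> \<in> set js'" for \<gamma>
    using D[of \<gamma>] that js i cols[of \<gamma>] by (intro cscale_in_A mult_in_A y_in_A) auto
  have restA: "(\<Sum>\<gamma>\<in>set js'. ?t \<gamma>) \<in> A" using tA by (rule sum_in_A')
  have rest: "a < lead (y i j * ?D j)" if "a \<in> supp (\<Sum>\<gamma>\<in>set js'. ?t \<gamma>)" for a
  proof -
    have "(\<Sum>\<gamma>\<in>set js'. coef (?t \<gamma>) a) \<noteq> 0" using that unfolding supp_def coef_sum by simp
    then have "\<exists>\<gamma>\<in>set js'. coef (?t \<gamma>) a \<noteq> 0" by (metis (no_types, lifting) sum.neutral)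
    then obtain \<gamma> where g: "\<gamma> \<in> set js'" "coef (?t \<gamma>) a \<noteq> 0" by blast
    have c: "\<gamma> \<in> {1..n}" "\<gamma> \<in> set js" using cols g js by auto
    have "a \<in> supp (y i \<gamma> * ?D \<gamma>)" using g(2) by (simp add: supp_def)
    then have "a \<le> lead (y i \<gamma> * ?D \<gamma>)"
      using D[OF c(2)] by (intro lead_ge mult_in_A y_in_A i c) auto
    also have "lead (y i \<gamma> * ?D \<gamma>) = unit_vec i \<gamma> + lead (?D \<gamma>)"
      using lead_mult(1)[OF y_in_A[OF i(1) c(1)] _ y_nonzero[OF i(1) c(1)], of "?D \<gamma>"] D[OF c(2)] lead_y[OF i(1) c(1)] by simp
    also have "\<dots> < unit_vec i j + lead (?D j)" by (rule less[OF g(1)])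
    finally show ?thesis using main by simp
  qed
  have "word_expo (Word (zip (i # is) js)) = unit_vec i j + lead (?D j)"
    using D[of j] by (simp add: js word_expo_def)
  then show ?case
    using lead_add_less[OF main(1) restA main(2) rest] main restA
    unfolding split by (auto intro: add_in_A)
qed

text \<open>Diagonals are numbered from the upper right corner, \<open>k = 1\<close>, to the lower
  left corner, \<open>k = m + n - 1\<close>. The equation says, without truncated subtraction, that
  column minus row is \<open>n - k\<close>.\<close>

definition diagonal :: "nat \<Rightarrow> expo" where
  "diagonal k = (\<Sum>p\<in>{p \<in> box. n + fst p = snd p + k}. Poly_Mapping.single p 1)"

lemma lookup_diagonal: "Poly_Mapping.lookup (diagonal k) p = (if p \<in> box \<and> n + fst p = snd p + k then 1 else 0)"
proof -
  have "Poly_Mapping.lookup (diagonal k) p = (\<Sum>p'\<in>{p \<in> box. n + fst p = snd p + k}. if p' = p then 1 else 0)"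
    unfolding diagonal_def lookup_sum by (intro sum.cong refl) (auto simp: lookup_single when_def)
  then show ?thesis by simp
qed

definition b :: "nat \<Rightarrow> endo" where
  "b k = qdet q y (sorted_list_of_set (b_rows m n k)) (b_cols m n k)"

text \<open>The three ranges of \<open>k\<close> share one shape: a square block of size
  \<open>t\<close> with upper left corner \<open>(r, s)\<close>, extended along the diagonal until
  it meets the border at both ends.\<close>

lemma b_intervals:
  assumes "m \<le> n" "1 \<le> k" "k \<le> m + n - 1"
  obtains r s t where "b_rows m n k = {r..<r + t}" "b_cols m n k = {s..<s + t}" "n + r = s + k" "1 \<le> r" "1 \<le> s"
    "r + t \<le> Suc m" "s + t \<le> Suc n" "k \<le> m \<longrightarrow> r = 1 \<and> s + t = Suc n" "m < k \<and> k \<le> n \<longrightarrow> r = 1 \<and> r + t = Suc m"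
    "n < k \<longrightarrow> r + t = Suc m \<and> s = 1"
proof -
  consider "k \<le> m" | "m < k" "k \<le> n" | "n < k" by linarith
  then show ?thesis
  proof cases
    case 1
    show ?thesis
      by (rule that[of 1 k "n - k + 1"]) (use 1 assms in \<open>auto simp: b_rows_def b_cols_def\<close>)
  next
    case 2
    show ?thesis
      by (rule that[of 1 m "n - k + 1"]) (use 2 assms in \<open>auto simp: b_rows_def b_cols_def\<close>)
  next
    case 3
    show ?thesis
      by (rule that[of "k - n + 1" "m + n - k" 1]) (use 3 assms in \<open>auto simp: b_rows_def b_cols_def\<close>)
  qed
qed

lemma sorted_list_of_interval: "sorted_list_of_set {r..<s} = [r..<s]"
  by (simp add: sorted_list_of_set_range)

lemma b_props:
  assumes "m \<le> n" "1 \<le> k" "k \<le> m + n - 1"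
  shows "b k \<in> A" "b k \<noteq> 0" "lead (b k) = diagonal k"
    "j \<in> {1..m} \<Longrightarrow> \<alpha> \<in> {1..n} \<Longrightarrow> \<exists>c. b k * y j \<alpha> = c *\<^sub>c (y j \<alpha> * b k)"
proof -
  obtain r s t where rs: "b_rows m n k = {r..<r + t}" "b_cols m n k = {s..<s + t}" "n + r = s + k" "1 \<le> r" "1 \<le> s"
    "r + t \<le> Suc m" "s + t \<le> Suc n" "k \<le> m \<longrightarrow> r = 1 \<and> s + t = Suc n" "m < k \<and> k \<le> n \<longrightarrow> r = 1 \<and> r + t = Suc m"
    "n < k \<longrightarrow> r + t = Suc m \<and> s = 1"
    by (rule b_intervals[OF assms])
  have b: "b k = qdet q y [r..<r + t] (set [s..<s + t])"
    unfolding b_def rs sorted_list_of_interval by simp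
  have L: "qdet q y [r..<r + t] (set [s..<s + t]) \<in> A \<and> qdet q y [r..<r + t] (set [s..<s + t]) \<noteq> 0 \<and>
    lead (qdet q y [r..<r + t] (set [s..<s + t])) = word_expo (Word (zip [r..<r + t] [s..<s + t]))"
    using rs by (intro qdet_lead) auto
  have z: "set (zip [r..<r + t] [s..<s + t]) = {p \<in> box. n + fst p = snd p + k}"
  proof -
    have "zip [r..<r + t] [s..<s + t] = map (\<lambda>l. (r + l, s + l)) [0..<t]"
      by (rule nth_equalityI) simp_all
    then have "set (zip [r..<r + t] [s..<s + t]) = (\<lambda>l. (r + l, s + l)) ` {..<t}"
      by (simp add: atLeast0LessThan)
    also have "\<dots> = {p \<in> box. n + fst p = snd p + k}"
    proof (intro Set.set_eqI iffI)
      fix p assume "p \<in> {p \<in> box. n + fst p = snd p + k}"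
      then obtain i \<alpha> where p: "p = (i, \<alpha>)" "i \<in> {1..m}" "\<alpha> \<in> {1..n}" "n + i = \<alpha> + k" by (auto simp: box_def)
      have "r \<le> i" "i - r < t" using p rs by auto
      then have "p = (\<lambda>l. (r + l, s + l)) (i - r)" using p rs by auto
      then show "p \<in> (\<lambda>l. (r + l, s + l)) ` {..<t}" using \<open>i - r < t\<close> by blast
    qed (use rs in \<open>auto simp: box_def\<close>)
    finally show ?thesis .
  qed
  have "word_expo (Word (zip [r..<r + t] [s..<s + t])) = diagonal k"
  proof (rule poly_mapping_eqI)
    fix p
    have "distinct (zip [r..<r + t] [s..<s + t])" by (simp add: distinct_zipI1)
    then have "count_list (zip [r..<r + t] [s..<s + t]) p = (if p \<in> set (zip [r..<r + t] [s..<s + t]) then 1 else 0)"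
      by (metis count_mset distinct_count_atmost_1)
    then show "Poly_Mapping.lookup (word_expo (Word (zip [r..<r + t] [s..<s + t]))) p = Poly_Mapping.lookup (diagonal k) p"
      unfolding lookup_word_expo lookup_diagonal by (auto simp only: z word.sel mem_Collect_eq split: if_split)
  qed
  then show "b k \<in> A" "b k \<noteq> 0" "lead (b k) = diagonal k" using L b by auto
  show "\<exists>c. b k * y j \<alpha> = c *\<^sub>c (y j \<alpha> * b k)" if j: "j \<in> {1..m}" "\<alpha> \<in> {1..n}"
    unfolding b
  proof (rule y.qdet_normal)
    show "j \<in> set [r..<r + t] \<and> (\<alpha> \<in> set [s..<s + t] \<or> (\<forall>\<gamma>\<in>set [s..<s + t]. \<alpha> < \<gamma>) \<or> (\<forall>\<gamma>\<in>set [s..<s + t]. \<gamma> < \<alpha>)) \<or>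
      \<alpha> \<in> set [s..<s + t] \<and> ((\<forall>i\<in>set [r..<r + t]. j < i) \<or> (\<forall>i\<in>set [r..<r + t]. i < j)) \<or>
      (\<forall>i\<in>set [r..<r + t]. i < j) \<and> (\<forall>\<gamma>\<in>set [s..<s + t]. \<alpha> < \<gamma>) \<or>
      (\<forall>i\<in>set [r..<r + t]. j < i) \<and> (\<forall>\<gamma>\<in>set [s..<s + t]. \<gamma> < \<alpha>)"
    proof -
      \<comment> \<open>The block touches the upper or left border and the lower or right border, so
        no generator lies in the two regions where \<open>qdet_normal\<close> gives nothing.\<close>
      have no: "\<not> (j < r \<and> \<alpha> < s)" "\<not> (r + t \<le> j \<and> s + t \<le> \<alpha>)"
        using rs(8-) j by (cases "k \<le> m"; cases "k \<le> n"; simp)+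
      have J: "j < r \<Longrightarrow> \<forall>i\<in>set [r..<r + t]. j < i" "r \<le> j \<Longrightarrow> j < r + t \<Longrightarrow> j \<in> set [r..<r + t]"
        "r + t \<le> j \<Longrightarrow> \<forall>i\<in>set [r..<r + t]. i < j" by auto
      have K: "\<alpha> < s \<Longrightarrow> \<forall>\<gamma>\<in>set [s..<s + t]. \<alpha> < \<gamma>" "s \<le> \<alpha> \<Longrightarrow> \<alpha> < s + t \<Longrightarrow> \<alpha> \<in> set [s..<s + t]"
        "s + t \<le> \<alpha> \<Longrightarrow> \<forall>\<gamma>\<in>set [s..<s + t]. \<gamma> < \<alpha>" by auto
      have "j < r \<or> r \<le> j \<and> j < r + t \<or> r + t \<le> j" "\<alpha> < s \<or> s \<le> \<alpha> \<and> \<alpha> < s + t \<or> s + t \<le> \<alpha>"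
        by linarith+
      then show ?thesis using no J K by argo
    qed
  qed (use rs j in auto)
qed

end

section \<open>Counting eigenvalues\<close>

context quantum_torus
begin

text \<open>Row \<open>j\<close> meets the diagonal in column \<open>n + j - k\<close>, and column
  \<open>\<alpha>\<close> meets it in row \<open>\<alpha> + k - n\<close>, whenever these are in
  range. The two contributions have opposite signs, so the exponent vanishes if both or neither meet
  it.\<close>

lemma exponent_diagonal:
  assumes j: "j \<in> {1..m}" and a: "\<alpha> \<in> {1..n}"
  shows "exponent (diagonal k) j \<alpha> = (if k < n + j \<and> j \<le> k then sgn (int \<alpha> + int k - int n - int j) else 0) -
    (if n < \<alpha> + k \<and> \<alpha> + k \<le> n + m then sgn (int \<alpha> + int k - int n - int j) else 0)"
proof -
  have "(\<Sum>\<beta>\<in>{1..n}. Poly_Mapping.lookup (diagonal k) (j, \<beta>) * sgn (int \<alpha> - int \<beta>)) =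
    (\<Sum>\<beta>\<in>{1..n}. if \<beta> = n + j - k then if k < n + j \<and> j \<le> k then sgn (int \<alpha> + int k - int n - int j) else 0 else 0)"
    using j by (intro sum.cong refl) (auto simp: lookup_diagonal box_def of_nat_diff algebra_simps)
  also have "\<dots> = (if k < n + j \<and> j \<le> k then sgn (int \<alpha> + int k - int n - int j) else 0)"
    using j by auto
  finally have 1: "(\<Sum>\<beta>\<in>{1..n}. Poly_Mapping.lookup (diagonal k) (j, \<beta>) * sgn (int \<alpha> - int \<beta>)) = \<dots>" .
  have "(\<Sum>i\<in>{1..m}. Poly_Mapping.lookup (diagonal k) (i, \<alpha>) * sgn (int j - int i)) =
    (\<Sum>i\<in>{1..m}. if i = \<alpha> + k - n then if n < \<alpha> + k \<and> \<alpha> + k \<le> n + m then - sgn (int \<alpha> + int k - int n - int j) else 0 else 0)"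
    using a by (intro sum.cong refl) (auto simp: lookup_diagonal box_def of_nat_diff algebra_simps sgn_if)
  also have "\<dots> = - (if n < \<alpha> + k \<and> \<alpha> + k \<le> n + m then sgn (int \<alpha> + int k - int n - int j) else 0)"
    by auto
  finally show ?thesis
    using 1 by (simp add: exponent_rows_cols[OF j a])
qed

definition count_exponent :: "expo \<Rightarrow> int \<Rightarrow> nat" where
  "count_exponent a e = card {p \<in> box. exponent a (fst p) (snd p) = e}"

lemma exponent_diagonal_values:
  assumes "p \<in> box"
  shows "exponent (diagonal k) (fst p) (snd p) \<in> {- 1, 0, 1}"
proof (cases p)
  case (Pair j \<alpha>)
  then have j: "j \<in> {1..m}" "\<alpha> \<in> {1..n}" using assms by (auto simp: box_def)
  show ?thesis
    unfolding Pair fst_conv snd_conv exponent_diagonal[OF j] sgn_if by auto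
qed

lemma count_diagonal_left:
  assumes "m \<le> n" "k \<le> m"
  shows "count_exponent (diagonal k) (- 1) = k * (n - k)" "count_exponent (diagonal k) 1 = (m - k) * k"
proof -
  have "{p \<in> box. exponent (diagonal k) (fst p) (snd p) = - 1} = {1..k} \<times> {1..n - k}"
    using assms by (auto simp: box_def exponent_diagonal sgn_if split: if_splits; arith)
  then show "count_exponent (diagonal k) (- 1) = k * (n - k)"
    by (simp add: count_exponent_def)
  have "{p \<in> box. exponent (diagonal k) (fst p) (snd p) = 1} = {k + 1..m} \<times> {n - k + 1..n}"
    using assms by (auto simp: box_def exponent_diagonal sgn_if split: if_splits; arith)
  then show "count_exponent (diagonal k) 1 = (m - k) * k"
    using assms by (simp add: count_exponent_def)
qed

lemma count_diagonal_middle: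
  assumes "m \<le> k" "k \<le> n"
  shows "count_exponent (diagonal k) (- 1) = m * (n - k)" "count_exponent (diagonal k) 1 = m * (k - m)"
proof -
  have "{p \<in> box. exponent (diagonal k) (fst p) (snd p) = - 1} = {1..m} \<times> {1..n - k}"
    using assms by (auto simp: box_def exponent_diagonal sgn_if split: if_splits; arith)
  then show "count_exponent (diagonal k) (- 1) = m * (n - k)"
    by (simp add: count_exponent_def)
  have "{p \<in> box. exponent (diagonal k) (fst p) (snd p) = 1} = {1..m} \<times> {n + m - k + 1..n}"
    using assms by (auto simp: box_def exponent_diagonal sgn_if split: if_splits; arith)
  then show "count_exponent (diagonal k) 1 = m * (k - m)"
    using assms by (simp add: count_exponent_def)
qed

lemma count_diagonal_right:
  assumes "m \<le> n" "n \<le> k" "k \<le> m + n"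
  shows "count_exponent (diagonal k) (- 1) = (k - n) * (m + n - k)" "count_exponent (diagonal k) 1 = (m + n - k) * (k - m)"
proof -
  have "{p \<in> box. exponent (diagonal k) (fst p) (snd p) = - 1} = {1..k - n} \<times> {1..m + n - k}"
    using assms by (auto simp: box_def exponent_diagonal sgn_if split: if_splits; arith)
  then show "count_exponent (diagonal k) (- 1) = (k - n) * (m + n - k)"
    by (simp add: count_exponent_def)
  have "{p \<in> box. exponent (diagonal k) (fst p) (snd p) = 1} = {k - n + 1..m} \<times> {m + n - k + 1..n}"
    using assms by (auto simp: box_def exponent_diagonal sgn_if split: if_splits; arith)
  then show "count_exponent (diagonal k) 1 = (m + n - k) * (k - m)"
    using assms by (simp add: count_exponent_def)
qed

lemma exponent_add: "exponent (a + a') i \<alpha> = exponent a i \<alpha> + exponent a' i \<alpha>"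
  by (simp add: exponent_def form_simps)

lemma exponent_zero: "exponent 0 i \<alpha> = 0"
  by (simp add: exponent_def form_simps)

text \<open>These are also the counts of the diagonal \<open>2 * m\<close>, so at this one index
  multiplicities cannot tell a single diagonal from the sum of two.\<close>

lemma count_two_diagonals:
  assumes "n = 3 * m"
  shows "count_exponent (diagonal m + diagonal n) (- 1) = m * m" "count_exponent (diagonal m + diagonal n) 1 = m * m"
proof -
  have le: "n \<le> 3 * m" "3 * m \<le> n" and mn: "m \<le> n" using assms by simp_all
  have e: "exponent (diagonal m + diagonal n) j \<alpha> = (if \<alpha> \<le> m then - 1 else if 2 * m < \<alpha> then 1 else 0)"
    if j: "j \<in> {1..m}" "\<alpha> \<in> {1..n}" for j \<alpha>
  proof -
    have "exponent (diagonal m) j \<alpha> = (if \<alpha> \<le> 2 * m then - 1 else 0)"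
      unfolding exponent_diagonal[OF j] sgn_if using j le by auto
    moreover have "exponent (diagonal n) j \<alpha> = (if \<alpha> \<le> m then 0 else 1)"
      unfolding exponent_diagonal[OF j] sgn_if using j le by auto
    ultimately show ?thesis using j by (auto simp: exponent_add)
  qed
  have "{p \<in> box. exponent (diagonal m + diagonal n) (fst p) (snd p) = - 1} = {1..m} \<times> {1..m}"
    using mn by (auto simp: box_def e split: if_splits)
  then show "count_exponent (diagonal m + diagonal n) (- 1) = m * m"
    by (simp add: count_exponent_def)
  have "{p \<in> box. exponent (diagonal m + diagonal n) (fst p) (snd p) = 1} = {1..m} \<times> {2 * m + 1..n}"
    by (auto simp: box_def e split: if_splits)
  moreover have "n - 2 * m = m" using assms by simp
  ultimately show "count_exponent (diagonal m + diagonal n) 1 = m * m"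
    by (simp add: count_exponent_def)
qed

lemma count_diagonal_int:
  assumes n: "n = 3 * m" and k: "1 \<le> k" "k \<le> 4 * m - 1"
  shows "k \<le> m \<Longrightarrow> int (count_exponent (diagonal k) (- 1)) = int k * (3 * int m - int k) \<and>
      int (count_exponent (diagonal k) 1) = (int m - int k) * int k"
    "m \<le> k \<Longrightarrow> k \<le> 3 * m \<Longrightarrow> int (count_exponent (diagonal k) (- 1)) = int m * (3 * int m - int k) \<and>
      int (count_exponent (diagonal k) 1) = int m * (int k - int m)"
    "3 * m \<le> k \<Longrightarrow> int (count_exponent (diagonal k) (- 1)) = (int k - 3 * int m) * (4 * int m - int k) \<and>
      int (count_exponent (diagonal k) 1) = (4 * int m - int k) * (int k - int m)"
  using n k count_diagonal_left[of k] count_diagonal_middle[of k] count_diagonal_right[of k]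
  by (simp_all add: of_nat_diff)

lemma count_diagonal_inj:
  assumes n: "n = 3 * m" and k: "1 \<le> k" "k \<le> 4 * m - 1" and l: "1 \<le> l" "l \<le> 4 * m - 1"
    and eq: "count_exponent (diagonal k) (- 1) = count_exponent (diagonal l) (- 1)"
      "count_exponent (diagonal k) 1 = count_exponent (diagonal l) 1"
  shows "k = l"
proof -
  \<comment> \<open>\<open>W k\<close> is the length of the diagonal. The difference of the two
    counts is \<open>2 * int m * D k\<close>, and their sum
    \<open>2 * W k * (2 * int m - W k)\<close> is strictly increasing in \<open>W k\<close> up to
    \<open>int m\<close>. Together \<open>D\<close> and \<open>W\<close> determine
    \<open>k\<close>.\<close>
  define D where "D k = (if k \<le> m then - int k else if k \<le> 3 * m then int k - 2 * int m else 4 * int m - int k)" for k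
  define W where "W k = (if k \<le> m then int k else if k \<le> 3 * m then int m else 4 * int m - int k)" for k
  have m: "0 < int m" using k by simp
  have diff: "int (count_exponent (diagonal k) 1) - int (count_exponent (diagonal k) (- 1)) = 2 * int m * D k"
    and tot: "int (count_exponent (diagonal k) 1) + int (count_exponent (diagonal k) (- 1)) = 2 * W k * (2 * int m - W k)"
    if "1 \<le> k" "k \<le> 4 * m - 1" for k
    using count_diagonal_int[OF n that] by (auto simp: D_def W_def algebra_simps)
  have W: "1 \<le> W k" "W k \<le> int m" if "1 \<le> k" "k \<le> 4 * m - 1" for k
    using that by (auto simp: W_def)
  have "2 * int m * D k = 2 * int m * D l"
    unfolding diff[OF k, symmetric] diff[OF l, symmetric] eq ..
  then have D: "D k = D l" using m by simp
  have "2 * W k * (2 * int m - W k) = 2 * W l * (2 * int m - W l)"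
    unfolding tot[OF k, symmetric] tot[OF l, symmetric] eq ..
  then have "(W k - W l) * (2 * int m - W k - W l) = 0" by (simp add: algebra_simps)
  then have "W k = W l" using W[OF k] W[OF l] by auto
  then show ?thesis using D k l m unfolding D_def W_def by (auto split: if_splits)
qed

text \<open>The exponents at the corners \<open>(1, 1)\<close> and \<open>(m, n)\<close> are, up to sign, the total multiplicities of the
  diagonals that miss the corner; hence multiplicities are at most one.\<close>

lemma diagonal_characterization:
  assumes m: "m \<ge> 1" and n: "n = 3 * m" and k: "1 \<le> k" "k \<le> 4 * m - 1" "k \<noteq> 2 * m"
    and nonneg: "\<And>p. 0 \<le> Poly_Mapping.lookup a p" and outside: "\<And>p. p \<notin> box \<Longrightarrow> Poly_Mapping.lookup a p = 0"
    and diag: "\<And>i \<alpha>. i \<in> {1..m} \<Longrightarrow> Suc i \<le> m \<Longrightarrow> \<alpha> \<in> {1..n} \<Longrightarrow> Suc \<alpha> \<le> n \<Longrightarrow>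
      Poly_Mapping.lookup a (Suc i, Suc \<alpha>) = Poly_Mapping.lookup a (i, \<alpha>)"
    and count: "\<And>e. count_exponent a e = count_exponent (diagonal k) e"
  shows "a = diagonal k"
proof -
  \<comment> \<open>\<open>x l\<close> is the constant value on diagonal \<open>l\<close>, read at
    its first entry, which lies in the first row or the first column.\<close>
  define x where "x l = Poly_Mapping.lookup a (if l \<le> n then (1, n + 1 - l) else (l + 1 - n, 1))" for l
  have x: "Poly_Mapping.lookup a (j, \<alpha>) = x (n + j - \<alpha>)" if "j \<in> {1..m}" "\<alpha> \<in> {1..n}" for j \<alpha>
  proof -
    have "j \<le> m \<Longrightarrow> 1 \<le> j \<Longrightarrow> \<alpha> \<le> n \<Longrightarrow> 1 \<le> \<alpha> \<Longrightarrow> Poly_Mapping.lookup a (j, \<alpha>) = x (n + j - \<alpha>)" for \<alpha>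
    proof (induction j arbitrary: \<alpha>)
      case (Suc j)
      show ?case
      proof (cases "j = 0 \<or> \<alpha> = 1")
        case True
        then show ?thesis using Suc.prems by (auto simp: x_def)
      next
        case False
        then have "Poly_Mapping.lookup a (Suc j, Suc (\<alpha> - 1)) = Poly_Mapping.lookup a (j, \<alpha> - 1)"
          using Suc.prems by (intro diag) auto
        moreover have "1 \<le> \<alpha> - 1" using False Suc.prems by auto
        ultimately show ?thesis using False Suc.prems Suc.IH[of "\<alpha> - 1"] by simp
      qed
    qed simp
    then show ?thesis using that by simp
  qed
  have n1: "1 \<le> n" using m n by simp
  have x0: "0 \<le> x l" for l unfolding x_def by (rule nonneg)
  \<comment> \<open>A value that occurs has positive count, hence also occurs for the diagonal
    \<open>k\<close>, where only \<open>- 1\<close>, \<open>0\<close> and \<open>1\<close> are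
    possible.\<close>
  have vals: "exponent a i \<alpha> \<in> {- 1, 0, 1}" if "(i, \<alpha>) \<in> box" for i \<alpha>
  proof -
    have "{p \<in> box. exponent a (fst p) (snd p) = exponent a i \<alpha>} \<noteq> {}" using that by force
    then have "count_exponent a (exponent a i \<alpha>) \<noteq> 0" by (simp add: count_exponent_def)
    then have "{p \<in> box. exponent (diagonal k) (fst p) (snd p) = exponent a i \<alpha>} \<noteq> {}"
      using count by (metis count_exponent_def card.empty)
    then obtain p where "p \<in> box" "exponent (diagonal k) (fst p) (snd p) = exponent a i \<alpha>" by blast
    then show ?thesis using exponent_diagonal_values by metis
  qed
  have two_le: "Suc 0 \<le> i \<Longrightarrow> 2 \<le> i \<longleftrightarrow> i \<noteq> Suc 0" for i by auto
  have pred_le: "i \<le> n \<Longrightarrow> i \<le> n - Suc 0 \<longleftrightarrow> i \<noteq> n" "i \<le> m \<Longrightarrow> i \<le> m - Suc 0 \<longleftrightarrow> i \<noteq> m" for i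
    using m n by auto
  \<comment> \<open>Seen from \<open>(1, 1)\<close>, all other entries of the first row and column
    count with sign \<open>- 1\<close>; only diagonal \<open>n\<close>, which passes through this
    corner, is absent.\<close>
  have corner1: "(\<Sum>\<beta>\<in>{2..n}. x (n + 1 - \<beta>)) + (\<Sum>j\<in>{2..m}. x (n + j - 1)) \<le> 1"
  proof -
    have "(\<Sum>\<beta>\<in>{1..n}. Poly_Mapping.lookup a (1, \<beta>) * sgn (int 1 - int \<beta>)) = - (\<Sum>\<beta>\<in>{2..n}. x (n + 1 - \<beta>))"
      unfolding sum_negf[symmetric] using x m by (intro sum.mono_neutral_cong_right) (auto simp: two_le pred_le)
    moreover have "(\<Sum>j\<in>{1..m}. Poly_Mapping.lookup a (j, 1) * sgn (int 1 - int j)) = - (\<Sum>j\<in>{2..m}. x (n + j - 1))"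
      unfolding sum_negf[symmetric] using x m n1 by (intro sum.mono_neutral_cong_right) (auto simp: two_le pred_le)
    ultimately have "exponent a 1 1 = - (\<Sum>\<beta>\<in>{2..n}. x (n + 1 - \<beta>)) - (\<Sum>j\<in>{2..m}. x (n + j - 1))"
      using m n1 by (simp add: exponent_rows_cols)
    then show ?thesis using vals[of 1 1] m n1 by (auto simp: box_def)
  qed
  \<comment> \<open>Likewise \<open>(m, n)\<close> sees every diagonal except \<open>m\<close>, now
    with positive sign.\<close>
  have corner2: "(\<Sum>\<beta>\<in>{1..n - 1}. x (n + m - \<beta>)) + (\<Sum>j\<in>{1..m - 1}. x j) \<le> 1"
  proof -
    have "(\<Sum>\<beta>\<in>{1..n}. Poly_Mapping.lookup a (m, \<beta>) * sgn (int n - int \<beta>)) = (\<Sum>\<beta>\<in>{1..n - 1}. x (n + m - \<beta>))"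
      using x m by (intro sum.mono_neutral_cong_right) (auto simp: two_le pred_le)
    moreover have "(\<Sum>j\<in>{1..m}. Poly_Mapping.lookup a (j, n) * sgn (int m - int j)) = (\<Sum>j\<in>{1..m - 1}. x j)"
      using x m n1 by (intro sum.mono_neutral_cong_right) (auto simp: two_le pred_le)
    ultimately have "exponent a m n = (\<Sum>\<beta>\<in>{1..n - 1}. x (n + m - \<beta>)) + (\<Sum>j\<in>{1..m - 1}. x j)"
      using m n1 by (simp add: exponent_rows_cols)
    then show ?thesis using vals[of m n] m n1 by (auto simp: box_def)
  qed
  let ?K = "{1..m + n - 1}"
  have sum1: "(\<Sum>l\<in>?K - {n}. x l) \<le> 1"
  proof -
    have "?K - {n} = {1..n - 1} \<union> {n + 1..m + n - 1}" using m n by auto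
    then have "(\<Sum>l\<in>?K - {n}. x l) = (\<Sum>l\<in>{1..n - 1}. x l) + (\<Sum>l\<in>{n + 1..m + n - 1}. x l)"
      by (simp add: sum.union_disjoint)
    also have "(\<Sum>l\<in>{1..n - 1}. x l) = (\<Sum>\<beta>\<in>{2..n}. x (n + 1 - \<beta>))"
      by (rule sum.reindex_bij_witness[of _ "\<lambda>\<beta>. n + 1 - \<beta>" "\<lambda>l. n + 1 - l"]) auto
    also have "(\<Sum>l\<in>{n + 1..m + n - 1}. x l) = (\<Sum>j\<in>{2..m}. x (n + j - 1))"
      by (rule sum.reindex_bij_witness[of _ "\<lambda>j. n + j - 1" "\<lambda>l. l + 1 - n"]) auto
    finally show ?thesis using corner1 by simp
  qed
  have sum2: "(\<Sum>l\<in>?K - {m}. x l) \<le> 1"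
  proof -
    have "?K - {m} = {1..m - 1} \<union> {m + 1..m + n - 1}" using m n by auto
    then have "(\<Sum>l\<in>?K - {m}. x l) = (\<Sum>l\<in>{1..m - 1}. x l) + (\<Sum>l\<in>{m + 1..m + n - 1}. x l)"
      by (simp add: sum.union_disjoint)
    also have "(\<Sum>l\<in>{m + 1..m + n - 1}. x l) = (\<Sum>\<beta>\<in>{1..n - 1}. x (n + m - \<beta>))"
      by (rule sum.reindex_bij_witness[of _ "\<lambda>\<beta>. n + m - \<beta>" "\<lambda>l. n + m - l"]) auto
    finally show ?thesis using corner2 by simp
  qed
  \<comment> \<open>Two diagonals avoiding a common corner cannot both occur. Only the pair
    \<open>m\<close>, \<open>n\<close> escapes, because each of the two corners lies on one of
    them.\<close>
  have two: "x l + x l' \<le> 1" if "l \<in> ?K - {p}" "l' \<in> ?K - {p}" "l \<noteq> l'" "p = n \<or> p = m" for l l' p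
  proof -
    have "x l + x l' = (\<Sum>i\<in>{l, l'}. x i)" using that by simp
    also have "\<dots> \<le> (\<Sum>i\<in>?K - {p}. x i)" using that x0 by (intro sum_mono2) auto
    finally show ?thesis using sum1 sum2 that by auto
  qed
  have one: "x l \<le> 1" if "l \<in> ?K" for l
  proof -
    obtain p where "p = n \<or> p = m" "p \<noteq> l" using m n by (cases "l = n") auto
    moreover from this have "x l \<le> (\<Sum>i\<in>?K - {p}. x i)" using that x0 by (intro member_le_sum) auto
    ultimately show ?thesis using sum1 sum2 by auto
  qed
  have expand: "a = diagonal l" if "l \<in> ?K" "x l = 1" "\<And>l'. l' \<in> ?K \<Longrightarrow> l' \<noteq> l \<Longrightarrow> x l' = 0" for l
  proof (rule poly_mapping_eqI)
    fix p :: "nat \<times> nat"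
    obtain j \<alpha> where p: "p = (j, \<alpha>)" by (cases p)
    show "Poly_Mapping.lookup a p = Poly_Mapping.lookup (diagonal l) p"
    proof (cases "p \<in> box")
      case True
      then have j: "j \<in> {1..m}" "\<alpha> \<in> {1..n}" "n + j - \<alpha> \<in> ?K" by (auto simp: box_def p)
      then show ?thesis
        using True x[OF j(1,2)] that(2) that(3)[OF j(3)] by (cases "n + j - \<alpha> = l") (auto simp: lookup_diagonal p)
    qed (simp add: outside lookup_diagonal)
  qed
  have finish: "a = diagonal k" if "l \<in> ?K" "x l = 1" "\<And>l'. l' \<in> ?K \<Longrightarrow> l' \<noteq> l \<Longrightarrow> x l' = 0" for l
  proof -
    have al: "a = diagonal l" using that by (rule expand)
    have "1 \<le> l" "l \<le> 4 * m - 1" using that(1) n by auto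
    moreover have "count_exponent (diagonal k) e = count_exponent (diagonal l) e" for e
      unfolding al[symmetric] count ..
    ultimately have "k = l" by (intro count_diagonal_inj[OF n k(1,2)])
    then show ?thesis using al by simp
  qed
  have nK: "n \<in> ?K" "m \<in> ?K" "m \<noteq> n" using m n by auto
  show ?thesis
  proof (cases "\<exists>l\<in>?K. l \<noteq> m \<and> l \<noteq> n \<and> x l \<noteq> 0")
    case True
    then obtain l where l: "l \<in> ?K" "l \<noteq> m" "l \<noteq> n" "x l \<noteq> 0" by blast
    then have xl: "x l = 1" using x0[of l] one[of l] by linarith
    have "x l' = 0" if "l' \<in> ?K" "l' \<noteq> l" for l'
      using two[of l m l'] two[of l n l'] xl l that x0[of l'] nK by (cases "l' = m") auto
    then show ?thesis using finish l xl by blast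
  next
    case False
    then have z: "x l = 0" if "l \<in> ?K" "l \<noteq> m" "l \<noteq> n" for l using that by blast
    consider "x m = 0" "x n = 0" | "x m = 1" "x n = 0" | "x m = 0" "x n = 1" | "x m = 1" "x n = 1"
      using x0[of m] x0[of n] one[OF nK(1)] one[OF nK(2)] by linarith
    then show ?thesis
    proof cases
      \<comment> \<open>The zero exponent gives no eigenvalue exponents \<open>- 1\<close> or
        \<open>1\<close>, whereas every diagonal in range has some.\<close>
      case 1
      have "a = 0"
      proof (rule poly_mapping_eqI)
        fix p :: "nat \<times> nat"
        obtain j \<alpha> where p: "p = (j, \<alpha>)" by (cases p)
        show "Poly_Mapping.lookup a p = Poly_Mapping.lookup 0 p"
        proof (cases "p \<in> box")
          case True
          then have j: "j \<in> {1..m}" "\<alpha> \<in> {1..n}" "n + j - \<alpha> \<in> ?K" by (auto simp: box_def p)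
          then show ?thesis
            using x[OF j(1,2)] z[OF j(3)] 1 by (cases "n + j - \<alpha> = m \<or> n + j - \<alpha> = n") (auto simp: p)
        qed (simp add: outside)
      qed
      then have "count_exponent (diagonal k) (- 1) = 0" "count_exponent (diagonal k) 1 = 0"
        unfolding count[symmetric] by (simp_all add: count_exponent_def exponent_zero)
      then show ?thesis using count_diagonal_int[OF n k(1,2)] m k by (cases "k \<le> m"; cases "k \<le> 3 * m") auto
    next
      case 2
      then show ?thesis using finish[OF nK(2)] z by metis
    next
      case 3
      then show ?thesis using finish[OF nK(1)] z by metis
    next
      \<comment> \<open>The pair that the corner bounds allow: its counts are those of diagonal
        \<open>2 * m\<close>, so injectivity leads to the excluded index.\<close>
      case 4
      have "a = diagonal m + diagonal n"
      proof (rule poly_mapping_eqI)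
        fix p :: "nat \<times> nat"
        obtain j \<alpha> where p: "p = (j, \<alpha>)" by (cases p)
        show "Poly_Mapping.lookup a p = Poly_Mapping.lookup (diagonal m + diagonal n) p"
        proof (cases "p \<in> box")
          case True
          then have j: "j \<in> {1..m}" "\<alpha> \<in> {1..n}" "n + j - \<alpha> \<in> ?K" by (auto simp: box_def p)
          then show ?thesis
            using True x[OF j(1,2)] z[OF j(3)] 4 nK
            by (cases "n + j - \<alpha> = m"; cases "n + j - \<alpha> = n") (auto simp: lookup_add lookup_diagonal p)
        qed (simp add: outside lookup_add lookup_diagonal)
      qed
      then have "count_exponent (diagonal k) (- 1) = m * m" "count_exponent (diagonal k) 1 = m * m"
        unfolding count[symmetric] by (simp_all only: count_two_diagonals[OF n])
      moreover have "count_exponent (diagonal (2 * m)) (- 1) = m * m" "count_exponent (diagonal (2 * m)) 1 = m * m"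
      proof -
        have "m \<le> 2 * m" "2 * m \<le> n" "n - 2 * m = m" "2 * m - m = m" using n by simp_all
        then show "count_exponent (diagonal (2 * m)) (- 1) = m * m" "count_exponent (diagonal (2 * m)) 1 = m * m"
          by (simp_all only: count_diagonal_middle)
      qed
      moreover have "1 \<le> 2 * m" "2 * m \<le> 4 * m - 1" using m by auto
      ultimately have "k = 2 * m" by (intro count_diagonal_inj[OF n k(1,2)]) simp_all
      then show ?thesis using k by simp
    qed
  qed
qed

end

section \<open>Linear parts of automorphisms\<close>

context quantum_torus
begin

abbreviation y_at :: "nat \<times> nat \<Rightarrow> endo" where
  "y_at p \<equiv> y (fst p) (snd p)"

lemma y_at_S: "p \<in> box \<Longrightarrow> y_at p \<in> S"
  using S_closed(7) by (auto simp: box_def)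

definition degree :: "expo \<Rightarrow> int" where
  "degree a = (\<Sum>k\<in>{1..m}. row_weight k a)"

lemma degree_add: "degree (a + a') = degree a + degree a'"
  by (simp add: degree_def weight_simps sum.distrib)

lemma degree_word_expo: "box_word w \<Longrightarrow> degree (word_expo w) = int (length (letters w))"
proof -
  have "degree (word_expo (Word ws)) = int (length ws)" if "set ws \<subseteq> box" for ws
    using that
  proof (induction ws)
    case Nil
    then show ?case by (simp add: degree_def word_expo_def weight_simps)
  next
    case (Cons x ws)
    obtain i \<alpha> where x: "x = (i, \<alpha>)" by (cases x) auto
    have "word_expo (Word (x # ws)) = unit_vec i \<alpha> + word_expo (Word ws)" by (simp add: word_expo_def x)
    moreover have "degree (unit_vec i \<alpha>) = 1"
      using Cons.prems by (simp add: degree_def row_weight_unit_vec x box_def)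
    ultimately show ?case using Cons by (simp add: degree_add)
  qed
  from this[of "letters w"] show "box_word w \<Longrightarrow> degree (word_expo w) = int (length (letters w))"
    by (simp add: box_word_def)
qed

lemma degree_eval_word:
  assumes "box_word w" "a \<in> supp (eval_word w)"
  shows "degree a = int (length (letters w))"
proof -
  have "degree a = degree (word_expo w)"
    unfolding degree_def using eval_word_props(4)[OF assms] by simp
  then show ?thesis using degree_word_expo assms by simp
qed

lemma eval_word_S:
  assumes "box_word w"
  shows "eval_word w \<in> S"
proof -
  have "phi (Poly_Mapping.single w 1) = eval_word w" by (simp add: phi_single)
  moreover have "Poly_Mapping.single w 1 \<in> carrier (free_alg m n)"
    using assms by (simp add: carrier_iff)
  ultimately show ?thesis unfolding S_def by (metis imageI)
qed

text \<open>The descending filtration by total degree. Torus exponents detect it, because every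
  monomial of an evaluated word has the length of the word as its degree.\<close>

definition S_deg :: "nat \<Rightarrow> endo set" where
  "S_deg d = {f \<in> S. \<forall>a\<in>supp f. int d \<le> degree a}"

lemma S_deg_closed:
  "f \<in> S_deg d \<Longrightarrow> g \<in> S_deg d \<Longrightarrow> f + g \<in> S_deg d" "f \<in> S_deg d \<Longrightarrow> g \<in> S_deg d \<Longrightarrow> f - g \<in> S_deg d"
  "f \<in> S_deg d \<Longrightarrow> c *\<^sub>c f \<in> S_deg d" "0 \<in> S_deg d"
proof -
  have "supp (f + g) \<subseteq> supp f \<union> supp g" "supp (f - g) \<subseteq> supp f \<union> supp g" "supp (c *\<^sub>c f) \<subseteq> supp f"
    by (auto simp: supp_def)
  then show "f \<in> S_deg d \<Longrightarrow> g \<in> S_deg d \<Longrightarrow> f + g \<in> S_deg d" "f \<in> S_deg d \<Longrightarrow> g \<in> S_deg d \<Longrightarrow> f - g \<in> S_deg d"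
    "f \<in> S_deg d \<Longrightarrow> c *\<^sub>c f \<in> S_deg d"
    unfolding S_deg_def by (auto intro: S_closed)
  show "0 \<in> S_deg d" by (auto simp: S_deg_def S_closed supp_def)
qed

lemma S_deg_sum: "(\<And>i. i \<in> I \<Longrightarrow> f i \<in> S_deg d) \<Longrightarrow> (\<Sum>i\<in>I. f i) \<in> S_deg d"
  by (induction I rule: infinite_finite_induct) (auto intro: S_deg_closed)

lemma S_deg_mult:
  assumes "f \<in> S_deg d" "g \<in> S_deg e"
  shows "f * g \<in> S_deg (d + e)"
proof -
  have "int (d + e) \<le> degree a" if a: "a \<in> supp (f * g)" for a
  proof -
    have "f \<in> A" "g \<in> A" using assms S_in_A by (auto simp: S_deg_def)
    then obtain b c where "b \<in> supp f" "c \<in> supp g" "a = b + c" using supp_mult a by metis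
    then show ?thesis using assms by (fastforce simp: S_deg_def degree_add)
  qed
  then show ?thesis using assms by (auto simp: S_deg_def intro: S_closed)
qed

lemma S_supp:
  assumes "f \<in> S" "a \<in> supp f"
  shows "0 \<le> degree a" "degree a = 0 \<Longrightarrow> a = 0"
proof -
  obtain r where r: "sorted_combination r" "f = phi r" using assms S_sorted by blast
  then obtain w where w: "w \<in> Poly_Mapping.keys r" "a \<in> supp (eval_word w)" using supp_phi assms by metis
  then have bw: "box_word w" using r by (auto simp: sorted_combination_def carrier_iff)
  have d: "degree a = int (length (letters w))" using degree_eval_word[OF bw w(2)] .
  then show "0 \<le> degree a" by simp
  assume "degree a = 0"
  then have "letters w = []" using d by simp
  then have "eval_word w = 1" by (simp add: eval_word_def)
  then show "a = 0" using w(2) by (auto simp: supp_def coef_one split: if_splits)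
qed

lemma word_sum_S_deg:
  assumes "\<And>w. w \<in> W \<Longrightarrow> box_word w \<and> d \<le> length (letters w)"
  shows "(\<Sum>w\<in>W. c w *\<^sub>c eval_word w) \<in> S_deg d"
proof (intro S_deg_sum S_deg_closed(3))
  fix w assume "w \<in> W"
  then show "eval_word w \<in> S_deg d"
    using assms degree_eval_word eval_word_S by (fastforce simp: S_deg_def)
qed

text \<open>The higher part is kept as an explicit sum of words, since conjugation by a
  quasi-central element will rescale it word by word.\<close>

lemma linear_part:
  assumes "f \<in> S"
  obtains c0 P W c where "finite W" "\<And>w. w \<in> W \<Longrightarrow> box_word w \<and> 2 \<le> length (letters w)"
    "f = c0 *\<^sub>c 1 + (\<Sum>p\<in>box. P p *\<^sub>c y_at p) + (\<Sum>w\<in>W. c w *\<^sub>c eval_word w)"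
proof -
  obtain r where r: "sorted_combination r" "f = phi r" using assms S_sorted by blast
  let ?L = "Poly_Mapping.lookup r"
  let ?W = "{w \<in> Poly_Mapping.keys r. 2 \<le> length (letters w)}"
  let ?F = "insert (Word []) ((\<lambda>p. Word [p]) ` box) \<union> ?W"
  have bw: "box_word w" if "w \<in> Poly_Mapping.keys r" for w
    using that r by (auto simp: sorted_combination_def carrier_iff)
  have "Poly_Mapping.keys r \<subseteq> ?F"
  proof
    fix w assume w: "w \<in> Poly_Mapping.keys r"
    show "w \<in> ?F"
    proof (cases "letters w" rule: list.exhaust)
      case Nil
      then show ?thesis by (cases w) auto
    next
      case (Cons p ps)
      then show ?thesis using w bw[OF w] by (cases w; cases ps) (auto simp: box_word_def)
    qed
  qed
  then have "f = (\<Sum>w\<in>?F. ?L w *\<^sub>c eval_word w)"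
    unfolding r(2) by (intro phi_superset) auto
  also have "\<dots> = (\<Sum>w\<in>insert (Word []) ((\<lambda>p. Word [p]) ` box). ?L w *\<^sub>c eval_word w) + (\<Sum>w\<in>?W. ?L w *\<^sub>c eval_word w)"
    by (rule sum.union_disjoint) auto
  also have "(\<Sum>w\<in>insert (Word []) ((\<lambda>p. Word [p]) ` box). ?L w *\<^sub>c eval_word w) =
    ?L (Word []) *\<^sub>c eval_word (Word []) + (\<Sum>w\<in>(\<lambda>p. Word [p]) ` box. ?L w *\<^sub>c eval_word w)"
    by (rule sum.insert) auto
  also have "(\<Sum>w\<in>(\<lambda>p. Word [p]) ` box. ?L w *\<^sub>c eval_word w) = (\<Sum>p\<in>box. ?L (Word [p]) *\<^sub>c y_at p)"
    by (subst sum.reindex) (auto simp: inj_on_def eval_word_def case_prod_unfold)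
  also have "eval_word (Word []) = 1" by (simp add: eval_word_def)
  finally show ?thesis by (intro that[of ?W]) (auto simp: bw)
qed

text \<open>Otherwise the constant and linear part would have a leading exponent of degree at most
  \<open>1\<close>, but being \<open>- g\<close> it only has exponents of degree at least
  \<open>2\<close>.\<close>

lemma linear_part_unique:
  assumes g: "g \<in> S_deg 2" and eq: "c0 *\<^sub>c 1 + (\<Sum>p\<in>box. P p *\<^sub>c y_at p) + g = 0"
  shows "c0 = 0" "p \<in> box \<Longrightarrow> P p = 0"
proof -
  define r where "r = Poly_Mapping.single (Word []) c0 + (\<Sum>p\<in>box. Poly_Mapping.single (Word [p]) (P p))"
  have lk: "Poly_Mapping.lookup r w = (if w = Word [] then c0 else 0) + (\<Sum>p\<in>box. if w = Word [p] then P p else 0)" for w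
    unfolding r_def lookup_add lookup_sum by (simp add: lookup_single when_def eq_commute)
  have keys: "w = Word [] \<or> (\<exists>p\<in>box. w = Word [p])" if "w \<in> Poly_Mapping.keys r" for w
  proof (rule ccontr)
    assume *: "\<not> (w = Word [] \<or> (\<exists>p\<in>box. w = Word [p]))"
    then have "Poly_Mapping.lookup r w = 0" unfolding lk by (auto intro!: sum.neutral)
    then show False using that by (simp add: in_keys_iff)
  qed
  have sorted: "sorted_combination r"
    using keys by (fastforce simp: sorted_combination_def carrier_iff box_word_def)
  have phi_r: "phi r = - g"
    using eq by (simp add: r_def phi_add phi_sum phi_single eval_word_def case_prod_unfold eq_neg_iff_add_eq_0)
  have "r = 0"
  proof (rule ccontr)
    assume "r \<noteq> 0"
    then obtain w where w: "phi r \<noteq> 0" "w \<in> Poly_Mapping.keys r" "lead (phi r) = word_expo w"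
      using lead_phi sorted by blast
    have "phi r \<in> A" using sorted phi_in_A by (simp add: sorted_combination_def)
    then have "word_expo w \<in> supp (phi r)" using w lead_in by metis
    then have "word_expo w \<in> supp g" by (simp add: phi_r supp_def)
    then have "2 \<le> degree (word_expo w)" using g by (auto simp: S_deg_def)
    moreover have "box_word w" using sorted w by (auto simp: sorted_combination_def carrier_iff)
    ultimately show False using keys[OF w(2)] by (auto simp: degree_word_expo)
  qed
  then have z: "Poly_Mapping.lookup r w = 0" for w by simp
  show "c0 = 0" using z[of "Word []"] unfolding lk by simp
  show "P p = 0" if "p \<in> box" using z[of "Word [p]"] that unfolding lk by simp
qed

lemma coef_zero_linear_part:
  assumes "g \<in> S_deg 2"
  shows "coef (c0 *\<^sub>c 1 + (\<Sum>p\<in>box. P p *\<^sub>c y_at p) + g) 0 = c0"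
proof -
  have deg0: "degree 0 = 0" by (simp add: degree_def weight_simps)
  have "coef (y_at p) 0 = 0" if "p \<in> box" for p
  proof -
    have "box_word (Word [p])" using that by (simp add: box_word_def)
    then have "0 \<notin> supp (eval_word (Word [p]))" using degree_eval_word[of "Word [p]" 0] deg0 by auto
    then show ?thesis by (simp add: supp_def eval_word_def case_prod_unfold)
  qed
  moreover have "coef g 0 = 0" using assms deg0 by (force simp: S_deg_def supp_def)
  ultimately show ?thesis by (simp add: coef_sum coef_one)
qed

text \<open>Compare the components of least degree of \<open>f * g\<close> and \<open>g * f\<close>.\<close>

lemma no_constant_term:
  assumes f: "f \<in> S" and g: "g \<in> S" "g \<noteq> 0" and eq: "f * g = \<kappa> *\<^sub>c (g * f)" and "\<kappa> \<noteq> 1"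
  shows "coef f 0 = 0"
proof -
  have fin: "finite (supp g)" "supp g \<noteq> {}" using g S_in_A A_finite supp_nonempty by auto
  \<comment> \<open>By \<open>S_supp\<close> exponents in \<open>S\<close> have degree at least
    \<open>0\<close>, and degree \<open>0\<close> only for exponent \<open>0\<close>. At an exponent
    \<open>b0\<close> of least degree in \<open>g\<close>, only the constant term of
    \<open>f\<close> can contribute to either product.\<close>
  then obtain b0 where b0: "b0 \<in> supp g" "\<And>b. b \<in> supp g \<Longrightarrow> degree b0 \<le> degree b"
    by (metis arg_min_on_def arg_min_if_finite(1) arg_min_least)
  have u: "a = 0 \<and> b = b0" if "a \<in> supp f" "b \<in> supp g" "degree a + degree b = degree b0" "a + b = b0" for a b
  proof -
    have "degree a = 0" using S_supp(1)[OF f that(1)] b0(2)[OF that(2)] that(3) by simp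
    then show ?thesis using S_supp(2)[OF f that(1)] that(4) by simp
  qed
  have "coef (f * g) (0 + b0) = coef f 0 * coef g b0 * q powi form 0 b0"
  proof (rule coef_mult_unique[OF S_in_A[OF f] S_in_A[OF g(1)]])
    fix a b assume "a \<in> supp f" "b \<in> supp g" "a + b = 0 + b0"
    then show "a = 0 \<and> b = b0" using u degree_add[of a b] by simp
  qed
  moreover have "coef (g * f) (b0 + 0) = coef g b0 * coef f 0 * q powi form b0 0"
  proof (rule coef_mult_unique[OF S_in_A[OF g(1)] S_in_A[OF f]])
    fix b a assume "b \<in> supp g" "a \<in> supp f" "b + a = b0 + 0"
    then show "b = b0 \<and> a = 0" using u[of a b] degree_add[of a b] by (simp add: add.commute)
  qed
  ultimately have "coef f 0 * coef g b0 = \<kappa> * (coef f 0 * coef g b0)"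
    using eq by (simp add: form_simps mult.commute)
  moreover have "coef g b0 \<noteq> 0" using b0 by (simp add: supp_def)
  ultimately show ?thesis using \<open>\<kappa> \<noteq> 1\<close> by simp
qed

definition twist :: "(nat \<Rightarrow> nat \<Rightarrow> complex) \<Rightarrow> (nat \<times> nat) word \<Rightarrow> complex" where
  "twist c w = prod_list (map (\<lambda>(i, \<alpha>). c i \<alpha>) (letters w))"

lemma quasi_central_word:
  assumes "quasi_central z c" "box_word w"
  shows "z * eval_word w = twist c w *\<^sub>c (eval_word w * z)"
proof -
  have "z * eval_word (Word ws) = twist c (Word ws) *\<^sub>c (eval_word (Word ws) * z)" if "set ws \<subseteq> box" for ws
    using that
  proof (induction ws)
    case Nil
    then show ?case by (simp add: eval_word_def twist_def)
  next
    case (Cons x ws)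
    obtain i \<alpha> where x: "x = (i, \<alpha>)" by (cases x) auto
    have e: "eval_word (Word (x # ws)) = y i \<alpha> * eval_word (Word ws)" "twist c (Word (x # ws)) = c i \<alpha> * twist c (Word ws)"
      by (simp_all add: eval_word_def twist_def x)
    have "z * y i \<alpha> = c i \<alpha> *\<^sub>c (y i \<alpha> * z)"
      using assms(1) Cons.prems by (auto simp: quasi_central_def x box_def)
    then have "z * (y i \<alpha> * eval_word (Word ws)) = c i \<alpha> *\<^sub>c (y i \<alpha> * (z * eval_word (Word ws)))"
      by (simp add: mult.assoc[symmetric])
    then show ?case using Cons by (simp add: e mult.assoc)
  qed
  from this[of "letters w"] assms(2) show ?thesis by (simp add: box_word_def)
qed

lemma quasi_central_words:
  assumes "quasi_central z c" "\<And>w. w \<in> W \<Longrightarrow> box_word w"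
  shows "z * (\<Sum>w\<in>W. d w *\<^sub>c eval_word w) = (\<Sum>w\<in>W. (d w * twist c w) *\<^sub>c eval_word w) * z"
  using quasi_central_word[OF assms(1)] assms(2) by (simp add: sum_distrib_left sum_distrib_right)

lemma quasi_central_imp_normal:
  assumes "quasi_central z c" "f \<in> S"
  shows "\<exists>f'\<in>S. z * f = f' * z"
proof -
  obtain r where r: "sorted_combination r" "f = phi r" using assms S_sorted by blast
  have bw: "box_word w" if "w \<in> Poly_Mapping.keys r" for w
    using that r by (auto simp: sorted_combination_def carrier_iff)
  have "z * f = (\<Sum>w\<in>Poly_Mapping.keys r. (Poly_Mapping.lookup r w * twist c w) *\<^sub>c eval_word w) * z"
    unfolding r(2) phi_def using bw by (rule quasi_central_words[OF assms(1)])
  moreover have "(\<Sum>w\<in>Poly_Mapping.keys r. (Poly_Mapping.lookup r w * twist c w) *\<^sub>c eval_word w) \<in> S"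
    using bw by (intro S_sum S_closed(4) eval_word_S)
  ultimately show ?thesis by blast
qed

section \<open>Injective endomorphisms and the matrices of their linear parts\<close>

definition S_hom :: "(endo \<Rightarrow> endo) \<Rightarrow> bool" where
  "S_hom s \<longleftrightarrow> (\<forall>f\<in>S. s f \<in> S) \<and> inj_on s S \<and> s 1 = 1 \<and> (\<forall>f\<in>S. \<forall>c. s (c *\<^sub>c f) = c *\<^sub>c s f) \<and>
    (\<forall>f\<in>S. \<forall>g\<in>S. s (f + g) = s f + s g \<and> s (f * g) = s f * s g)"

lemma S_hom_simps:
  assumes "S_hom s"
  shows "f \<in> S \<Longrightarrow> s f \<in> S" "s 1 = 1" "f \<in> S \<Longrightarrow> s (c *\<^sub>c f) = c *\<^sub>c s f"
    "f \<in> S \<Longrightarrow> g \<in> S \<Longrightarrow> s (f + g) = s f + s g" "f \<in> S \<Longrightarrow> g \<in> S \<Longrightarrow> s (f * g) = s f * s g" "s 0 = 0"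
    "f \<in> S \<Longrightarrow> f \<noteq> 0 \<Longrightarrow> s f \<noteq> 0"
proof -
  show "f \<in> S \<Longrightarrow> s f \<in> S" "s 1 = 1" "f \<in> S \<Longrightarrow> s (c *\<^sub>c f) = c *\<^sub>c s f"
    "f \<in> S \<Longrightarrow> g \<in> S \<Longrightarrow> s (f + g) = s f + s g" "f \<in> S \<Longrightarrow> g \<in> S \<Longrightarrow> s (f * g) = s f * s g"
    using assms by (auto simp: S_hom_def)
  have "s (0 *\<^sub>c 0) = 0 *\<^sub>c s 0" using assms S_closed(5) unfolding S_hom_def by blast
  then show 0: "s 0 = 0" by simp
  show "f \<in> S \<Longrightarrow> f \<noteq> 0 \<Longrightarrow> s f \<noteq> 0"
    using assms 0 S_closed(5) by (metis S_hom_def inj_onD)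
qed

lemma S_hom_sum:
  assumes "S_hom s" "\<And>i. i \<in> I \<Longrightarrow> f i \<in> S"
  shows "s (\<Sum>i\<in>I. f i) = (\<Sum>i\<in>I. s (f i))"
  using assms(2)
  by (induction I rule: infinite_finite_induct) (simp_all add: S_hom_simps[OF assms(1)] S_sum)

end

context generic_quantum_torus
begin

text \<open>Each generator commutes with another one of its row up to a factor other than
  \<open>1\<close>; the partner exists since \<open>2 \<le> n\<close>. The images satisfy the same
  relation, so \<open>no_constant_term\<close> applies.\<close>

lemma S_hom_generator:
  assumes s: "S_hom s" and n: "2 \<le> n" and p: "p \<in> box"
  shows "s (y_at p) \<in> S_deg 1" "coef (s (y_at p)) 0 = 0"
proof -
  obtain i \<alpha> where p': "p = (i, \<alpha>)" "i \<in> {1..m}" "\<alpha> \<in> {1..n}" using p by (auto simp: box_def)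
  have q1: "q \<noteq> 1" "inverse q \<noteq> 1" using generic[of 1] by auto
  have "\<exists>\<beta>\<in>{1..n}. \<exists>\<kappa>. \<kappa> \<noteq> 1 \<and> y i \<alpha> * y i \<beta> = \<kappa> *\<^sub>c (y i \<beta> * y i \<alpha>)"
  proof (cases "\<alpha> = n")
    case True
    have "y i \<alpha> * y i 1 = inverse q *\<^sub>c (y i 1 * y i \<alpha>)" using True p' n by (intro y.row) auto
    then show ?thesis using q1 n by (intro bexI[of _ 1] exI[of _ "inverse q"] conjI) auto
  next
    case False
    have "y i n * y i \<alpha> = inverse q *\<^sub>c (y i \<alpha> * y i n)" using False p' n by (intro y.row) auto
    then have "y i \<alpha> * y i n = q *\<^sub>c (y i n * y i \<alpha>)" using q_nz by simp
    then show ?thesis using q1 n by (intro bexI[of _ n] exI[of _ q] conjI) auto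
  qed
  then obtain \<beta> \<kappa> where b: "\<beta> \<in> {1..n}" "\<kappa> \<noteq> 1" "y i \<alpha> * y i \<beta> = \<kappa> *\<^sub>c (y i \<beta> * y i \<alpha>)" by blast
  have yS: "y i \<alpha> \<in> S" "y i \<beta> \<in> S" "y i \<beta> \<noteq> 0" using p' b S_closed(7) y_nonzero by auto
  have "s (y i \<alpha>) * s (y i \<beta>) = s (\<kappa> *\<^sub>c (y i \<beta> * y i \<alpha>))"
    using S_hom_simps(5)[OF s yS(1,2)] b(3) by simp
  also have "\<dots> = \<kappa> *\<^sub>c (s (y i \<beta>) * s (y i \<alpha>))"
    using S_hom_simps[OF s] yS S_closed(3) by simp
  finally have "coef (s (y i \<alpha>)) 0 = 0"
    using S_hom_simps[OF s] yS b(2) by (intro no_constant_term) auto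
  then show 0: "coef (s (y_at p)) 0 = 0" using p' by simp
  have "1 \<le> degree a" if "a \<in> supp (s (y_at p))" for a
  proof -
    have S: "s (y_at p) \<in> S" using S_hom_simps[OF s] y_at_S[OF p] by simp
    have "a \<noteq> 0" using that 0 by (auto simp: supp_def)
    then show ?thesis using S_supp[OF S that] by linarith
  qed
  then show "s (y_at p) \<in> S_deg 1"
    using S_hom_simps[OF s] y_at_S[OF p] by (simp add: S_deg_def)
qed

lemma S_hom_word:
  assumes s: "S_hom s" and n: "2 \<le> n" and w: "box_word w"
  shows "s (eval_word w) \<in> S_deg (length (letters w))"
proof -
  have "s (eval_word (Word ws)) \<in> S_deg (length ws)" if "set ws \<subseteq> box" for ws
    using that
  proof (induction ws)
    case Nil
    have "supp 1 = {0}" by (auto simp: supp_def coef_one)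
    then show ?case by (simp add: eval_word_def S_hom_simps[OF s] S_deg_def S_closed degree_def weight_simps)
  next
    case (Cons x ws)
    have "eval_word (Word (x # ws)) = y_at x * eval_word (Word ws)" by (simp add: eval_word_def case_prod_unfold)
    moreover have "eval_word (Word ws) \<in> S" using Cons.prems by (intro eval_word_S) (simp add: box_word_def)
    moreover have "y_at x \<in> S" using Cons.prems y_at_S by simp
    ultimately have "s (eval_word (Word (x # ws))) = s (y_at x) * s (eval_word (Word ws))"
      using S_hom_simps(5)[OF s] by simp
    moreover have "s (y_at x) * s (eval_word (Word ws)) \<in> S_deg (1 + length ws)"
      using Cons s n by (intro S_deg_mult S_hom_generator) auto
    ultimately show ?case by simp
  qed
  from this[of "letters w"] w show ?thesis by (simp add: box_word_def)
qed

lemma S_hom_words: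
  assumes s: "S_hom s" and n: "2 \<le> n" and W: "\<And>w. w \<in> W \<Longrightarrow> box_word w \<and> 2 \<le> length (letters w)"
  shows "s (\<Sum>w\<in>W. c w *\<^sub>c eval_word w) \<in> S_deg 2"
proof -
  have "s (\<Sum>w\<in>W. c w *\<^sub>c eval_word w) = (\<Sum>w\<in>W. c w *\<^sub>c s (eval_word w))"
    using W by (simp add: S_hom_sum[OF s] S_hom_simps[OF s] S_closed eval_word_S)
  also have "\<dots> \<in> S_deg 2"
  proof (intro S_deg_sum S_deg_closed(3))
    fix w assume "w \<in> W"
    then show "s (eval_word w) \<in> S_deg 2"
      using S_hom_word[OF s n, of w] W[of w] by (force simp: S_deg_def)
  qed
  finally show ?thesis .
qed

lemma S_hom_linear_part:
  assumes s: "S_hom s" and n: "2 \<le> n"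
  obtains P W c where "\<And>p w. p \<in> box \<Longrightarrow> w \<in> W p \<Longrightarrow> box_word w \<and> 2 \<le> length (letters w)"
    "\<And>p. p \<in> box \<Longrightarrow> s (y_at p) = (\<Sum>t\<in>box. P t p *\<^sub>c y_at t) + (\<Sum>w\<in>W p. c p w *\<^sub>c eval_word w)"
proof -
  have "\<exists>x. (\<forall>w\<in>fst (snd x). box_word w \<and> 2 \<le> length (letters w)) \<and>
      s (y_at p) = (\<Sum>t\<in>box. fst x t *\<^sub>c y_at t) + (\<Sum>w\<in>fst (snd x). snd (snd x) w *\<^sub>c eval_word w)" if p: "p \<in> box" for p
  proof -
    have "s (y_at p) \<in> S" using S_hom_simps[OF s] y_at_S[OF p] by simp
    then obtain c0 P W c where W: "\<And>w. w \<in> W \<Longrightarrow> box_word w \<and> 2 \<le> length (letters w)"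
      and e: "s (y_at p) = c0 *\<^sub>c 1 + (\<Sum>t\<in>box. P t *\<^sub>c y_at t) + (\<Sum>w\<in>W. c w *\<^sub>c eval_word w)"
      by (rule linear_part) blast
    have "c0 = 0"
      using S_hom_generator(2)[OF s n p] coef_zero_linear_part[OF word_sum_S_deg[OF W]] unfolding e by simp
    then show ?thesis using W e by (intro exI[of _ "(P, W, c)"]) auto
  qed
  then have "\<forall>p\<in>box. \<exists>x. (\<forall>w\<in>fst (snd x). box_word w \<and> 2 \<le> length (letters w)) \<and>
      s (y_at p) = (\<Sum>t\<in>box. fst x t *\<^sub>c y_at t) + (\<Sum>w\<in>fst (snd x). snd (snd x) w *\<^sub>c eval_word w)"
    by (rule ballI)
  from bchoice[OF this] obtain F where "\<forall>p\<in>box. (\<forall>w\<in>fst (snd (F p)). box_word w \<and> 2 \<le> length (letters w)) \<and>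
      s (y_at p) = (\<Sum>t\<in>box. fst (F p) t *\<^sub>c y_at t) + (\<Sum>w\<in>fst (snd (F p)). snd (snd (F p)) w *\<^sub>c eval_word w)" ..
  then show ?thesis by (intro that[of "\<lambda>p. fst (snd (F p))" "\<lambda>t p. fst (F p) t" "\<lambda>p. snd (snd (F p))"]) simp_all
qed

text \<open>The chain rule at the origin: as \<open>s\<close> has no constant terms on generators,
  it sends words of length at least \<open>2\<close> to \<open>S_deg 2\<close>. So the linear part
  of the composite is the product of the matrices \<open>P\<close> and \<open>Q\<close>.\<close>

lemma linear_parts_inverse:
  assumes s: "S_hom s" and n: "2 \<le> n"
    and inv: "\<And>p. p \<in> box \<Longrightarrow> s (s' (y_at p)) = y_at p"
    and W: "\<And>p w. p \<in> box \<Longrightarrow> w \<in> W p \<Longrightarrow> box_word w \<and> 2 \<le> length (letters w)"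
    and P: "\<And>p. p \<in> box \<Longrightarrow> s (y_at p) = (\<Sum>t\<in>box. P t p *\<^sub>c y_at t) + (\<Sum>w\<in>W p. c p w *\<^sub>c eval_word w)"
    and W': "\<And>p w. p \<in> box \<Longrightarrow> w \<in> W' p \<Longrightarrow> box_word w \<and> 2 \<le> length (letters w)"
    and Q: "\<And>p. p \<in> box \<Longrightarrow> s' (y_at p) = (\<Sum>t\<in>box. Q t p *\<^sub>c y_at t) + (\<Sum>w\<in>W' p. c' p w *\<^sub>c eval_word w)"
    and tp: "t \<in> box" "p \<in> box"
  shows "(\<Sum>r\<in>box. P t r * Q r p) = (if t = p then 1 else 0)"
proof -
  let ?g = "\<lambda>r. \<Sum>w\<in>W r. c r w *\<^sub>c eval_word w" and ?g' = "\<Sum>w\<in>W' p. c' p w *\<^sub>c eval_word w"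
  have gS: "?g r \<in> S_deg 2" if "r \<in> box" for r using W[OF that] by (rule word_sum_S_deg)
  have g'S: "?g' \<in> S" using W'[OF tp(2)] by (intro S_sum S_closed(4) eval_word_S) auto
  have yS: "(\<Sum>t\<in>box. Q t p *\<^sub>c y_at t) \<in> S" by (intro S_sum S_closed(4) y_at_S)
  have "y_at p = s ((\<Sum>r\<in>box. Q r p *\<^sub>c y_at r) + ?g')" using inv[OF tp(2)] Q[OF tp(2)] by simp
  also have "\<dots> = (\<Sum>r\<in>box. Q r p *\<^sub>c s (y_at r)) + s ?g'"
    using yS g'S by (simp add: S_hom_simps[OF s] S_hom_sum[OF s] S_closed y_at_S)
  also have "(\<Sum>r\<in>box. Q r p *\<^sub>c s (y_at r)) = (\<Sum>r\<in>box. \<Sum>t\<in>box. (P t r * Q r p) *\<^sub>c y_at t) + (\<Sum>r\<in>box. Q r p *\<^sub>c ?g r)"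
    unfolding sum.distrib[symmetric]
    by (intro sum.cong refl) (simp add: P cscale_add_right cscale_sum_right mult.commute[of "Q _ p"])
  also have "(\<Sum>r\<in>box. \<Sum>t\<in>box. (P t r * Q r p) *\<^sub>c y_at t) = (\<Sum>t\<in>box. (\<Sum>r\<in>box. P t r * Q r p) *\<^sub>c y_at t)"
    by (subst sum.swap) (simp add: cscale_sum_left)
  finally have "(\<Sum>t\<in>box. (\<Sum>r\<in>box. P t r * Q r p) *\<^sub>c y_at t) + (\<Sum>r\<in>box. Q r p *\<^sub>c ?g r) + s ?g' = y_at p" by simp
  also have "y_at p = (\<Sum>t\<in>box. (if t = p then 1 else 0) *\<^sub>c y_at t)"
  proof -
    have "(\<Sum>t\<in>box. (if t = p then 1 else 0) *\<^sub>c y_at t) = (\<Sum>t\<in>box. if t = p then y_at p else 0)"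
      by (intro sum.cong) auto
    then show ?thesis using tp by simp
  qed
  finally have eq: "0 *\<^sub>c 1 + (\<Sum>t\<in>box. ((\<Sum>r\<in>box. P t r * Q r p) - (if t = p then 1 else 0)) *\<^sub>c y_at t) +
      ((\<Sum>r\<in>box. Q r p *\<^sub>c ?g r) + s ?g') = 0"
    by (simp only: cscale_diff_left sum_subtractf cscale_zero_left add_0_left) (simp add: algebra_simps)
  have mem: "(\<Sum>r\<in>box. Q r p *\<^sub>c ?g r) + s ?g' \<in> S_deg 2"
  proof (rule S_deg_closed(1))
    show "(\<Sum>r\<in>box. Q r p *\<^sub>c ?g r) \<in> S_deg 2"
      by (rule S_deg_sum, rule S_deg_closed(3), rule gS)
    show "s ?g' \<in> S_deg 2"
      by (rule S_hom_words[OF s n W'[OF tp(2)]])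
  qed
  have "(\<Sum>r\<in>box. P t r * Q r p) - (if t = p then 1 else 0) = 0"
    by (rule linear_part_unique(2)[of "(\<Sum>r\<in>box. Q r p *\<^sub>c ?g r) + s ?g'" 0
          "\<lambda>t. (\<Sum>r\<in>box. P t r * Q r p) - (if t = p then 1 else 0)" t, OF mem eq tp(1)])
  then show ?thesis by simp
qed

text \<open>Apply \<open>s\<close> to the commutation rule of \<open>f\<close> with
  \<open>y_at p\<close>, move \<open>s f\<close> past every word of \<open>s (y_at p)\<close>,
  cancel it on the right and compare linear coefficients. A nonzero entry of the matrix can only
  link equal eigenvalues.\<close>

lemma linear_part_intertwines:
  assumes s: "S_hom s" and n: "2 \<le> n" and f: "quasi_central f c" "f \<noteq> 0" and z: "quasi_central (s f) c'"
    and W: "\<And>w. w \<in> W \<Longrightarrow> box_word w \<and> 2 \<le> length (letters w)"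
    and P: "s (y_at p) = (\<Sum>t\<in>box. P t *\<^sub>c y_at t) + (\<Sum>w\<in>W. d w *\<^sub>c eval_word w)"
    and tp: "t \<in> box" "p \<in> box" and nz: "P t \<noteq> 0"
  shows "c' (fst t) (snd t) = c (fst p) (snd p)"
proof -
  let ?z = "s f" and ?cp = "c (fst p) (snd p)" and ?g = "\<Sum>w\<in>W. d w *\<^sub>c eval_word w"
    and ?g' = "\<Sum>w\<in>W. (d w * twist c' w) *\<^sub>c eval_word w"
  have fS: "f \<in> S" "s f \<in> S" "s f \<noteq> 0" using f S_hom_simps[OF s] by (auto simp: quasi_central_def)
  have p: "f * y_at p = ?cp *\<^sub>c (y_at p * f)" using f tp by (auto simp: quasi_central_def box_def)
  have z_at: "?z * y_at t = c' (fst t) (snd t) *\<^sub>c (y_at t * ?z)" if "t \<in> box" for t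
    using z that by (auto simp: quasi_central_def box_def)
  have "?z * s (y_at p) = s (f * y_at p)" using S_hom_simps(5)[OF s fS(1) y_at_S[OF tp(2)]] by simp
  also have "\<dots> = ?cp *\<^sub>c (s (y_at p) * ?z)"
    unfolding p using S_hom_simps[OF s] fS y_at_S[OF tp(2)] S_closed(3) by simp
  finally have 1: "?z * s (y_at p) = (?cp *\<^sub>c s (y_at p)) * ?z" by simp
  have "?z * s (y_at p) = ((\<Sum>t\<in>box. (P t * c' (fst t) (snd t)) *\<^sub>c y_at t) + ?g') * ?z"
    unfolding P distrib_left distrib_right
    using quasi_central_words[OF z, of W d] W z_at by (simp add: sum_distrib_left sum_distrib_right)
  then have 2: "((\<Sum>t\<in>box. (P t * c' (fst t) (snd t)) *\<^sub>c y_at t) + ?g') * ?z = (?cp *\<^sub>c s (y_at p)) * ?z"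
    using 1 by simp
  have g: "?g \<in> S_deg 2" "?g' \<in> S_deg 2" using W by (auto intro: word_sum_S_deg)
  have yS: "(\<Sum>t\<in>box. e t *\<^sub>c y_at t) \<in> S" for e by (intro S_sum S_closed(4) y_at_S)
  have "(\<Sum>t\<in>box. (P t * c' (fst t) (snd t)) *\<^sub>c y_at t) + ?g' = ?cp *\<^sub>c s (y_at p)"
    by (rule A_right_cancel[OF _ _ _ _ 2])
      (use g yS fS S_hom_simps(1)[OF s y_at_S[OF tp(2)]] in \<open>auto intro!: S_in_A S_closed simp: S_deg_def\<close>)
  then have "(\<Sum>t\<in>box. (P t * c' (fst t) (snd t)) *\<^sub>c y_at t) + ?g' = (\<Sum>t\<in>box. (?cp * P t) *\<^sub>c y_at t) + ?cp *\<^sub>c ?g"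
    by (simp add: P cscale_add_right cscale_sum_right)
  then have eq: "0 *\<^sub>c 1 + (\<Sum>t\<in>box. (P t * c' (fst t) (snd t) - ?cp * P t) *\<^sub>c y_at t) + (?g' - ?cp *\<^sub>c ?g) = 0"
    by (simp only: cscale_diff_left sum_subtractf cscale_zero_left add_0_left) (simp add: algebra_simps)
  have "P t * c' (fst t) (snd t) - ?cp * P t = 0"
    by (rule linear_part_unique(2)[of "?g' - ?cp *\<^sub>c ?g" 0 "\<lambda>t. P t * c' (fst t) (snd t) - ?cp * P t" t,
          OF S_deg_closed(2)[OF g(2) S_deg_closed(3)[OF g(1)]] eq tp(1)])
  then show ?thesis using nz by simp
qed

end

text \<open>The number of indices with eigenvalue \<open>e\<close> is the trace of a spectral projection, and traces are
  invariant under conjugation.\<close>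

lemma card_eigenvalues_eq:
  fixes P Q :: "'i \<Rightarrow> 'i \<Rightarrow> 'a::field_char_0"
  assumes fin: "finite I"
    and QP: "\<And>p. p \<in> I \<Longrightarrow> (\<Sum>t\<in>I. Q p t * P t p) = 1" and PQ: "\<And>t. t \<in> I \<Longrightarrow> (\<Sum>p\<in>I. P t p * Q p t) = 1"
    and inter: "\<And>t p. t \<in> I \<Longrightarrow> p \<in> I \<Longrightarrow> P t p \<noteq> 0 \<Longrightarrow> c' t = c p"
  shows "card {p \<in> I. c p = e} = card {t \<in> I. c' t = e}"
proof -
  have "(of_nat (card {p \<in> I. c p = e}) :: 'a) = (\<Sum>p\<in>I. if c p = e then 1 else 0)"
    using fin by (simp add: sum.If_cases Int_def)
  also have "\<dots> = (\<Sum>p\<in>I. \<Sum>t\<in>I. if c p = e then Q p t * P t p else 0)"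
    by (intro sum.cong refl) (auto simp: QP)
  also have "\<dots> = (\<Sum>t\<in>I. \<Sum>p\<in>I. if c p = e then Q p t * P t p else 0)"
    by (rule sum.swap)
  \<comment> \<open>Nonzero entries link equal eigenvalues, so membership in the eigenspace may be
    tested at either index.\<close>
  also have "\<dots> = (\<Sum>t\<in>I. \<Sum>p\<in>I. if c' t = e then P t p * Q p t else 0)"
    by (intro sum.cong refl) (use inter in fastforce)
  also have "\<dots> = (\<Sum>t\<in>I. if c' t = e then 1 else 0)"
    by (intro sum.cong refl) (auto simp: PQ)
  also have "\<dots> = of_nat (card {t \<in> I. c' t = e})"
    using fin by (simp add: sum.If_cases Int_def)
  finally show ?thesis by simp
qed

section \<open>The eigenvector property\<close>

context quantum_torus
begin

lemma qdet_in_S: "set is \<subseteq> {1..m} \<Longrightarrow> \<Gamma> \<subseteq> {1..n} \<Longrightarrow> qdet q y is \<Gamma> \<in> S"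
proof (induction "is" arbitrary: \<Gamma>)
  case (Cons i "is")
  have "qdet q y is (\<Gamma> - {\<gamma>}) \<in> S" for \<gamma>
    by (rule Cons.IH) (use Cons.prems in auto)
  then show ?case
    unfolding qdet.simps using Cons.prems by (intro S_sum S_closed) auto
qed (simp add: S_closed)

lemma b_quasi_central:
  assumes "m \<le> n" "1 \<le> k" "k \<le> m + n - 1"
  shows "b k \<in> S" "\<exists>c. quasi_central (b k) c"
proof -
  have "b_rows m n k \<subseteq> {1..m}" "b_cols m n k \<subseteq> {1..n}" "finite (b_rows m n k)"
    using assms by (auto simp: b_rows_def b_cols_def)
  then show S: "b k \<in> S" unfolding b_def by (intro qdet_in_S) auto
  have "\<forall>i\<in>{1..m}. \<forall>\<alpha>\<in>{1..n}. \<exists>c. b k * y i \<alpha> = c *\<^sub>c (y i \<alpha> * b k)"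
    using b_props(4)[OF assms] by blast
  then have "\<forall>i\<in>{1..m}. \<exists>c. \<forall>\<alpha>\<in>{1..n}. b k * y i \<alpha> = c \<alpha> *\<^sub>c (y i \<alpha> * b k)"
    by (intro ballI bchoice) blast
  from bchoice[OF this] S show "\<exists>c. quasi_central (b k) c"
    by (auto simp: quasi_central_def)
qed

lemma quasi_central_diff:
  assumes "quasi_central z c" "quasi_central z' c'" "\<And>i \<alpha>. i \<in> {1..m} \<Longrightarrow> \<alpha> \<in> {1..n} \<Longrightarrow> c i \<alpha> = c' i \<alpha>"
  shows "quasi_central (z - d *\<^sub>c z') c"
  unfolding quasi_central_def
proof (intro conjI ballI)
  show "z - d *\<^sub>c z' \<in> S" using assms by (auto simp: quasi_central_def intro: S_closed)
  fix i \<alpha> assume i: "i \<in> {1..m}" "\<alpha> \<in> {1..n}"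
  have z: "z * y i \<alpha> = c i \<alpha> *\<^sub>c (y i \<alpha> * z)" "z' * y i \<alpha> = c i \<alpha> *\<^sub>c (y i \<alpha> * z')"
    using assms i by (auto simp: quasi_central_def)
  show "(z - d *\<^sub>c z') * y i \<alpha> = c i \<alpha> *\<^sub>c (y i \<alpha> * (z - d *\<^sub>c z'))"
    by (simp add: left_diff_distrib right_diff_distrib z cscale_diff_right mult.commute)
qed

end

context generic_quantum_torus
begin

text \<open>Being the exponent of a word, the leading exponent is nonnegative and supported in
  \<open>box\<close>. Together with \<open>lead_diagonal\<close> this brings
  \<open>diagonal_characterization\<close> into play.\<close>

lemma quasi_central_lead:
  assumes m: "m \<ge> 1" and n: "n = 3 * m" and k: "1 \<le> k" "k \<le> 4 * m - 1" "k \<noteq> 2 * m"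
    and z: "quasi_central z c" "z \<noteq> 0"
    and count: "\<And>e. count_exponent (lead z) e = count_exponent (diagonal k) e"
  shows "lead z = diagonal k"
proof -
  have "z \<in> S" using z by (simp add: quasi_central_def)
  then obtain w where w: "box_word w" "lead z = word_expo w" using S_lead z by metis
  show ?thesis
  proof (rule diagonal_characterization[OF m n k _ _ _ count])
    show "0 \<le> Poly_Mapping.lookup (lead z) p" for p
      by (simp add: w lookup_word_expo)
    show "Poly_Mapping.lookup (lead z) p = 0" if "p \<notin> box" for p
      using w that by (auto simp: lookup_word_expo box_word_def count_list_0_iff)
    show "Poly_Mapping.lookup (lead z) (Suc i, Suc \<alpha>) = Poly_Mapping.lookup (lead z) (i, \<alpha>)"
      if "i \<in> {1..m}" "Suc i \<le> m" "\<alpha> \<in> {1..n}" "Suc \<alpha> \<le> n" for i \<alpha>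
      using lead_diagonal[OF z that] .
  qed
qed

lemma count_exponent_scalars:
  assumes "quasi_central z c" "z \<noteq> 0"
  shows "count_exponent (lead z) e = card {p \<in> box. c (fst p) (snd p) = q powi e}"
proof -
  have "c (fst p) (snd p) = q powi e \<longleftrightarrow> exponent (lead z) (fst p) (snd p) = e" if "p \<in> box" for p
    using quasi_central_scalar[OF assms, of "fst p" "snd p"] that powi_inj by (auto simp: box_def)
  then show ?thesis unfolding count_exponent_def by (intro arg_cong[of _ _ card]) auto
qed

theorem b_eigenvector:
  assumes m: "m \<ge> 1" and n: "n = 3 * m" and k: "1 \<le> k" "k \<le> 4 * m - 1" "k \<noteq> 2 * m"
    and s: "S_hom s" and s': "S_hom s'" and inv: "\<And>f. f \<in> S \<Longrightarrow> s (s' f) = f" "\<And>f. f \<in> S \<Longrightarrow> s' (s f) = f"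
  shows "\<exists>c. c \<noteq> 0 \<and> s (b k) = c *\<^sub>c b k"
proof -
  have n2: "2 \<le> n" and mn: "m \<le> n" and kmn: "k \<le> m + n - 1" using m n k by auto
  have b: "b k \<in> S" "b k \<noteq> 0" "lead (b k) = diagonal k"
    using b_quasi_central(1)[OF mn k(1) kmn] b_props[OF mn k(1) kmn] by auto
  obtain c where c: "quasi_central (b k) c" using b_quasi_central(2)[OF mn k(1) kmn] by blast
  have z: "s (b k) \<in> S" "s (b k) \<noteq> 0" using S_hom_simps[OF s] b by auto
  \<comment> \<open>Normality is transported through \<open>s\<close>, because every
    \<open>f\<close> in \<open>S\<close> is \<open>s (s' f)\<close>.\<close>
  have "\<exists>f'\<in>S. s (b k) * f = f' * s (b k)" if f: "f \<in> S" for f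
  proof -
    have f0: "s' f \<in> S" using S_hom_simps[OF s'] f by simp
    obtain g where g: "g \<in> S" "b k * s' f = g * b k" using quasi_central_imp_normal[OF c f0] by blast
    have "s (b k) * s (s' f) = s g * s (b k)"
      using arg_cong[OF g(2), of s] S_hom_simps(5)[OF s] b f0 g(1) by simp
    then show ?thesis using inv(1)[OF f] S_hom_simps(1)[OF s g(1)] by auto
  qed
  then obtain c' where c': "quasi_central (s (b k)) c'" using quasi_central_normal[OF z] by blast
  obtain P W d where W: "\<And>p w. p \<in> box \<Longrightarrow> w \<in> W p \<Longrightarrow> box_word w \<and> 2 \<le> length (letters w)"
    and P: "\<And>p. p \<in> box \<Longrightarrow> s (y_at p) = (\<Sum>t\<in>box. P t p *\<^sub>c y_at t) + (\<Sum>w\<in>W p. d p w *\<^sub>c eval_word w)"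
    by (rule S_hom_linear_part[OF s n2]) blast
  obtain Q W' d' where W': "\<And>p w. p \<in> box \<Longrightarrow> w \<in> W' p \<Longrightarrow> box_word w \<and> 2 \<le> length (letters w)"
    and Q: "\<And>p. p \<in> box \<Longrightarrow> s' (y_at p) = (\<Sum>t\<in>box. Q t p *\<^sub>c y_at t) + (\<Sum>w\<in>W' p. d' p w *\<^sub>c eval_word w)"
    by (rule S_hom_linear_part[OF s' n2]) blast
  have PQ: "(\<Sum>r\<in>box. P t r * Q r p) = (if t = p then 1 else 0)" if "t \<in> box" "p \<in> box" for t p
    by (rule linear_parts_inverse[OF s n2 inv(1)[OF y_at_S] W P W' Q that])
  have QP: "(\<Sum>r\<in>box. Q t r * P r p) = (if t = p then 1 else 0)" if "t \<in> box" "p \<in> box" for t p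
    by (rule linear_parts_inverse[OF s' n2 inv(2)[OF y_at_S] W' Q W P that])
  have cards: "card {p \<in> box. c (fst p) (snd p) = e} = card {t \<in> box. c' (fst t) (snd t) = e}" for e
  proof (rule card_eigenvalues_eq[where P = P and Q = Q])
    show "finite box" by simp
    show "(\<Sum>t\<in>box. Q p t * P t p) = 1" if "p \<in> box" for p using QP[OF that that] by simp
    show "(\<Sum>p\<in>box. P t p * Q p t) = 1" if "t \<in> box" for t using PQ[OF that that] by simp
    show "c' (fst t) (snd t) = c (fst p) (snd p)" if "t \<in> box" "p \<in> box" "P t p \<noteq> 0" for t p
      by (rule linear_part_intertwines[OF s n2 c b(2) c' W[OF that(2)] P[OF that(2)] that])
  qed
  have "lead (s (b k)) = diagonal k"
    by (rule quasi_central_lead[OF m n k c' z(2)])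
      (simp add: count_exponent_scalars[OF c' z(2)] cards[symmetric] count_exponent_scalars[OF c b(2), unfolded b(3)])
  then have lead: "lead (s (b k)) = lead (b k)" using b by simp
  \<comment> \<open>Eigenvalues depend only on the leading exponent. So \<open>s (b k)\<close> and
    \<open>b k\<close> rescale the generators alike, and their linear combinations do so as
    well.\<close>
  have cc': "c' i \<alpha> = c i \<alpha>" if "i \<in> {1..m}" "\<alpha> \<in> {1..n}" for i \<alpha>
    using quasi_central_scalar[OF c b(2) that] quasi_central_scalar[OF c' z(2) that] lead by simp
  define \<mu> where "\<mu> = coef (s (b k)) (diagonal k) / coef (b k) (diagonal k)"
  let ?z = "s (b k) - \<mu> *\<^sub>c b k"
  have qc: "quasi_central ?z c'" using c' c cc' by (rule quasi_central_diff)
  have nz: "coef (b k) (diagonal k) \<noteq> 0" "coef (s (b k)) (diagonal k) \<noteq> 0"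
    using lead_in[OF S_in_A[OF b(1)] b(2)] lead_in[OF S_in_A[OF z(1)] z(2)] lead b(3) by (simp_all add: supp_def)
  have "?z = 0"
  proof (rule ccontr)
    assume z0: "?z \<noteq> 0"
    \<comment> \<open>The count depends only on the eigenvalues \<open>c'\<close>. So
      \<open>?z\<close> would again lead with \<open>diagonal k\<close>, where \<open>\<mu>\<close>
      was chosen to make its coefficient vanish.\<close>
    have "count_exponent (lead ?z) e = count_exponent (diagonal k) e" for e
      using count_exponent_scalars[OF qc z0] count_exponent_scalars[OF c' z(2)] lead b(3) by simp
    then have "lead ?z = diagonal k" by (rule quasi_central_lead[OF m n k qc z0])
    then have "coef ?z (diagonal k) \<noteq> 0"
      using lead_in[OF S_in_A z0] qc by (auto simp: quasi_central_def supp_def)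
    then show False using nz by (simp add: \<mu>_def)
  qed
  moreover have "\<mu> \<noteq> 0" using nz by (simp add: \<mu>_def)
  ultimately show ?thesis by (intro exI[of _ \<mu>]) simp
qed

end

section \<open>The recursive minors as signed sums over permutations\<close>

definition inversions :: "nat list \<Rightarrow> nat" where
  "inversions xs = card {(a, b). a < b \<and> b < length xs \<and> xs ! b < xs ! a}"

lemma finite_inversions: "finite {(a, b). a < b \<and> b < length xs \<and> xs ! b < xs ! a}"
  by (rule finite_subset[of _ "{..<length xs} \<times> {..<length xs}"]) auto

text \<open>Inversions either involve the first position, and then are counted by the smaller
  entries behind it, or belong to the tail. This matches the exponent in the recursion of
  \<open>qdet\<close>.\<close>

lemma inversions_Cons:
  assumes "distinct (x # xs)"
  shows "inversions (x # xs) = below x (set xs) + inversions xs"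
proof -
  let ?I = "\<lambda>xs. {(a, b). a < b \<and> b < length xs \<and> xs ! b < xs ! a}"
  let ?B = "{b. b < length xs \<and> xs ! b < x}"
  have "?I (x # xs) = (\<lambda>b. (0, Suc b)) ` ?B \<union> (\<lambda>(a, b). (Suc a, Suc b)) ` ?I xs"
  proof (intro Set.set_eqI iffI)
    fix p assume "p \<in> ?I (x # xs)"
    then obtain a b where p: "p = (a, b)" "a < b" "b < length (x # xs)" "(x # xs) ! b < (x # xs) ! a" by auto
    then obtain b' where b': "b = Suc b'" by (cases b) auto
    show "p \<in> (\<lambda>b. (0, Suc b)) ` ?B \<union> (\<lambda>(a, b). (Suc a, Suc b)) ` ?I xs"
      using p b' by (cases a) (auto simp: image_iff)
  qed auto
  moreover have "card ((\<lambda>b. (0, Suc b)) ` ?B \<union> (\<lambda>(a, b). (Suc a, Suc b)) ` ?I xs) =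
      card ((\<lambda>b. (0::nat, Suc b)) ` ?B) + card ((\<lambda>(a, b). (Suc a, Suc b)) ` ?I xs)"
    using finite_inversions by (intro card_Un_disjoint) auto
  moreover have "card ((\<lambda>b. (0::nat, Suc b)) ` ?B) = card ?B" by (intro card_image) (auto simp: inj_on_def)
  moreover have "card ((\<lambda>(a, b). (Suc a, Suc b)) ` ?I xs) = inversions xs"
    unfolding inversions_def by (intro card_image) (auto simp: inj_on_def)
  moreover have "card ?B = below x (set xs)"
  proof -
    have "(\<lambda>b. xs ! b) ` ?B = {y \<in> set xs. y < x}" by (auto simp: in_set_conv_nth)
    moreover have "inj_on (\<lambda>b. xs ! b) ?B" using assms by (auto simp: inj_on_def nth_eq_iff_index_eq)
    ultimately show ?thesis unfolding below_def by (metis card_image)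
  qed
  ultimately show ?thesis by (simp only: inversions_def[of "x # xs"])
qed

lemma qdet_expand:
  assumes "finite \<Gamma>" "card \<Gamma> = length is"
  shows "qdet q Y is \<Gamma> = (\<Sum>xs\<in>permutations_of_set \<Gamma>. (- q) ^ inversions xs *\<^sub>c prod_list (map2 Y is xs))"
  using assms
proof (induction "is" arbitrary: \<Gamma>)
  case Nil
  then show ?case by (simp add: inversions_def)
next
  case (Cons i "is")
  have ne: "\<Gamma> \<noteq> {}" using Cons.prems by auto
  let ?f = "\<lambda>xs. (- q) ^ inversions xs *\<^sub>c prod_list (map2 Y (i # is) xs)"
  have "(\<Sum>xs\<in>permutations_of_set \<Gamma>. ?f xs) = (\<Sum>\<gamma>\<in>\<Gamma>. \<Sum>xs\<in>(#) \<gamma> ` permutations_of_set (\<Gamma> - {\<gamma>}). ?f xs)"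
    unfolding permutations_of_set_nonempty[OF ne] using Cons.prems
    by (intro sum.UNION_disjoint) auto
  also have "\<dots> = (\<Sum>\<gamma>\<in>\<Gamma>. \<Sum>xs\<in>permutations_of_set (\<Gamma> - {\<gamma>}). ?f (\<gamma> # xs))"
    by (rule sum.cong[OF refl], subst sum.reindex) simp_all
  also have "\<dots> = (\<Sum>\<gamma>\<in>\<Gamma>. (- q) ^ below \<gamma> \<Gamma> *\<^sub>c (Y i \<gamma> * qdet q Y is (\<Gamma> - {\<gamma>})))"
  proof (intro sum.cong refl)
    fix \<gamma> assume g: "\<gamma> \<in> \<Gamma>"
    have inv: "inversions (\<gamma> # xs) = below \<gamma> \<Gamma> + inversions xs" if "xs \<in> permutations_of_set (\<Gamma> - {\<gamma>})" for xs
    proof -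
      have xs: "set xs = \<Gamma> - {\<gamma>}" "distinct xs" using that by (auto dest: permutations_of_setD)
      then show ?thesis
        using inversions_Cons[of \<gamma> xs] below_remove[OF Cons.prems(1) g, of \<gamma>] by simp
    qed
    have "qdet q Y is (\<Gamma> - {\<gamma>}) = (\<Sum>xs\<in>permutations_of_set (\<Gamma> - {\<gamma>}). (- q) ^ inversions xs *\<^sub>c prod_list (map2 Y is xs))"
      using Cons.prems g by (intro Cons.IH) auto
    then show "(\<Sum>xs\<in>permutations_of_set (\<Gamma> - {\<gamma>}). ?f (\<gamma> # xs)) = (- q) ^ below \<gamma> \<Gamma> *\<^sub>c (Y i \<gamma> * qdet q Y is (\<Gamma> - {\<gamma>}))"
      by (simp add: inv sum_distrib_left cscale_sum_right power_add)
  qed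
  finally show ?case by simp
qed

text \<open>Injectivity comes from the distinctness of the sorted list; surjectivity follows by
  counting, as both sides have \<open>card \<Gamma>\<close> factorial elements.\<close>

lemma permutes_lists:
  assumes "finite \<Gamma>"
  defines "g \<equiv> sorted_list_of_set \<Gamma>" and "t \<equiv> card \<Gamma>"
  shows "bij_betw (\<lambda>\<pi>. map (\<lambda>k. g ! \<pi> k) [0..<t]) {\<pi>. \<pi> permutes {..<t}} (permutations_of_set \<Gamma>)"
proof -
  have g: "set g = \<Gamma>" "distinct g" "length g = t" using assms by (simp_all add: g_def t_def)
  let ?F = "\<lambda>\<pi>. map (\<lambda>k. g ! \<pi> k) [0..<t]"
  have inj: "inj_on ?F {\<pi>. \<pi> permutes {..<t}}"
  proof (rule inj_onI)
    fix \<pi> \<rho> assume p: "\<pi> \<in> {\<pi>. \<pi> permutes {..<t}}" "\<rho> \<in> {\<pi>. \<pi> permutes {..<t}}" and eq: "?F \<pi> = ?F \<rho>"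
    show "\<pi> = \<rho>"
    proof
      fix k show "\<pi> k = \<rho> k"
      proof (cases "k < t")
        case True
        then have "g ! \<pi> k = g ! \<rho> k" using eq by simp
        moreover have "\<pi> k < t" "\<rho> k < t"
          using p True permutes_in_image[of \<pi> "{..<t}" k] permutes_in_image[of \<rho> "{..<t}" k] by auto
        ultimately show ?thesis using g by (simp add: nth_eq_iff_index_eq)
      next
        case False
        then show ?thesis using p by (simp add: permutes_def)
      qed
    qed
  qed
  have sub: "?F ` {\<pi>. \<pi> permutes {..<t}} \<subseteq> permutations_of_set \<Gamma>"
  proof clarify
    fix \<pi> assume p: "\<pi> permutes {..<t}"
    have "map ((!) g) (map \<pi> [0..<t]) = ?F \<pi>" by simp
    moreover have "set (map \<pi> [0..<t]) = {..<t}" using permutes_image[OF p] by (simp add: atLeast0LessThan)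
    moreover have "distinct (map \<pi> [0..<t])" using permutes_inj_on[OF p] by (simp add: distinct_map inj_on_def)
    moreover have "set (map ((!) g) ls) = \<Gamma>" if "set ls = {..<t}" for ls
    proof -
      have "(!) g ` {..<t} = set g" using g by (auto simp: set_conv_nth)
      then show ?thesis using that g by simp
    qed
    moreover have "inj_on ((!) g) {..<t}" using g by (simp add: inj_on_nth)
    ultimately show "?F \<pi> \<in> permutations_of_set \<Gamma>"
      by (metis distinct_map permutations_of_setI)
  qed
  have "card (?F ` {\<pi>. \<pi> permutes {..<t}}) = card (permutations_of_set \<Gamma>)"
    using card_image[OF inj] card_permutations[of "{..<t}" t] assms(1) by (simp add: t_def)
  then have "?F ` {\<pi>. \<pi> permutes {..<t}} = permutations_of_set \<Gamma>"
    using sub by (intro card_subset_eq) auto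
  then show ?thesis using inj by (simp add: bij_betw_def)
qed

lemma inversions_permuted:
  assumes "sorted_wrt (<) g" "length g = t" "\<pi> permutes {..<t}"
  shows "inversions (map (\<lambda>k. g ! \<pi> k) [0..<t]) = perm_length t \<pi>"
proof -
  have "g ! \<pi> b < g ! \<pi> a \<longleftrightarrow> \<pi> b < \<pi> a" if "a < t" "b < t" for a b
  proof -
    have "\<pi> a < t" "\<pi> b < t"
      using that assms(3) permutes_in_image[of \<pi> "{..<t}" a] permutes_in_image[of \<pi> "{..<t}" b] by auto
    then show ?thesis
      using assms(1,2) sorted_wrt_nth_less[OF assms(1)] by (metis linorder_neqE_nat order_less_asym)
  qed
  then show ?thesis
    unfolding inversions_def perm_length_def by (intro arg_cong[of _ _ card]) auto
qed

context quantum_torus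
begin

lemma phi_prod_list: "phi (prod_list ps) = prod_list (map phi ps)"
  by (induction ps) (simp_all add: phi_mult)

lemma phi_free_minor:
  assumes "finite I" "finite \<Gamma>" "card I = card \<Gamma>"
  shows "phi (free_minor q I \<Gamma>) = qdet q y (sorted_list_of_set I) \<Gamma>"
proof -
  let ?t = "card I" and ?is = "sorted_list_of_set I" and ?g = "sorted_list_of_set \<Gamma>"
  have "phi (free_minor q I \<Gamma>) = (\<Sum>\<pi> | \<pi> permutes {..<?t}. (- q) ^ perm_length ?t \<pi> *\<^sub>c
      prod_list (map (\<lambda>k. y (?is ! k) (?g ! \<pi> k)) [0..<?t]))"
    by (simp add: free_minor_def phi_sum phi_mult phi_prod_list comp_def)
  also have "\<dots> = (\<Sum>\<pi> | \<pi> permutes {..<?t}. (- q) ^ inversions (map (\<lambda>k. ?g ! \<pi> k) [0..<?t]) *\<^sub>c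
      prod_list (map2 y ?is (map (\<lambda>k. ?g ! \<pi> k) [0..<?t])))"
  proof (intro sum.cong refl)
    fix \<pi> assume "\<pi> \<in> {\<pi>. \<pi> permutes {..<?t}}"
    then have "inversions (map (\<lambda>k. ?g ! \<pi> k) [0..<?t]) = perm_length ?t \<pi>"
      using assms by (intro inversions_permuted) auto
    moreover have "map2 y ?is (map (\<lambda>k. ?g ! \<pi> k) [0..<?t]) = map (\<lambda>k. y (?is ! k) (?g ! \<pi> k)) [0..<?t]"
      by (rule nth_equalityI) (use assms in auto)
    ultimately show "(- q) ^ perm_length ?t \<pi> *\<^sub>c prod_list (map (\<lambda>k. y (?is ! k) (?g ! \<pi> k)) [0..<?t]) =
      (- q) ^ inversions (map (\<lambda>k. ?g ! \<pi> k) [0..<?t]) *\<^sub>c prod_list (map2 y ?is (map (\<lambda>k. ?g ! \<pi> k) [0..<?t]))"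
      by simp
  qed
  also have "\<dots> = (\<Sum>xs\<in>permutations_of_set \<Gamma>. (- q) ^ inversions xs *\<^sub>c prod_list (map2 y ?is xs))"
    using sum.reindex_bij_betw[OF permutes_lists[OF assms(2)]] assms(3) by simp
  also have "\<dots> = qdet q y ?is \<Gamma>"
    using assms by (intro qdet_expand[symmetric]) auto
  finally show ?thesis .
qed

lemma free_minor_carrier:
  assumes "I \<subseteq> {1..m}" "\<Gamma> \<subseteq> {1..n}" "card I = card \<Gamma>"
  shows "free_minor q I \<Gamma> \<in> carrier (free_alg m n)"
proof -
  have fin: "finite I" "finite \<Gamma>" using assms finite_subset by blast+
  have sum: "(\<Sum>x\<in>X. f x) \<in> carrier (free_alg m n)" if "\<And>x. x \<in> X \<Longrightarrow> f x \<in> carrier (free_alg m n)" for X :: "(nat \<Rightarrow> nat) set" and f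
    using that by (induction X rule: infinite_finite_induct) (auto intro: free_alg_plus free_alg_zero)
  have prod: "prod_list ps \<in> carrier (free_alg m n)" if "set ps \<subseteq> carrier (free_alg m n)" for ps
    using that by (induction ps) (auto intro: free_alg_times free_alg_one)
  show ?thesis
    unfolding free_minor_def
  proof (intro sum free_alg_times scal_closed prod subsetI)
    fix \<pi> p assume p: "\<pi> \<in> {\<pi>. \<pi> permutes {..<card I}}"
      "p \<in> set (map (\<lambda>k. gen (sorted_list_of_set I ! k) (sorted_list_of_set \<Gamma> ! \<pi> k)) [0..<card I])"
    then obtain k where k: "k < card I" "p = gen (sorted_list_of_set I ! k) (sorted_list_of_set \<Gamma> ! \<pi> k)" by auto
    have "\<pi> k < card \<Gamma>" using p k assms permutes_in_image[of \<pi> "{..<card I}" k] by auto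
    then have "sorted_list_of_set I ! k \<in> I" "sorted_list_of_set \<Gamma> ! \<pi> k \<in> \<Gamma>"
      using k fin by (metis nth_mem set_sorted_list_of_set sorted_list_of_set.length_sorted_key_list_of_set)+
    then have "sorted_list_of_set I ! k \<in> {1..m}" "sorted_list_of_set \<Gamma> ! \<pi> k \<in> {1..n}"
      using assms by blast+
    then show "p \<in> carrier (free_alg m n)" unfolding k(2) by (rule gen_closed)
  qed
qed

end

section \<open>Transfer to the coset algebra\<close>

lemma carrier_Oq: "carrier (Oq q m n) = qm_class q m n ` carrier (free_alg m n)"
  by (auto simp: Oq_simps FactRing_def A_RCOSETS_def' qm_class_def)

lemma qm_class_hom:
  assumes "p \<in> carrier (free_alg m n)" "r \<in> carrier (free_alg m n)"
  shows "qm_class q m n p \<otimes>\<^bsub>Oq q m n\<^esub> qm_class q m n r = qm_class q m n (p * r)"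
    "qm_class q m n p \<oplus>\<^bsub>Oq q m n\<^esub> qm_class q m n r = qm_class q m n (p + r)"
    "\<one>\<^bsub>Oq q m n\<^esub> = qm_class q m n 1"
proof -
  interpret I: ideal "qm_ideal q m n" "free_alg m n" by (rule ideal_qm_ideal)
  show "qm_class q m n p \<otimes>\<^bsub>Oq q m n\<^esub> qm_class q m n r = qm_class q m n (p * r)"
    using I.rcoset_mult_add[OF assms] by (simp add: Oq_simps FactRing_def qm_class_def free_alg_simps)
  show "qm_class q m n p \<oplus>\<^bsub>Oq q m n\<^esub> qm_class q m n r = qm_class q m n (p + r)"
    using I.a_rcos_sum[OF assms] by (simp add: Oq_simps FactRing_def qm_class_def free_alg_simps)
  show "\<one>\<^bsub>Oq q m n\<^esub> = qm_class q m n 1"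
    by (simp add: Oq_simps FactRing_def qm_class_def free_alg_simps)
qed

context quantum_torus
begin

abbreviation "F \<equiv> carrier (free_alg m n)"
abbreviation "cls \<equiv> qm_class q m n"
abbreviation "R \<equiv> Oq q m n"

text \<open>Here \<open>phi_ideal\<close> and \<open>phi_kernel\<close> come together: cosets
  correspond to elements of \<open>S\<close>.\<close>

lemma class_eq_iff: "p \<in> F \<Longrightarrow> r \<in> F \<Longrightarrow> cls p = cls r \<longleftrightarrow> phi p = phi r"
  using phi_ideal[of "p - r"] phi_kernel[of "p - r"] free_alg_minus[of p m n r]
  by (auto simp: qm_class_eq_iff phi_minus)

text \<open>\<open>\<sigma>\<close> acts on cosets. Its counterpart on \<open>S\<close> uses chosen
  representatives on both sides, and \<open>lift_phi\<close> shows that the choices do not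
  matter.\<close>

definition lift :: "(qm_free set \<Rightarrow> qm_free set) \<Rightarrow> endo \<Rightarrow> endo" where
  "lift \<sigma> f = phi (SOME p'. p' \<in> F \<and> cls p' = \<sigma> (cls (SOME p. p \<in> F \<and> phi p = f)))"

lemma lift_phi:
  assumes "p \<in> F" "p' \<in> F" "cls p' = \<sigma> (cls p)"
  shows "lift \<sigma> (phi p) = phi p'"
proof -
  let ?p = "SOME r. r \<in> F \<and> phi r = phi p"
  have p: "?p \<in> F \<and> phi ?p = phi p" by (rule someI[of _ p]) (simp add: assms)
  then have cp: "cls ?p = cls p" using class_eq_iff assms by blast
  let ?p' = "SOME r. r \<in> F \<and> cls r = \<sigma> (cls ?p)"
  have "?p' \<in> F \<and> cls ?p' = \<sigma> (cls ?p)" by (rule someI[of _ p']) (simp add: assms cp)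
  then have "?p' \<in> F" "cls ?p' = cls p'" using cp assms by auto
  then have "phi ?p' = phi p'" using class_eq_iff assms by blast
  then show ?thesis by (simp add: lift_def)
qed

lemma representative:
  assumes "\<sigma> ` carrier R \<subseteq> carrier R" "p \<in> F"
  obtains p' where "p' \<in> F" "cls p' = \<sigma> (cls p)"
proof -
  have "\<sigma> (cls p) \<in> carrier R" using assms by (auto simp: carrier_Oq)
  then show ?thesis using that by (auto simp: carrier_Oq)
qed

lemma S_hom_lift:
  assumes \<sigma>: "\<sigma> \<in> algebra_auto R"
  shows "S_hom (lift \<sigma>)"
proof -
  have iso: "\<sigma> \<in> ring_hom R R" "bij_betw \<sigma> (carrier R) (carrier R)"
    and smult: "\<And>c x. x \<in> carrier R \<Longrightarrow> \<sigma> (c \<odot>\<^bsub>R\<^esub> x) = c \<odot>\<^bsub>R\<^esub> \<sigma> x"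
    using \<sigma> by (auto simp: algebra_auto_def ring_iso_def)
  have closed: "\<sigma> ` carrier R \<subseteq> carrier R" using iso(2) by (simp add: bij_betw_def)
  have cR: "cls p \<in> carrier R" if "p \<in> F" for p using that by (auto simp: carrier_Oq)
  have one: "lift \<sigma> 1 = 1"
    using lift_phi[OF free_alg_one free_alg_one, of \<sigma>] ring_hom_one[OF iso(1)] qm_class_hom(3)[OF free_alg_one free_alg_one]
    by simp
  have rep: "\<exists>p p'. p \<in> F \<and> p' \<in> F \<and> cls p' = \<sigma> (cls p) \<and> f = phi p \<and> lift \<sigma> f = phi p'" if f: "f \<in> S" for f
  proof -
    obtain p where p: "p \<in> F" "f = phi p" using f by (auto simp: S_def)
    obtain p' where p': "p' \<in> F" "cls p' = \<sigma> (cls p)" by (rule representative[OF closed p(1)])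
    show ?thesis using p p' lift_phi[of p p' \<sigma>] by blast
  qed
  have inj: "inj_on (lift \<sigma>) S"
  proof (rule inj_onI)
    fix f g assume f: "f \<in> S" and g: "g \<in> S" and eq: "lift \<sigma> f = lift \<sigma> g"
    obtain p p' where p: "p \<in> F" "p' \<in> F" "cls p' = \<sigma> (cls p)" "f = phi p" "lift \<sigma> f = phi p'"
      using rep[OF f] by blast
    obtain r r' where r: "r \<in> F" "r' \<in> F" "cls r' = \<sigma> (cls r)" "g = phi r" "lift \<sigma> g = phi r'"
      using rep[OF g] by blast
    have "phi p' = phi r'" using eq p(5) r(5) by simp
    then have "cls p' = cls r'" using class_eq_iff p(2) r(2) by blast
    then have "\<sigma> (cls p) = \<sigma> (cls r)" using p(3) r(3) by simp
    then have "cls p = cls r" using iso(2) cR[OF p(1)] cR[OF r(1)] by (auto simp: bij_betw_def dest: inj_onD)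
    then show "f = g" using p(1,4) r(1,4) class_eq_iff by blast
  qed
  have hom: "lift \<sigma> (f + g) = lift \<sigma> f + lift \<sigma> g \<and> lift \<sigma> (f * g) = lift \<sigma> f * lift \<sigma> g"
    if f: "f \<in> S" and g: "g \<in> S" for f g
  proof -
    obtain p p' where p: "p \<in> F" "p' \<in> F" "cls p' = \<sigma> (cls p)" "f = phi p" "lift \<sigma> f = phi p'"
      using rep[OF f] by blast
    obtain r r' where r: "r \<in> F" "r' \<in> F" "cls r' = \<sigma> (cls r)" "g = phi r" "lift \<sigma> g = phi r'"
      using rep[OF g] by blast
    have "cls (p' + r') = \<sigma> (cls (p + r))"
      using qm_class_hom(2)[OF p(2) r(2), of q] qm_class_hom(2)[OF p(1) r(1), of q] ring_hom_add[OF iso(1) cR[OF p(1)] cR[OF r(1)]] p r by simp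
    moreover have "cls (p' * r') = \<sigma> (cls (p * r))"
      using qm_class_hom(1)[OF p(2) r(2), of q] qm_class_hom(1)[OF p(1) r(1), of q] ring_hom_mult[OF iso(1) cR[OF p(1)] cR[OF r(1)]] p r by simp
    ultimately show ?thesis
      using lift_phi[of "p + r" "p' + r'" \<sigma>] lift_phi[of "p * r" "p' * r'" \<sigma>] p r
      by (simp add: free_alg_plus free_alg_times phi_add phi_mult)
  qed
  have scal: "lift \<sigma> (c *\<^sub>c f) = c *\<^sub>c lift \<sigma> f" if f: "f \<in> S" for f c
  proof -
    obtain p p' where p: "p \<in> F" "p' \<in> F" "cls p' = \<sigma> (cls p)" "f = phi p" "lift \<sigma> f = phi p'"
      using rep[OF f] by blast
    have "cls (scal c * p') = \<sigma> (cls (scal c * p))"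
      using qm_smult_class[OF p(1), where c = c and q = q] qm_smult_class[OF p(2), where c = c and q = q] smult[OF cR[OF p(1)], of c] p(3) by simp
    then show ?thesis
      using lift_phi[of "scal c * p" "scal c * p'" \<sigma>] p
      by (simp add: free_alg_times scal_closed phi_mult)
  qed
  have "lift \<sigma> f \<in> S" if "f \<in> S" for f
    using rep[OF that] by (auto simp: S_def)
  then show ?thesis unfolding S_hom_def using one inj hom scal by blast
qed

lemma algebra_auto_inverse:
  assumes "\<sigma> \<in> algebra_auto R"
  shows "inv_into (carrier R) \<sigma> \<in> algebra_auto R"
proof -
  have iso: "\<sigma> \<in> ring_iso R R" and bij: "bij_betw \<sigma> (carrier R) (carrier R)"
    and smult: "\<And>c x. x \<in> carrier R \<Longrightarrow> \<sigma> (c \<odot>\<^bsub>R\<^esub> x) = c \<odot>\<^bsub>R\<^esub> \<sigma> x"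
    using assms by (auto simp: algebra_auto_def ring_iso_def)
  have "inv_into (carrier R) \<sigma> (c \<odot>\<^bsub>R\<^esub> x) = c \<odot>\<^bsub>R\<^esub> inv_into (carrier R) \<sigma> x" if x: "x \<in> carrier R" for c x
  proof -
    let ?y = "inv_into (carrier R) \<sigma> x"
    have y: "?y \<in> carrier R" "\<sigma> ?y = x"
      using bij x by (metis bij_betw_def inv_into_into, metis bij_betw_inv_into_right)
    have "c \<odot>\<^bsub>R\<^esub> ?y \<in> carrier R"
    proof -
      obtain p where p: "p \<in> F" "?y = cls p" using y by (auto simp: carrier_Oq)
      then show ?thesis
        using qm_smult_class[OF p(1), where c = c and q = q] by (auto simp: carrier_Oq free_alg_times scal_closed)
    qed
    then have "inv_into (carrier R) \<sigma> (\<sigma> (c \<odot>\<^bsub>R\<^esub> ?y)) = c \<odot>\<^bsub>R\<^esub> ?y"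
      using bij by (metis bij_betw_inv_into_left)
    then show ?thesis using smult[OF y(1)] y(2) by simp
  qed
  then show ?thesis
    using ring_iso_set_sym[OF ring_Oq iso] by (auto simp: algebra_auto_def)
qed

lemma lift_inverse:
  assumes "\<sigma> \<in> algebra_auto R" "\<tau> \<in> algebra_auto R" "\<And>x. x \<in> carrier R \<Longrightarrow> \<sigma> (\<tau> x) = x" "f \<in> S"
  shows "lift \<sigma> (lift \<tau> f) = f"
proof -
  have closed: "\<tau> ` carrier R \<subseteq> carrier R"
    using assms(2) by (auto simp: algebra_auto_def ring_iso_def bij_betw_def)
  obtain p where p: "p \<in> F" "f = phi p" using assms by (auto simp: S_def)
  obtain p' where p': "p' \<in> F" "cls p' = \<tau> (cls p)" by (rule representative[OF closed p(1)])
  have "\<sigma> (cls p') = cls p" using assms(3) p p' by (auto simp: carrier_Oq)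
  then show ?thesis using lift_phi[of p p' \<tau>] lift_phi[of p' p \<sigma>] p p' by simp
qed

end

theorem proposition3p8:
  fixes q :: complex and m n :: nat and \<sigma> :: "qm_free set \<Rightarrow> qm_free set"
  assumes "q \<noteq> 0"
    and "\<forall>k\<ge>1::nat. q ^ k \<noteq> 1"
    and "m \<ge> 1"
    and "n = 3 * m"
    and "\<sigma> \<in> algebra_auto (Oq q m n)"
  shows "\<forall>i \<in> {1..4 * m - 1}. i \<noteq> 2 * m \<longrightarrow>
    (\<exists>c::complex. c \<noteq> 0 \<and> \<sigma> (b_minor q m n i) = c \<odot>\<^bsub>Oq q m n\<^esub> b_minor q m n i)"
proof (intro ballI impI)
  fix i assume i: "i \<in> {1..4 * m - 1}" "i \<noteq> 2 * m"
  interpret generic_quantum_torus q m n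
    by unfold_locales (use assms in auto)
  have mn: "m \<le> n" "1 \<le> i" "i \<le> m + n - 1" using i assms by auto
  let ?\<tau> = "inv_into (carrier R) \<sigma>"
  have \<tau>: "?\<tau> \<in> algebra_auto R" by (rule algebra_auto_inverse[OF assms(5)])
  have bij: "bij_betw \<sigma> (carrier R) (carrier R)" using assms(5) by (auto simp: algebra_auto_def ring_iso_def)
  have inv: "\<sigma> (?\<tau> x) = x" "?\<tau> (\<sigma> x) = x" if "x \<in> carrier R" for x
    using bij_betw_inv_into_right[OF bij that] bij_betw_inv_into_left[OF bij that] by auto
  obtain c where c: "c \<noteq> 0" "lift \<sigma> (b i) = c *\<^sub>c b i"
    using b_eigenvector[OF assms(3,4) _ _ i(2) S_hom_lift[OF assms(5)] S_hom_lift[OF \<tau>]]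
      lift_inverse[OF assms(5) \<tau> inv(1)] lift_inverse[OF \<tau> assms(5) inv(2)] i(1) by auto
  let ?P = "free_minor q (b_rows m n i) (b_cols m n i)"
  obtain r s t where rs: "b_rows m n i = {r..<r + t}" "b_cols m n i = {s..<s + t}" "1 \<le> r" "1 \<le> s"
    "r + t \<le> Suc m" "s + t \<le> Suc n"
    by (rule b_intervals[OF mn])
  have P: "?P \<in> F" "phi ?P = b i"
  proof -
    have *: "b_rows m n i \<subseteq> {1..m}" "b_cols m n i \<subseteq> {1..n}" "card (b_rows m n i) = card (b_cols m n i)"
      "finite (b_rows m n i)" "finite (b_cols m n i)"
      using rs by auto
    show "?P \<in> F" by (rule free_minor_carrier[OF *(1-3)])
    show "phi ?P = b i" unfolding b_def by (rule phi_free_minor[OF *(4,5,3)])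
  qed
  have closed: "\<sigma> ` carrier R \<subseteq> carrier R" using bij by (simp add: bij_betw_def)
  obtain P' where P': "P' \<in> F" "cls P' = \<sigma> (cls ?P)" by (rule representative[OF closed P(1)])
  \<comment> \<open>The eigenvector equation in the torus is pulled back to cosets through
    representatives in the free algebra.\<close>
  have "phi P' = phi (scal c * ?P)"
    using lift_phi[of ?P P' \<sigma>] P(1) P' c(2) P(2) by (simp add: phi_mult)
  then have "cls P' = cls (scal c * ?P)"
    using class_eq_iff[OF P'(1) free_alg_times[OF scal_closed P(1)]] by simp
  then have "\<sigma> (b_minor q m n i) = c \<odot>\<^bsub>R\<^esub> b_minor q m n i"
    using P' qm_smult_class[OF P(1), where c = c and q = q] by (simp add: b_minor_rows_cols quantum_minor_def)
  then show "\<exists>c. c \<noteq> 0 \<and> \<sigma> (b_minor q m n i) = c \<odot>\<^bsub>R\<^esub> b_minor q m n i"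
    using c(1) by blast
qed

end
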